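(* Let $\boldsymbol{A}\in \mathbb{DQ}^{m \times n}$, $\boldsymbol{B}\in \mathbb{DQ}^{p \times n}$, $\boldsymbol{C}=\begin{pmatrix}\boldsymbol{A}\\ \boldsymbol{B}\end{pmatrix}\in \mathbb{DQ}^{(m+p) \times n}$, with $\mathrm{rank}(\boldsymbol{C})=k$ and $\mathrm{Arank}(\boldsymbol{C})=t$, and put $s=k-t$. (I) There exist unitary dual quaternion matrices $\boldsymbol{U}\in \mathbb{DQ}^{m \times m}$, $\boldsymbol{V}\in \mathbb{DQ}^{p \times p}$ and a dual quaternion matrix $\boldsymbol{X}\in \mathbb{DQ}^{n \times n}$ such that $$\boldsymbol{A}=\boldsymbol{U}(\Sigma_{\boldsymbol{A}},\ 0)\boldsymbol{X},\qquad \boldsymbol{B}=\boldsymbol{V}(\Sigma_{\boldsymbol{B}},\ 0)\boldsymbol{X},$$ where, for some nonnegative integers $r,r_1,q,t_1$ with $r_1\le r$, the matrices $\Sigma_{\boldsymbol{A}}$ ($m\times k$) and $\Sigma_{\boldsymbol{B}}$ ($p\times k$) are $$\Sigma_{\boldsymbol{A}}=\begin{pmatrix} I&0&0&0\\ 0&S_{\boldsymbol{A}}&0&0\\ 0&0&\Xi\epsilon&0\\ 0&0&0&0\end{pmatrix},\qquad \Sigma_{\boldsymbol{B}}=\begin{pmatrix}\Sigma\epsilon&0&0&0&0\\ 0&0&0&0&0\\ 0&0&S_{\boldsymbol{B}}&0&0\\ 0&0&0&I&0\\ 0&0&0&0&I\end{pmatrix};$$ the block rows of $\Sigma_{\boldsymbol{A}}$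 have sizes $r,\ q,\ t_1,\ m-r-q-t_1$ and its block columns have sizes $r,\ q,\ t_1,\ k-r-q-t_1$; the block rows of $\Sigma_{\boldsymbol{B}}$ have sizes $r_1,\ p+r-k-r_1,\ q,\ t_1,\ k-r-q-t_1$ and its block columns have sizes $r_1,\ r-r_1,\ q,\ t_1,\ k-r-q-t_1$. Here $\Sigma=\mathrm{diag}(\sigma_1,\dots,\sigma_{r_1})$ and $\Xi=\mathrm{diag}(\xi_1,\dots,\xi_{t_1})$ are real with $\sigma_1\ge\cdots\ge\sigma_{r_1}>0$, $\xi_1\ge\cdots\ge\xi_{t_1}>0$, and $S_{\boldsymbol{A}}=\mathrm{diag}(c_1,\dots,c_q)$, $S_{\boldsymbol{B}}=\mathrm{diag}(s_1,\dots,s_q)$ have appreciable dual number entries with $0<c_1\le\cdots\le c_q<1$, $1>s_1\ge\cdots\ge s_q>0$, and $c_i^2+s_i^2=1$ for $i=1,\dots,q$. (II) More precisely, there exist unitary dual quaternion matrices $\hat{\boldsymbol{U}}\in \mathbb{DQ}^{m \times m}$, $\hat{\boldsymbol{V}}\in \mathbb{DQ}^{p \times p}$ and a nonsingular dual quaternion matrix $\hat{\boldsymbol{X}}\in \mathbb{DQ}^{n \times n}$ such that $$\boldsymbol{A}=\hat{\boldsymbol{U}}(\hat\Sigma_{\boldsymbol{A}},\ \boldsymbol{N}_{\boldsymbol{A}}\epsilon,\ 0)\hat{\boldsymbol{X}},\qquad \boldsymbol{B}=\hat{\boldsymbol{V}}(\hat\Sigma_{\boldsymbol{B}},\ \boldsymbol{N}_{\boldsymbol{B}}\epsilon,\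 0)\hat{\boldsymbol{X}},$$ where $\boldsymbol{N}_{\boldsymbol{A}}\in\mathbb{DQ}^{m\times s}$, $\boldsymbol{N}_{\boldsymbol{B}}\in\mathbb{DQ}^{p\times s}$, the matrix $\begin{pmatrix}\boldsymbol{N}_{\boldsymbol{A}}\\ \boldsymbol{N}_{\boldsymbol{B}}\end{pmatrix}$ has orthonormal columns, and, for some nonnegative integers $\hat r,\hat r_1,\hat q,\hat t$ with $\hat r_1\le\hat r$, the matrices $\hat\Sigma_{\boldsymbol{A}}$ ($m\times t$) and $\hat\Sigma_{\boldsymbol{B}}$ ($p\times t$) are $$\hat\Sigma_{\boldsymbol{A}}=\begin{pmatrix} I&0&0&0\\ 0&\hat S_{\boldsymbol{A}}&0&0\\ 0&0&\hat\Xi\epsilon&0\\ 0&0&0&0\end{pmatrix},\qquad \hat\Sigma_{\boldsymbol{B}}=\begin{pmatrix}\hat\Sigma\epsilon&0&0&0&0\\ 0&0&0&0&0\\ 0&0&\hat S_{\boldsymbol{B}}&0&0\\ 0&0&0&I&0\\ 0&0&0&0&I\end{pmatrix};$$ the block rows of $\hat\Sigma_{\boldsymbol{A}}$ have sizes $\hat r,\ \hat q,\ \hat t,\ m-\hat r-\hat q-\hat t$ and its block columns have sizes $\hat r,\ \hat q,\ \hat t,\ t-\hat r-\hat q-\hat t$; the block rows of $\hat\Sigma_{\boldsymbol{B}}$ have sizes $\hat r_1,\ p+\hat r-t-\hat r_1,\ \hat q,\ \hat t,\ t-\hat r-\hat q-\hat t$ and its block columns have sizes $\hat r_1,\ \hat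 r-\hat r_1,\ \hat q,\ \hat t,\ t-\hat r-\hat q-\hat t$. Here $\hat\Sigma=\mathrm{diag}(\hat\sigma_1,\dots,\hat\sigma_{\hat r_1})$ and $\hat\Xi=\mathrm{diag}(\hat\xi_1,\dots,\hat\xi_{\hat t})$ are real with $\hat\sigma_1\ge\cdots\ge\hat\sigma_{\hat r_1}>0$, $\hat\xi_1\ge\cdots\ge\hat\xi_{\hat t}>0$, and $\hat S_{\boldsymbol{A}}=\mathrm{diag}(\hat c_1,\dots,\hat c_{\hat q})$, $\hat S_{\boldsymbol{B}}=\mathrm{diag}(\hat s_1,\dots,\hat s_{\hat q})$ have appreciable dual number entries with $0<\hat c_1\le\cdots\le\hat c_{\hat q}<1$, $1>\hat s_1\ge\cdots\ge\hat s_{\hat q}>0$, and $\hat c_i^2+\hat s_i^2=1$ for $i=1,\dots,\hat q$.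
   Context: Dual numbers: $\mathbb{D}=\{a+b\epsilon: a,b\in\mathbb{R}\}$ with $\epsilon\neq0$, $\epsilon^2=0$; $a+b\epsilon$ is appreciable if $a\ne0$ and infinitesimal otherwise. $\mathbb{D}$ is totally ordered lexicographically: $a+b\epsilon>a'+b'\epsilon$ iff $a>a'$, or $a=a'$ and $b>b'$. $\mathbb{Q}$ denotes the real (Hamilton) quaternions, and $\mathbb{DQ}=\{\mathbf{q}_{st}+\mathbf{q}_{in}\epsilon:\mathbf{q}_{st},\mathbf{q}_{in}\in\mathbb{Q}\}$ the dual quaternions, where $\epsilon$ commutes with quaternions; conjugation is $\mathbf{q}_{st}^*+\mathbf{q}_{in}^*\epsilon$. A matrix $\boldsymbol{A}\in\mathbb{DQ}^{m\times n}$ is written $\mathbf{A}_{st}+\mathbf{A}_{in}\epsilon$ with $\mathbf{A}_{st},\mathbf{A}_{in}\in\mathbb{Q}^{m\times n}$, and $\boldsymbol{A}^*$ is its conjugate transpose. A square $\boldsymbol{U}$ is unitary if $\boldsymbol{U}^*\boldsymbol{U}=\boldsymbol{U}\boldsymbol{U}^*=I$; a square matrix is nonsingular if it has a two-sided inverse. A matrix $\boldsymbol{N}$ has orthonormal columns if $\boldsymbol{N}^*\boldsymbol{N}=I$. Rank: every $\boldsymbol{A}\in\mathbb{DQ}^{m\times n}$ has a singular value decomposition (known) $\boldsymbol{U}^*\boldsymbol{A}\boldsymbol{V}=\begin{pmatrix}\mathrm{diag}(\mu_1,\dots,\mu_t)&0\\0&0\end{pmatrix}$ with $\boldsymbol{U},\boldsymbol{V}$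 unitary, $\mu_1\ge\cdots\ge\mu_r$ positive appreciable dual numbers and $\mu_{r+1}\ge\cdots\ge\mu_t$ positive infinitesimal dual numbers; the $\mu_i$ are unique. Then $\mathrm{rank}(\boldsymbol{A})=t$ and $\mathrm{Arank}(\boldsymbol{A})=r$ (the appreciable rank). $I$ and $0$ denote identity and zero blocks of suitable size; blocks with zero rows or columns are allowed (empty). *)

theory Defs
  imports Complex_Main "Jordan_Normal_Form.Matrix"
begin

datatype quat = Quat (qRe: real) (qI: real) (qJ: real) (qK: real)

lemma quat_eq_iff:
  "x = y \<longleftrightarrow> qRe x = qRe y \<and> qI x = qI y \<and> qJ x = qJ y \<and> qK x = qK y"
  by (cases x; cases y) auto

instantiation quat :: real_algebra_1
begin

definition zero_quat :: quat where "0 = Quat 0 0 0 0"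
definition one_quat :: quat where "1 = Quat 1 0 0 0"
definition plus_quat :: "quat \<Rightarrow> quat \<Rightarrow> quat" where
  "x + y = Quat (qRe x + qRe y) (qI x + qI y) (qJ x + qJ y) (qK x + qK y)"
definition uminus_quat :: "quat \<Rightarrow> quat" where
  "- x = Quat (- qRe x) (- qI x) (- qJ x) (- qK x)"
definition minus_quat :: "quat \<Rightarrow> quat \<Rightarrow> quat" where
  "x - y = Quat (qRe x - qRe y) (qI x - qI y) (qJ x - qJ y) (qK x - qK y)"
definition times_quat :: "quat \<Rightarrow> quat \<Rightarrow> quat" where
  "x * y = Quat
     (qRe x * qRe y - qI x * qI y - qJ x * qJ y - qK x * qK y)
     (qRe x * qI y + qI x * qRe y + qJ x * qK y - qK x * qJ y)
     (qRe x * qJ y - qI x * qK y + qJ x * qRe y + qK x * qI y)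
     (qRe x * qK y + qI x * qJ y - qJ x * qI y + qK x * qRe y)"
definition scaleR_quat :: "real \<Rightarrow> quat \<Rightarrow> quat" where
  "scaleR a x = Quat (a * qRe x) (a * qI x) (a * qJ x) (a * qK x)"

instance
  by standard
    (simp_all add: quat_eq_iff zero_quat_def one_quat_def plus_quat_def uminus_quat_def
      minus_quat_def times_quat_def scaleR_quat_def algebra_simps)

end

instantiation quat :: conjugate
begin

definition conjugate_quat :: "quat \<Rightarrow> quat" where
  "conjugate x = Quat (qRe x) (- qI x) (- qJ x) (- qK x)"

instance
  by standard (auto simp: quat_eq_iff conjugate_quat_def)

end

text \<open>
  \<open>Dual a b\<close> stands for \<open>a + b \<epsilon>\<close>, where \<open>\<epsilon>\<close> is central and squares to zero. The dual
  numbers are \<open>real dual\<close>, the dual quaternions are \<open>quat dual\<close>.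
\<close>

datatype 'a dual = Dual (st_part: 'a) (in_part: 'a)

lemma dual_eq_iff: "x = y \<longleftrightarrow> st_part x = st_part y \<and> in_part x = in_part y"
  by (cases x; cases y) auto

instantiation dual :: (ring_1) ring_1
begin

definition zero_dual :: "'a dual" where "0 = Dual 0 0"
definition one_dual :: "'a dual" where "1 = Dual 1 0"
definition plus_dual :: "'a dual \<Rightarrow> 'a dual \<Rightarrow> 'a dual" where
  "x + y = Dual (st_part x + st_part y) (in_part x + in_part y)"
definition uminus_dual :: "'a dual \<Rightarrow> 'a dual" where
  "- x = Dual (- st_part x) (- in_part x)"
definition minus_dual :: "'a dual \<Rightarrow> 'a dual \<Rightarrow> 'a dual" where
  "x - y = Dual (st_part x - st_part y) (in_part x - in_part y)"
definition times_dual :: "'a dual \<Rightarrow> 'a dual \<Rightarrow> 'a dual" where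
  "x * y = Dual (st_part x * st_part y) (st_part x * in_part y + in_part x * st_part y)"

instance
  by standard
    (simp_all add: dual_eq_iff zero_dual_def one_dual_def plus_dual_def uminus_dual_def
      minus_dual_def times_dual_def algebra_simps)

end

instance dual :: (comm_ring_1) comm_ring_1
  by standard (simp_all add: dual_eq_iff times_dual_def one_dual_def plus_dual_def algebra_simps)

instantiation dual :: (real_algebra_1) real_algebra_1
begin

definition scaleR_dual :: "real \<Rightarrow> 'a dual \<Rightarrow> 'a dual" where
  "scaleR a x = Dual (a *\<^sub>R st_part x) (a *\<^sub>R in_part x)"

instance
  by standard
    (simp_all add: dual_eq_iff scaleR_dual_def plus_dual_def times_dual_def algebra_simps)

end

instantiation dual :: (conjugate) conjugate
begin

definition conjugate_dual :: "'a dual \<Rightarrow> 'a dual" where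
  "conjugate x = Dual (conjugate (st_part x)) (conjugate (in_part x))"

instance
  by standard (auto simp: dual_eq_iff conjugate_dual_def)

end

instantiation dual :: (linorder) linorder
begin

definition less_dual :: "'a dual \<Rightarrow> 'a dual \<Rightarrow> bool" where
  "x < y \<longleftrightarrow> st_part x < st_part y \<or> st_part x = st_part y \<and> in_part x < in_part y"
definition less_eq_dual :: "'a dual \<Rightarrow> 'a dual \<Rightarrow> bool" where
  "x \<le> y \<longleftrightarrow> st_part x < st_part y \<or> st_part x = st_part y \<and> in_part x \<le> in_part y"

instance
  by standard (auto simp: dual_eq_iff less_dual_def less_eq_dual_def)

end

definition appreciable :: "'a::zero dual \<Rightarrow> bool" where
  "appreciable x \<longleftrightarrow> st_part x \<noteq> 0"

definition eps :: "'a::ring_1 dual" where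
  "eps = Dual 0 1"

definition dq_of_dual :: "real dual \<Rightarrow> quat dual" where
  "dq_of_dual = map_dual of_real"

text \<open>
  The library's \<open>mat_adjoint\<close> lives over \<open>conjugatable_field\<close>, whose conjugation is
  multiplicative, whereas quaternion conjugation reverses products.
\<close>

definition conj_transpose :: "'a::conjugate mat \<Rightarrow> 'a mat" where
  "conj_transpose A = map_mat conjugate (transpose_mat A)"

definition unitary_mat :: "nat \<Rightarrow> quat dual mat \<Rightarrow> bool" where
  "unitary_mat n U \<longleftrightarrow> U \<in> carrier_mat n n \<and>
     conj_transpose U * U = 1\<^sub>m n \<and> U * conj_transpose U = 1\<^sub>m n"

definition orthonormal_columns :: "quat dual mat \<Rightarrow> bool" where
  "orthonormal_columns N \<longleftrightarrow> conj_transpose N * N = 1\<^sub>m (dim_col N)"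

definition append_cols :: "'a::zero mat \<Rightarrow> 'a mat \<Rightarrow> 'a mat" (infixr "@\<^sub>c" 65) where
  "A @\<^sub>c B = four_block_mat A B (0\<^sub>m 0 (dim_col A)) (0\<^sub>m 0 (dim_col B))"

text \<open>
  The list \<open>mus\<close> holds the positive singular values in decreasing order. In the lexicographic
  order every positive appreciable number exceeds every infinitesimal one, so the appreciable
  singular values form an initial segment.
\<close>

definition is_svd ::
  "quat dual mat \<Rightarrow> quat dual mat \<Rightarrow> quat dual mat \<Rightarrow> real dual list \<Rightarrow> bool" where
  "is_svd A U V mus \<longleftrightarrow>
     unitary_mat (dim_row A) U \<and> unitary_mat (dim_col A) V \<and>
     length mus \<le> dim_row A \<and> length mus \<le> dim_col A \<and>
     sorted_wrt (\<ge>) mus \<and> (\<forall>\<mu>\<in>set mus. 0 < \<mu>) \<and>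
     conj_transpose U * A * V =
       diag_block_mat
         [mat_diag (length mus) (\<lambda>i. dq_of_dual (mus ! i)),
          0\<^sub>m (dim_row A - length mus) (dim_col A - length mus)]"

text \<open>
  A singular value decomposition always exists and its list of singular values is unique, so
  the choice operator picks a determined list.
\<close>

definition singular_values :: "quat dual mat \<Rightarrow> real dual list" where
  "singular_values A = (SOME mus. \<exists>U V. is_svd A U V mus)"

definition dq_rank :: "quat dual mat \<Rightarrow> nat" where
  "dq_rank A = length (singular_values A)"

definition dq_Arank :: "quat dual mat \<Rightarrow> nat" where
  "dq_Arank A = length (filter appreciable (singular_values A))"

text \<open>
  Diagonal entries are given by functions on indices starting from 0. The parameter \<open>k\<close> is the
  number of columns, and \<open>\<sigma>\<close>, \<open>\<xi>\<close>, \<open>c\<close>, \<open>s\<close> are the diagonals of \<open>\<Sigma>\<close>, \<open>\<Xi>\<close>, \<open>S_A\<close>, \<open>S_B\<close>.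
  The blocks of \<open>Sigma_B\<close> are not aligned with those of \<open>Sigma_A\<close>: the second diagonal block
  of \<open>Sigma_B\<close> is a rectangular zero block.
\<close>

definition Sigma_A ::
  "nat \<Rightarrow> nat \<Rightarrow> nat \<Rightarrow> nat \<Rightarrow> nat \<Rightarrow> (nat \<Rightarrow> real dual) \<Rightarrow> (nat \<Rightarrow> real) \<Rightarrow> quat dual mat" where
  "Sigma_A m k r q t\<^sub>1 c \<xi> = diag_block_mat
     [1\<^sub>m r,
      mat_diag q (\<lambda>i. dq_of_dual (c i)),
      eps \<cdot>\<^sub>m mat_diag t\<^sub>1 (\<lambda>i. of_real (\<xi> i)),
      0\<^sub>m (m - r - q - t\<^sub>1) (k - r - q - t\<^sub>1)]"

definition Sigma_B ::
  "nat \<Rightarrow> nat \<Rightarrow> nat \<Rightarrow> nat \<Rightarrow> nat \<Rightarrow> nat \<Rightarrow> (nat \<Rightarrow> real dual) \<Rightarrow> (nat \<Rightarrow> real) \<Rightarrow> quat dual mat" where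
  "Sigma_B p k r r\<^sub>1 q t\<^sub>1 s \<sigma> = diag_block_mat
     [eps \<cdot>\<^sub>m mat_diag r\<^sub>1 (\<lambda>i. of_real (\<sigma> i)),
      0\<^sub>m (p + r - k - r\<^sub>1) (r - r\<^sub>1),
      mat_diag q (\<lambda>i. dq_of_dual (s i)),
      1\<^sub>m t\<^sub>1,
      1\<^sub>m (k - r - q - t\<^sub>1)]"

text \<open>
  The first two lines say that all block sizes occurring above are nonnegative, so that no
  subtraction of natural numbers is truncated.
\<close>

definition gsvd_parameters ::
  "nat \<Rightarrow> nat \<Rightarrow> nat \<Rightarrow> nat \<Rightarrow> nat \<Rightarrow> nat \<Rightarrow> nat \<Rightarrow>
   (nat \<Rightarrow> real) \<Rightarrow> (nat \<Rightarrow> real) \<Rightarrow> (nat \<Rightarrow> real dual) \<Rightarrow> (nat \<Rightarrow> real dual) \<Rightarrow> bool" where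
  "gsvd_parameters m p k r r\<^sub>1 q t\<^sub>1 \<sigma> \<xi> c s \<longleftrightarrow>
     r\<^sub>1 \<le> r \<and> r + q + t\<^sub>1 \<le> m \<and>
     r + q + t\<^sub>1 \<le> k \<and> k + r\<^sub>1 \<le> p + r \<and>
     antimono_on {..<r\<^sub>1} \<sigma> \<and> (\<forall>i<r\<^sub>1. 0 < \<sigma> i) \<and>
     antimono_on {..<t\<^sub>1} \<xi> \<and> (\<forall>i<t\<^sub>1. 0 < \<xi> i) \<and>
     mono_on {..<q} c \<and> antimono_on {..<q} s \<and>
     (\<forall>i<q. appreciable (c i) \<and> 0 < c i \<and> c i < 1 \<and>
            appreciable (s i) \<and> 0 < s i \<and> s i < 1 \<and>
            (c i)\<^sup>2 + (s i)\<^sup>2 = 1)"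

end

theory Submission
  imports Defs "HOL-Combinatorics.Permutations"
begin

text \<open>
  Since \<open>C = G D H\<^sup>*\<close> is a singular value decomposition, \<open>A\<close> and \<open>B\<close> are the products of the
  upper and the lower part of \<open>G\<close> with the common right factor \<open>D H\<^sup>*\<close>. Only the columns of
  \<open>G\<close> that belong to positive singular values matter, and they are orthonormal. A pair \<open>P, R\<close>
  of blocks with \<open>P\<^sup>* P + R\<^sup>* R = I\<close> has a CS decomposition (\<open>cs_decomposition\<close>): one unitary
  \<open>W\<close> brings both blocks to the forms \<open>Sigma_A\<close> and \<open>Sigma_B\<close>. Taking all \<open>k\<close> columns gives
  the first part. For the second part only the \<open>t\<close> columns with appreciable singular values
  are decomposed; the remaining singular values are infinitesimal, \<open>\<mu> = \<epsilon> \<mu>'\<close> with \<open>\<mu>'\<close> real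
  and positive, so \<open>\<epsilon>\<close> can stay with the columns of \<open>G\<close> while the invertible \<open>\<mu>'\<close> goes into
  the right factor.

  For the CS decomposition take a singular value decomposition of \<open>P\<close>. The Gram matrix of
  \<open>R W\<close> is then diagonal with entries \<open>1 - \<mu>\<^sup>2\<close>. If \<open>\<mu>\<close> has standard part 1, the column of
  \<open>R W\<close> is infinitesimal, hence has Gram entry zero, hence \<open>\<mu> = 1\<close> exactly; all other columns
  have appreciable length and become basis vectors after normalization and completion
  (\<open>orthogonal_columns_normal_form\<close>). What remains of \<open>R W\<close> is a single infinitesimal block,
  to which a quaternion singular value decomposition applies; the unitary factor on its right
  only rotates the columns where \<open>P W\<close> is the identity, and is absorbed there.

  The singular value decomposition of a dual quaternion matrix (\<open>dual_svd\<close>) is obtained from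
  that of its standard part, a real diagonal matrix up to unitary factors. Unitary matrices of
  the form \<open>I + \<epsilon> K\<close> with \<open>K\<close> skew-Hermitian remove from the infinitesimal part every entry
  between different singular values and the skew part within equal positive ones
  (\<open>remove_off_block_perturbation\<close>). What is left is, on the positive singular values, a
  Hermitian matrix commuting with the diagonal, and elsewhere an arbitrary block. The first is
  treated by simultaneous diagonalization, the second by a quaternion singular value
  decomposition.

  Over the quaternions everything rests on the spectral theorem for a commuting pair of
  Hermitian matrices. A common eigenvector is found by maximizing the quadratic form of one
  matrix over the unit sphere of an eigenspace of the other (\<open>common_eigenvector\<close>); it is
  completed to a unitary matrix by a Householder reflection, and induction on the dimension
  does the rest.
\<close>

section \<open>Quaternions and dual numbers\<close>

text \<open>
  Rings with an involution that reverses products: the common setting for matrices over the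
  quaternions and over the dual quaternions.
\<close>

class star_ring = ring_1 + conjugate +
  assumes conjugate_add: "conjugate (x + y) = conjugate x + conjugate y"
    and conjugate_mult: "conjugate (x * y) = conjugate y * conjugate x"
begin

lemma conjugate_zero [simp]: "conjugate 0 = 0"
  using conjugate_add[of 0 0] by simp

lemma conjugate_one [simp]: "conjugate 1 = 1"
  using conjugate_mult[of "conjugate 1" 1] by simp

lemma conjugate_uminus: "conjugate (- x) = - conjugate x"
  using conjugate_add[of "- x" x] by (simp add: eq_neg_iff_add_eq_0)

lemma conjugate_diff: "conjugate (x - y) = conjugate x - conjugate y"
  using conjugate_add[of x "- y"] by (simp add: conjugate_uminus)

lemma conjugate_sum: "conjugate (sum f S) = (\<Sum>x\<in>S. conjugate (f x))"
  by (induction S rule: infinite_finite_induct) (simp_all add: conjugate_add)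

end

lemma quat_sel [simp]:
  "qRe 0 = 0" "qI 0 = 0" "qJ 0 = 0" "qK 0 = 0"
  "qRe 1 = 1" "qI 1 = 0" "qJ 1 = 0" "qK 1 = 0"
  "qRe (x + y) = qRe x + qRe y" "qI (x + y) = qI x + qI y"
  "qJ (x + y) = qJ x + qJ y" "qK (x + y) = qK x + qK y"
  "qRe (x - y) = qRe x - qRe y" "qI (x - y) = qI x - qI y"
  "qJ (x - y) = qJ x - qJ y" "qK (x - y) = qK x - qK y"
  "qRe (- x) = - qRe x" "qI (- x) = - qI x" "qJ (- x) = - qJ x" "qK (- x) = - qK x"
  "qRe (a *\<^sub>R x) = a * qRe x" "qI (a *\<^sub>R x) = a * qI x"
  "qJ (a *\<^sub>R x) = a * qJ x" "qK (a *\<^sub>R x) = a * qK x"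
  "qRe (conjugate x) = qRe x" "qI (conjugate x) = - qI x"
  "qJ (conjugate x) = - qJ x" "qK (conjugate x) = - qK x"
  by (simp_all add: zero_quat_def one_quat_def plus_quat_def minus_quat_def uminus_quat_def
      scaleR_quat_def conjugate_quat_def)

lemma quat_sel_times:
  "qRe (x * y) = qRe x * qRe y - qI x * qI y - qJ x * qJ y - qK x * qK y"
  "qI (x * y) = qRe x * qI y + qI x * qRe y + qJ x * qK y - qK x * qJ y"
  "qJ (x * y) = qRe x * qJ y - qI x * qK y + qJ x * qRe y + qK x * qI y"
  "qK (x * y) = qRe x * qK y + qI x * qJ y - qJ x * qI y + qK x * qRe y"
  by (simp_all add: times_quat_def)

lemma quat_sel_of_real [simp]:
  "qRe (of_real a) = a" "qI (of_real a) = 0" "qJ (of_real a) = 0" "qK (of_real a) = 0"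
  by (simp_all add: of_real_def)

lemma dual_sel [simp]:
  "st_part 0 = 0" "in_part 0 = 0" "st_part 1 = 1" "in_part 1 = 0"
  "st_part (x + y) = st_part x + st_part y" "in_part (x + y) = in_part x + in_part y"
  "st_part (x - y) = st_part x - st_part y" "in_part (x - y) = in_part x - in_part y"
  "st_part (- x) = - st_part x" "in_part (- x) = - in_part x"
  "st_part (x * y) = st_part x * st_part y"
  "in_part (x * y) = st_part x * in_part y + in_part x * st_part y"
  by (simp_all add: zero_dual_def one_dual_def plus_dual_def minus_dual_def uminus_dual_def
      times_dual_def)

lemma dual_sel_conjugate [simp]:
  "st_part (conjugate x) = conjugate (st_part x)" "in_part (conjugate x) = conjugate (in_part x)"
  by (simp_all add: conjugate_dual_def)

lemma dual_sel_sum [simp]: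
  "st_part (sum f S) = (\<Sum>x\<in>S. st_part (f x))" "in_part (sum f S) = (\<Sum>x\<in>S. in_part (f x))"
  by (induction S rule: infinite_finite_induct) simp_all

lemma dq_of_dual_sel [simp]:
  "st_part (dq_of_dual x) = of_real (st_part x)" "in_part (dq_of_dual x) = of_real (in_part x)"
  by (simp_all add: dq_of_dual_def dual.map_sel)

instance quat :: star_ring
  by standard (simp_all add: quat_eq_iff quat_sel_times algebra_simps)

instance dual :: (star_ring) star_ring
  by standard (simp_all add: dual_eq_iff conjugate_add conjugate_mult)

lemma conjugate_of_real [simp]: "conjugate (of_real a :: quat) = of_real a"
  by (simp add: quat_eq_iff)

lemma conjugate_scaleR: "conjugate (a *\<^sub>R x :: quat) = a *\<^sub>R conjugate x"
  by (simp add: quat_eq_iff)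

lemma qRe_sum: "qRe (sum f S) = (\<Sum>x\<in>S. qRe (f x))"
  by (induction S rule: infinite_finite_induct) auto

lemma of_real_commute: "of_real a * x = x * (of_real a :: 'a :: real_algebra_1)"
  by (simp add: of_real_def)

lemma conjugate_dq_of_dual [simp]: "conjugate (dq_of_dual a) = dq_of_dual a"
  by (simp add: dual_eq_iff)

lemma dq_of_dual_commute: "dq_of_dual a * x = x * dq_of_dual a"
  by (simp add: dual_eq_iff of_real_commute add.commute)

lemma dq_of_dual_arith [simp]:
  "dq_of_dual 0 = 0" "dq_of_dual 1 = 1"
  "dq_of_dual (a * b) = dq_of_dual a * dq_of_dual b"
  "dq_of_dual (a + b) = dq_of_dual a + dq_of_dual b"
  "dq_of_dual (a - b) = dq_of_dual a - dq_of_dual b"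
  by (simp_all add: dual_eq_iff)

lemma dq_of_dual_eq_iff [simp]: "dq_of_dual a = dq_of_dual b \<longleftrightarrow> a = b"
  by (simp add: dual_eq_iff)

definition qnorm2 :: "quat \<Rightarrow> real" where
  "qnorm2 x = (qRe x)\<^sup>2 + (qI x)\<^sup>2 + (qJ x)\<^sup>2 + (qK x)\<^sup>2"

lemma conjugate_mult_self: "conjugate x * x = of_real (qnorm2 x)"
  by (simp add: quat_eq_iff quat_sel_times qnorm2_def power2_eq_square)

lemma mult_conjugate_self: "x * conjugate x = of_real (qnorm2 x)"
  by (simp add: quat_eq_iff quat_sel_times qnorm2_def power2_eq_square)

lemma qnorm2_nonneg: "qnorm2 x \<ge> 0"
  by (simp add: qnorm2_def)

lemma qnorm2_eq_0_iff [simp]: "qnorm2 x = 0 \<longleftrightarrow> x = 0"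
  by (auto simp: qnorm2_def quat_eq_iff add_nonneg_eq_0_iff)

section \<open>Matrices over a ring with involution\<close>

notation conj_transpose ("_\<^sup>\<dagger>" [1000] 999)

lemma adj_dim [simp]: "dim_row (A\<^sup>\<dagger>) = dim_col A" "dim_col (A\<^sup>\<dagger>) = dim_row A"
  by (simp_all add: conj_transpose_def)

lemma adj_index [simp]:
  "i < dim_col A \<Longrightarrow> j < dim_row A \<Longrightarrow> A\<^sup>\<dagger> $$ (i,j) = conjugate (A $$ (j,i))"
  by (simp add: conj_transpose_def)

lemma adj_carrier [simp]: "A\<^sup>\<dagger> \<in> carrier_mat n m \<longleftrightarrow> A \<in> carrier_mat m n"
  unfolding carrier_mat_def mem_Collect_eq adj_dim by (rule conj_commute)

lemma adj_adj [simp]: "(A\<^sup>\<dagger>)\<^sup>\<dagger> = A"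
  by (rule eq_matI) auto

lemma mult_index:
  assumes "dim_col A = n" "dim_row B = n" "i < dim_row A" "j < dim_col B"
  shows "(A * B) $$ (i,j) = (\<Sum>l<n. A $$ (i,l) * B $$ (l,j))"
  using assms by (auto simp: scalar_prod_def atLeast0LessThan intro!: sum.cong)

text \<open>
  Side conditions on dimensions instead of carriers let the simplifier reassociate products
  and cancel factors unaided.
\<close>

lemma mult_assoc:
  fixes A B C :: "'a :: semiring_0 mat"
  shows "dim_col A = dim_row B \<Longrightarrow> dim_col B = dim_row C \<Longrightarrow> A * B * C = A * (B * C)"
  by (rule assoc_mult_mat[of A "dim_row A" "dim_row B" B "dim_col B" C "dim_col C"])
    (intro carrier_matI; simp)+

lemma zero_mult_dim:
  fixes B :: "'a :: ring_1 mat"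
  shows "dim_row B = n \<Longrightarrow> 0\<^sub>m m n * B = 0\<^sub>m m (dim_col B)"
    "dim_col B = m \<Longrightarrow> B * 0\<^sub>m m n = 0\<^sub>m (dim_row B) n"
  by (auto intro!: eq_matI)

lemma add_zero_dim:
  fixes B :: "'a :: ring_1 mat"
  shows "dim_row B = m \<Longrightarrow> dim_col B = n \<Longrightarrow> 0\<^sub>m m n + B = B"
    "dim_row B = m \<Longrightarrow> dim_col B = n \<Longrightarrow> B + 0\<^sub>m m n = B"
  by (auto intro!: eq_matI)

lemma mat_eq_if_minus_eq_zero:
  fixes A B :: "'a :: ring_1 mat"
  assumes "A - B = 0\<^sub>m m n" "A \<in> carrier_mat m n" "B \<in> carrier_mat m n"
  shows "A = B"
proof (rule eq_matI)
  fix i j assume "i < dim_row B" "j < dim_col B"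
  then show "A $$ (i,j) = B $$ (i,j)"
    using assms(2,3) arg_cong[OF assms(1), of "\<lambda>M. M $$ (i,j)"] by auto
qed (use assms in auto)

lemma adj_mult:
  fixes A B :: "'a :: star_ring mat"
  assumes "dim_col A = dim_row B"
  shows "(A * B)\<^sup>\<dagger> = B\<^sup>\<dagger> * A\<^sup>\<dagger>"
proof (rule eq_matI)
  fix i j assume "i < dim_row (B\<^sup>\<dagger> * A\<^sup>\<dagger>)" "j < dim_col (B\<^sup>\<dagger> * A\<^sup>\<dagger>)"
  then have ij: "i < dim_col B" "j < dim_row A"
    by simp_all
  have "(A * B)\<^sup>\<dagger> $$ (i,j) = conjugate (\<Sum>l<dim_row B. A $$ (j,l) * B $$ (l,i))"
    using ij assms mult_index[of A "dim_row B" B j i] by simp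
  also have "\<dots> = (B\<^sup>\<dagger> * A\<^sup>\<dagger>) $$ (i,j)"
    using ij assms mult_index[of "B\<^sup>\<dagger>" "dim_row B" "A\<^sup>\<dagger>" i j]
    by (simp add: conjugate_sum conjugate_mult)
  finally show "(A * B)\<^sup>\<dagger> $$ (i,j) = (B\<^sup>\<dagger> * A\<^sup>\<dagger>) $$ (i,j)" .
qed simp_all

text \<open>
  These take the place of explicit sums when a matrix is known only in some of its columns.
\<close>

lemma mult_cong_col:
  assumes "dim_col A = n" "dim_row B = n" "dim_row B' = n" "i < dim_row A"
    "j < dim_col B" "j' < dim_col B'" "\<And>l. l < n \<Longrightarrow> B $$ (l,j) = B' $$ (l,j')"
  shows "(A * B) $$ (i,j) = (A * B') $$ (i,j')"
  using assms by (simp add: mult_index del: index_mult_mat(1))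

lemma adj_mult_cong_cols:
  fixes A A' B B' :: "'a :: star_ring mat"
  assumes "dim_row A = n" "dim_row B = n" "dim_row A' = n" "dim_row B' = n"
    "i < dim_col A" "i' < dim_col A'" "j < dim_col B" "j' < dim_col B'"
    "\<And>l. l < n \<Longrightarrow> A $$ (l,i) = A' $$ (l,i')" "\<And>l. l < n \<Longrightarrow> B $$ (l,j) = B' $$ (l,j')"
  shows "(A\<^sup>\<dagger> * B) $$ (i,j) = (A'\<^sup>\<dagger> * B') $$ (i',j')"
  using assms by (simp add: mult_index del: index_mult_mat(1))

lemma adj_one [simp]: "(1\<^sub>m n :: 'a :: star_ring mat)\<^sup>\<dagger> = 1\<^sub>m n"
  by (rule eq_matI) auto

lemma adj_zero [simp]: "(0\<^sub>m m n :: 'a :: star_ring mat)\<^sup>\<dagger> = 0\<^sub>m n m"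
  by (rule eq_matI) auto

definition unitary :: "nat \<Rightarrow> 'a :: star_ring mat \<Rightarrow> bool" where
  "unitary n U \<longleftrightarrow> U \<in> carrier_mat n n \<and> U\<^sup>\<dagger> * U = 1\<^sub>m n \<and> U * U\<^sup>\<dagger> = 1\<^sub>m n"

lemma unitary_mat_iff: "unitary_mat n U \<longleftrightarrow> unitary n U"
  by (simp add: unitary_mat_def unitary_def)

lemma unitary_dim:
  assumes "unitary n U"
  shows "dim_row U = n" "dim_col U = n"
  using assms by (auto simp: unitary_def)

lemma unitary_cancel:
  assumes "unitary n U"
  shows "U\<^sup>\<dagger> * U = 1\<^sub>m n" "U * U\<^sup>\<dagger> = 1\<^sub>m n"
    "dim_row X = n \<Longrightarrow> U\<^sup>\<dagger> * (U * X) = X" "dim_row X = n \<Longrightarrow> U * (U\<^sup>\<dagger> * X) = X"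
  using assms unitary_dim[OF assms] by (simp_all add: unitary_def flip: mult_assoc)

lemma unitary_one [simp]: "unitary n (1\<^sub>m n)"
  by (simp add: unitary_def)

lemma unitary_adj: "unitary n U \<Longrightarrow> unitary n (U\<^sup>\<dagger>)"
  by (auto simp: unitary_def)

lemma unitary_mult:
  assumes "unitary n U" "unitary n V"
  shows "unitary n (U * V)"
  using assms unitary_dim[OF assms(1)] unitary_dim[OF assms(2)]
  by (auto simp: unitary_def adj_mult mult_assoc unitary_cancel[OF assms(1)]
      unitary_cancel[OF assms(2)])

subsection \<open>Diagonal matrices and direct sums\<close>

definition dmat :: "nat \<Rightarrow> nat \<Rightarrow> (nat \<Rightarrow> 'a :: zero) \<Rightarrow> 'a mat" where
  "dmat m n d = mat m n (\<lambda>(i,j). if i = j then d i else 0)"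

lemma dmat_dim [simp]: "dim_row (dmat m n d) = m" "dim_col (dmat m n d) = n"
  by (simp_all add: dmat_def)

lemma dmat_carrier [simp]: "dmat m n d \<in> carrier_mat m n"
  by (simp add: dmat_def)

lemma dmat_index [simp]: "i < m \<Longrightarrow> j < n \<Longrightarrow> dmat m n d $$ (i,j) = (if i = j then d i else 0)"
  by (simp add: dmat_def)

lemma dmat_cong: "(\<And>i. i < m \<Longrightarrow> i < n \<Longrightarrow> d i = e i) \<Longrightarrow> dmat m n d = dmat m n e"
  by (rule eq_matI) auto

lemma adj_dmat: "(dmat m n d)\<^sup>\<dagger> = dmat n m (\<lambda>i. conjugate (d i :: 'a :: star_ring))"
  by (rule eq_matI) auto

lemma dmat_mult_index:
  fixes A :: "'a :: ring_1 mat"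
  assumes "dim_row A = n" "i < m" "j < dim_col A"
  shows "(dmat m n d * A) $$ (i,j) = (if i < n then d i * A $$ (i,j) else 0)"
proof -
  have "(dmat m n d * A) $$ (i,j) = (\<Sum>l<n. (if i = l then d i * A $$ (l,j) else 0))"
    using assms by (simp only: mult_index dmat_dim) (intro sum.cong, auto)
  then show ?thesis
    by simp
qed

lemma mult_dmat_index:
  fixes A :: "'a :: ring_1 mat"
  assumes "dim_col A = n" "i < dim_row A" "j < p"
  shows "(A * dmat n p d) $$ (i,j) = (if j < n then A $$ (i,j) * d j else 0)"
proof -
  have "(A * dmat n p d) $$ (i,j) = (\<Sum>l<n. (if l = j then A $$ (i,l) * d j else 0))"
    using assms by (simp only: mult_index dmat_dim) (intro sum.cong, auto)
  then show ?thesis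
    by simp
qed

lemma dmat_mult:
  fixes d e :: "nat \<Rightarrow> 'a :: ring_1"
  shows "dmat m n d * dmat n p e = dmat m p (\<lambda>i. if i < n then d i * e i else 0)"
  by (rule eq_matI) (auto simp: dmat_mult_index simp del: index_mult_mat(1))

lemma one_mat_dmat: "1\<^sub>m n = dmat n n (\<lambda>_. 1)"
  by (rule eq_matI) auto

text \<open>
  The block diagonal matrix with two blocks, which may be rectangular or empty; all normal
  forms below are built from it and from \<open>dmat\<close>.
\<close>

definition dsum :: "'a :: zero mat \<Rightarrow> 'a mat \<Rightarrow> 'a mat" where
  "dsum A B = four_block_mat A (0\<^sub>m (dim_row A) (dim_col B)) (0\<^sub>m (dim_row B) (dim_col A)) B"

lemma dsum_dim [simp]:
  "dim_row (dsum A B) = dim_row A + dim_row B" "dim_col (dsum A B) = dim_col A + dim_col B"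
  by (simp_all add: dsum_def)

lemma dsum_carrier [simp]:
  "A \<in> carrier_mat m n \<Longrightarrow> B \<in> carrier_mat m' n' \<Longrightarrow> dsum A B \<in> carrier_mat (m + m') (n + n')"
  by (intro carrier_matI) auto

lemma dsum_index:
  "i < dim_row A + dim_row B \<Longrightarrow> j < dim_col A + dim_col B \<Longrightarrow> dsum A B $$ (i,j) =
    (if i < dim_row A then if j < dim_col A then A $$ (i,j) else 0
     else if j < dim_col A then 0 else B $$ (i - dim_row A, j - dim_col A))"
  by (auto simp: dsum_def)

lemma dsum_mult:
  fixes A B C D :: "'a :: ring_1 mat"
  assumes "dim_col A = dim_row C" "dim_col B = dim_row D"
  shows "dsum A B * dsum C D = dsum (A * C) (B * D)"
  unfolding dsum_def
  by (subst mult_four_block_mat[of _ "dim_row A" "dim_col A" _ "dim_col B" _ "dim_row B"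
        _ _ "dim_col C" _ "dim_col D"]) (use assms in auto)

lemma adj_dsum: "(dsum A B)\<^sup>\<dagger> = dsum (A\<^sup>\<dagger>) (B\<^sup>\<dagger> :: 'a :: star_ring mat)"
  by (rule eq_matI) (auto simp: dsum_index)

lemma dsum_one: "dsum (1\<^sub>m a) (1\<^sub>m b) = 1\<^sub>m (a + b)"
  by (rule eq_matI) (auto simp: dsum_index)

lemma dsum_dmat_square:
  "dsum (dmat a a d) (dmat m n e) = dmat (a + m) (a + n) (\<lambda>i. if i < a then d i else e (i - a))"
  by (rule eq_matI) (auto simp: dsum_index)

lemma dsum_assoc: "dsum A (dsum B C) = dsum (dsum A B) C"
  unfolding dsum_def by (rule assoc_four_block_mat)

lemma diag_block_mat_Cons_Cons: "diag_block_mat (A # B # Cs) = dsum A (diag_block_mat (B # Cs))"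
  by (simp add: dsum_def Let_def)

lemma mat_diag_dmat: "mat_diag n d = dmat n n d"
  by (rule eq_matI) (auto simp: mat_diag_def)

lemma zero_mat_dmat: "0\<^sub>m a b = dmat a b (\<lambda>_. 0)"
  by (rule eq_matI) auto

lemma dsum_inject:
  assumes "dsum A B = dsum C D" "dim_row A = dim_row C" "dim_col A = dim_col C"
    "dim_row B = dim_row D" "dim_col B = dim_col D"
  shows "A = C" "B = D"
proof -
  have eq: "dsum A B $$ (i,j) = dsum C D $$ (i,j)" for i j
    using assms by simp
  show "A = C"
  proof (rule eq_matI)
    fix i j assume "i < dim_row C" "j < dim_col C"
    then show "A $$ (i,j) = C $$ (i,j)"
      using eq[of i j] assms(2-) by (simp add: dsum_index)
  qed (use assms in auto)
  show "B = D"
  proof (rule eq_matI)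
    fix i j assume "i < dim_row D" "j < dim_col D"
    then show "B $$ (i,j) = D $$ (i,j)"
      using eq[of "dim_row A + i" "dim_col A + j"] assms(2-) by (simp add: dsum_index)
  qed (use assms in auto)
qed

lemma split_dsum:
  assumes "A \<in> carrier_mat (a + b) (c + d)"
    and "\<And>i j. i < a \<Longrightarrow> c \<le> j \<Longrightarrow> j < c + d \<Longrightarrow> A $$ (i,j) = 0"
    and "\<And>i j. a \<le> i \<Longrightarrow> i < a + b \<Longrightarrow> j < c \<Longrightarrow> A $$ (i,j) = 0"
  shows "A = dsum (mat a c (\<lambda>(i,j). A $$ (i,j))) (mat b d (\<lambda>(i,j). A $$ (a + i, c + j)))"
  by (rule eq_matI) (use assms in \<open>auto simp: dsum_index\<close>)

lemma unitary_dsum: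
  assumes "unitary a U" "unitary b V"
  shows "unitary (a + b) (dsum U V)"
  using assms unitary_dim[OF assms(1)] unitary_dim[OF assms(2)]
  by (auto simp: unitary_def adj_dsum dsum_mult dsum_one)

subsection \<open>Permuting and sorting\<close>

lemma unitary_permute_cols:
  fixes U :: "'a :: star_ring mat"
  assumes U: "unitary n U" and f: "f permutes {..<n}"
  shows "unitary n (mat n n (\<lambda>(i,j). U $$ (i, f j)))"
proof -
  define P :: "'a mat" where "P = mat n n (\<lambda>(i,j). if i = f j then 1 else 0)"
  have f_less: "f j < n \<longleftrightarrow> j < n" for j
    using permutes_in_image[OF f, of j] by simp
  have "P\<^sup>\<dagger> * P = 1\<^sub>m n"
  proof (rule eq_matI)
    fix i j assume ij: "i < dim_row (1\<^sub>m n :: 'a mat)" "j < dim_col (1\<^sub>m n :: 'a mat)"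
    have "(P\<^sup>\<dagger> * P) $$ (i,j) = (\<Sum>l<n. P\<^sup>\<dagger> $$ (i,l) * P $$ (l,j))"
      using ij by (intro mult_index) (auto simp: P_def)
    also have "\<dots> = (\<Sum>l<n. if l = f i then (if i = j then 1 else 0) else 0)"
      using ij injD[OF permutes_inj[OF f]] by (intro sum.cong) (auto simp: P_def)
    finally show "(P\<^sup>\<dagger> * P) $$ (i,j) = 1\<^sub>m n $$ (i,j)"
      using ij f_less by simp
  qed (auto simp: P_def)
  moreover have "P * P\<^sup>\<dagger> = 1\<^sub>m n"
  proof (rule eq_matI)
    fix i j assume ij: "i < dim_row (1\<^sub>m n :: 'a mat)" "j < dim_col (1\<^sub>m n :: 'a mat)"
    have "(P * P\<^sup>\<dagger>) $$ (i,j) = (\<Sum>l<n. P $$ (i,l) * P\<^sup>\<dagger> $$ (l,j))"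
      using ij by (intro mult_index) (auto simp: P_def)
    also have "\<dots> = (\<Sum>l<n. if l = inv_into UNIV f i then (if i = j then 1 else 0) else 0)"
      using ij by (intro sum.cong) (auto simp: P_def permutes_inverses[OF f])
    finally have "(P * P\<^sup>\<dagger>) $$ (i,j) = (\<Sum>l<n. if l = inv_into UNIV f i then (if i = j then 1 else 0) else 0)" .
    moreover have "inv_into UNIV f i < n"
      using permutes_in_image[OF permutes_inv[OF f], of i] ij by simp
    ultimately show "(P * P\<^sup>\<dagger>) $$ (i,j) = 1\<^sub>m n $$ (i,j)"
      using ij by simp
  qed (auto simp: P_def)
  ultimately have P: "unitary n P"
    by (simp add: unitary_def P_def)
  have "mat n n (\<lambda>(i,j). U $$ (i, f j)) = U * P"
  proof (rule eq_matI)
    fix i j assume ij: "i < dim_row (U * P)" "j < dim_col (U * P)"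
    have "(U * P) $$ (i,j) = (\<Sum>l<n. U $$ (i,l) * P $$ (l,j))"
      using ij unitary_dim[OF U] by (intro mult_index) (auto simp: P_def)
    also have "\<dots> = (\<Sum>l<n. if l = f j then U $$ (i,l) else 0)"
      using ij unitary_dim[OF U] by (intro sum.cong) (auto simp: P_def)
    finally show "mat n n (\<lambda>(i,j). U $$ (i, f j)) $$ (i,j) = (U * P) $$ (i,j)"
      using ij unitary_dim[OF U] f_less by (simp add: P_def)
  qed (use unitary_dim[OF U] in \<open>auto simp: P_def\<close>)
  then show ?thesis
    using unitary_mult[OF U P] by simp
qed

lemma mult_permute_index:
  fixes U A V :: "'a :: star_ring mat"
  assumes A: "A \<in> carrier_mat m n" and U: "unitary m U" and V: "unitary n V"
    and f: "f permutes {..<m}" and g: "g permutes {..<n}" and ij: "i < m" "j < n"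
  shows "((mat m m (\<lambda>(i,j). U $$ (i, f j)))\<^sup>\<dagger> * A * mat n n (\<lambda>(i,j). V $$ (i, g j))) $$ (i,j)
    = (U\<^sup>\<dagger> * A * V) $$ (f i, g j)"
proof -
  have "f i < m" "g j < n"
    using permutes_in_image[OF f, of i] permutes_in_image[OF g, of j] ij by auto
  then show ?thesis
    using A ij unitary_dim[OF U] unitary_dim[OF V]
    by (simp add: mult_index[of _ n] mult_index[of _ m] del: index_mult_mat(1))
qed

lemma sorting_permutation:
  fixes f :: "nat \<Rightarrow> 'a :: linorder"
  obtains p where "p permutes {..<l}" "\<And>i j. i \<le> j \<Longrightarrow> j < l \<Longrightarrow> f (p i) \<le> f (p j)"
proof -
  have "mset (sort (map f [0..<l])) = mset (map f [0..<l])"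
    by simp
  then obtain p where p: "p permutes {..<length (map f [0..<l])}"
      "permute_list p (map f [0..<l]) = sort (map f [0..<l])"
    by (rule mset_eq_permutation)
  have p': "p permutes {..<l}"
    using p(1) by simp
  have nth: "sort (map f [0..<l]) ! i = f (p i)" if "i < l" for i
    using permute_list_nth[OF p(1), of i] p(2) that permutes_in_image[OF p', of i] by simp
  have "f (p i) \<le> f (p j)" if "i \<le> j" "j < l" for i j
    using sorted_nth_mono[of "sort (map f [0..<l])" i j] that nth[of i] nth[of j] by simp
  with p' show thesis
    using that by blast
qed

lemma initial_segment:
  fixes P :: "nat \<Rightarrow> bool"
  assumes "\<And>i j. i \<le> j \<Longrightarrow> j < n \<Longrightarrow> P j \<Longrightarrow> P i"
  obtains r where "r \<le> n" "\<And>i. i < n \<Longrightarrow> P i \<longleftrightarrow> i < r"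
proof -
  have "\<exists>r\<le>n. \<forall>i<n. P i \<longleftrightarrow> i < r"
    using assms
  proof (induction n)
    case (Suc n)
    show ?case
    proof (cases "P n")
      case True
      then show ?thesis
        using Suc.prems[of _ n] by (intro exI[of _ "Suc n"]) auto
    next
      case False
      obtain r where "r \<le> n" "\<forall>i<n. P i \<longleftrightarrow> i < r"
        using Suc.IH Suc.prems by (meson less_Suc_eq)
      then show ?thesis
        using False by (intro exI[of _ r]) (auto simp: less_Suc_eq)
    qed
  qed simp
  then show thesis
    using that by blast
qed

text \<open>Permuting the columns of both unitary factors alike reorders the diagonal at will.\<close>

lemma permute_diagonal:
  fixes A :: "'a :: star_ring mat"
  assumes A: "A \<in> carrier_mat m n" and U: "unitary m U" and V: "unitary n V"
    and diag: "U\<^sup>\<dagger> * A * V = dmat m n d" and p: "p permutes {..<min m n}"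
  obtains U' V' where "unitary m U'" "unitary n V'" "U'\<^sup>\<dagger> * A * V' = dmat m n (\<lambda>i. d (p i))"
proof -
  have pm: "p permutes {..<m}" and pn: "p permutes {..<n}"
    by (rule permutes_subset[OF p]; auto)+
  have "(mat m m (\<lambda>(i,j). U $$ (i, p j)))\<^sup>\<dagger> * A * mat n n (\<lambda>(i,j). V $$ (i, p j))
      = dmat m n (\<lambda>i. d (p i))" (is "?L = ?R")
  proof (rule eq_matI)
    fix i j assume "i < dim_row ?R" "j < dim_col ?R"
    then have ij: "i < m" "j < n" by auto
    have "p i < m" "p j < n"
      using permutes_in_image[OF pm, of i] permutes_in_image[OF pn, of j] ij by auto
    then show "?L $$ (i,j) = ?R $$ (i,j)"
      unfolding mult_permute_index[OF A U V pm pn ij] diag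
      using ij injD[OF permutes_inj[OF p], of i j] by auto
  qed auto
  then show thesis
    using that unitary_permute_cols[OF U pm] unitary_permute_cols[OF V pn] by blast
qed

section \<open>Completing orthonormal columns to a unitary matrix\<close>

text \<open>The unit factor of a polar decomposition; at zero it is an arbitrary choice.\<close>

lemma quat_polar:
  fixes x :: quat
  obtains \<alpha> b where "\<alpha> * conjugate \<alpha> = 1" "conjugate \<alpha> * \<alpha> = 1" "b \<ge> 0"
    "conjugate \<alpha> * x = of_real b"
proof (cases "x = 0")
  case True
  then show thesis
    using that[of 1 0] by simp
next
  case False
  define b where "b = sqrt (qnorm2 x)"
  have b: "b > 0" "b * b = qnorm2 x"
    using False qnorm2_nonneg[of x] by (auto simp: b_def less_le)
  define \<alpha> where "\<alpha> = (1 / b) *\<^sub>R x"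
  have conj: "conjugate \<alpha> = (1 / b) *\<^sub>R conjugate x"
    by (simp add: \<alpha>_def quat_eq_iff)
  show thesis
  proof
    have "\<alpha> * conjugate \<alpha> = (1 / b * (1 / b)) *\<^sub>R of_real (qnorm2 x)"
      "conjugate \<alpha> * \<alpha> = (1 / b * (1 / b)) *\<^sub>R of_real (qnorm2 x)"
      unfolding conj by (simp_all add: \<alpha>_def mult_conjugate_self conjugate_mult_self)
    then show "\<alpha> * conjugate \<alpha> = 1" "conjugate \<alpha> * \<alpha> = 1"
      using b(1) by (simp_all add: of_real_def flip: b(2))
    show "conjugate \<alpha> * x = of_real b"
      using b(1) by (simp add: conj conjugate_mult_self of_real_def flip: b(2))
  qed (use b in simp)
qed

text \<open>
  Let \<open>\<alpha>\<close> be the unit factor of the first coordinate of \<open>u\<close>. The Householder reflection along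
  \<open>w = u + \<alpha> e\<^sub>0\<close> maps \<open>u\<close> to \<open>- \<alpha> e\<^sub>0\<close>. Being an involution it maps \<open>e\<^sub>0\<close> to \<open>- u\<close> times the
  conjugate of \<open>\<alpha>\<close>, so multiplying its first column by \<open>- \<alpha>\<close> on the right gives \<open>u\<close>. The
  choice of \<open>\<alpha>\<close> makes the inner product of \<open>w\<close> and \<open>u\<close> real and equal to half the squared
  length of \<open>w\<close>, which is why the image of \<open>u\<close> is a multiple of \<open>e\<^sub>0\<close>.
\<close>

lemma unit_vector_completion:
  fixes u :: "quat mat"
  assumes u: "u \<in> carrier_mat n 1" "u\<^sup>\<dagger> * u = 1\<^sub>m 1"
  obtains U where "unitary n U" "n > 0" "\<And>i. i < n \<Longrightarrow> U $$ (i,0) = u $$ (i,0)"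
proof -
  have sum_u: "(\<Sum>l<n. conjugate (u $$ (l,0)) * u $$ (l,0)) = 1"
    using mult_index[of "u\<^sup>\<dagger>" n u 0 0] u by simp
  then have n: "n > 0"
    by (intro Nat.gr0I) simp
  obtain \<alpha> b where \<alpha>: "\<alpha> * conjugate \<alpha> = 1" "conjugate \<alpha> * \<alpha> = 1" "b \<ge> 0"
    "conjugate \<alpha> * u $$ (0,0) = of_real b"
    by (rule quat_polar)
  have \<alpha>': "conjugate (u $$ (0,0)) * \<alpha> = of_real b"
    using arg_cong[OF \<alpha>(4), of conjugate] by (simp add: conjugate_mult)
  define w where "w i = u $$ (i,0) + (if i = 0 then \<alpha> else 0)" for i
  define \<gamma> where "\<gamma> = 1 / (1 + b)"
  \<comment> \<open>\<open>1 + b\<close> is half the squared length of \<open>w\<close>, and \<open>\<gamma>\<close> normalizes the projection along \<open>w\<close>.\<close>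
  have w_u: "(\<Sum>l<n. conjugate (w l) * u $$ (l,0)) = of_real (1 + b)"
  proof -
    have "(\<Sum>l<n. conjugate (w l) * u $$ (l,0)) = (\<Sum>l<n. conjugate (u $$ (l,0)) * u $$ (l,0))
        + (\<Sum>l<n. if l = 0 then conjugate \<alpha> * u $$ (l,0) else 0)"
      unfolding sum.distrib[symmetric]
      by (intro sum.cong) (auto simp: w_def conjugate_add algebra_simps)
    then show ?thesis
      using n by (simp add: sum_u \<alpha>)
  qed
  have w_w: "(\<Sum>l<n. conjugate (w l) * w l) = of_real (2 * (1 + b))"
  proof -
    have "(\<Sum>l<n. conjugate (w l) * w l) = (\<Sum>l<n. conjugate (w l) * u $$ (l,0))
        + (\<Sum>l<n. if l = 0 then conjugate (w l) * \<alpha> else 0)"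
      unfolding sum.distrib[symmetric]
      by (intro sum.cong) (auto simp: w_def algebra_simps)
    also have "\<dots> = of_real (1 + b) + conjugate (w 0) * \<alpha>"
      using n by (simp add: w_u)
    also have "conjugate (w 0) * \<alpha> = of_real (1 + b)"
      by (simp add: w_def conjugate_add distrib_right \<alpha> \<alpha>')
    finally show ?thesis
      by (simp only: mult_2 of_real_add)
  qed
  define H where "H = mat n n (\<lambda>(i,j). (if i = j then 1 else 0) - \<gamma> *\<^sub>R (w i * conjugate (w j)))"
  have H: "H \<in> carrier_mat n n" "H\<^sup>\<dagger> = H"
    by (auto simp: H_def intro!: eq_matI simp: conjugate_diff conjugate_mult conjugate_scaleR)
  have "H * H = 1\<^sub>m n"
  proof (rule eq_matI)
    fix i j assume "i < dim_row (1\<^sub>m n :: quat mat)" "j < dim_col (1\<^sub>m n :: quat mat)"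
    then have ij: "i < n" "j < n" by auto
    have "(H * H) $$ (i,j) = (\<Sum>l<n. H $$ (i,l) * H $$ (l,j))"
      using ij by (intro mult_index) (auto simp: H_def)
    also have "\<dots> = (\<Sum>l<n. (if l = i then H $$ (l,j) else 0)
        - (if l = j then \<gamma> *\<^sub>R (w i * conjugate (w l)) else 0)
        + (\<gamma> * \<gamma>) *\<^sub>R (w i * (conjugate (w l) * w l) * conjugate (w j)))"
      using ij by (intro sum.cong) (auto simp: H_def algebra_simps)
    also have "\<dots> = H $$ (i,j) - \<gamma> *\<^sub>R (w i * conjugate (w j))
        + (\<gamma> * \<gamma>) *\<^sub>R (w i * (\<Sum>l<n. conjugate (w l) * w l) * conjugate (w j))"
      using ij by (simp add: sum.distrib sum_subtractf sum_distrib_left sum_distrib_right scaleR_sum_right)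
    also have "\<dots> = (if i = j then 1 else 0)
        + (\<gamma> * \<gamma> * (2 * (1 + b)) - 2 * \<gamma>) *\<^sub>R (w i * conjugate (w j))"
      using ij unfolding w_w
      by (simp add: H_def of_real_def scaleR_diff_left scaleR_2 flip: scaleR_scaleR)
    also have "\<gamma> * \<gamma> * (2 * (1 + b)) - 2 * \<gamma> = 0"
      using \<alpha>(3) by (simp add: \<gamma>_def divide_simps)
    finally show "(H * H) $$ (i,j) = 1\<^sub>m n $$ (i,j)"
      using ij by simp
  qed (auto simp: H_def)
  then have uH: "unitary n H"
    using H by (simp add: unitary_def)
  define d where "d i = (if i = 0 then - \<alpha> else 1)" for i :: nat
  have uD: "unitary n (dmat n n d)"
    by (auto simp: unitary_def adj_dmat dmat_mult one_mat_dmat d_def conjugate_uminus \<alpha> intro!: dmat_cong)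
  have "(H * dmat n n d) $$ (i,0) = u $$ (i,0)" if "i < n" for i
  proof -
    have *: "w i * conjugate (w 0) * \<alpha> = (1 + b) *\<^sub>R w i"
      using \<alpha> \<alpha>'
      by (simp add: w_def conjugate_add distrib_right mult.assoc) (simp add: of_real_def algebra_simps)
    have "(H * dmat n n d) $$ (i,0) = H $$ (i,0) * - \<alpha>"
      using that n by (subst mult_dmat_index) (auto simp: H_def d_def)
    also have "\<dots> = (if i = 0 then - \<alpha> else 0) + \<gamma> *\<^sub>R (w i * conjugate (w 0) * \<alpha>)"
      using that n by (simp add: H_def left_diff_distrib)
    also have "\<gamma> *\<^sub>R (w i * conjugate (w 0) * \<alpha>) = (\<gamma> * (1 + b)) *\<^sub>R w i"
      unfolding * by simp
    also have "\<gamma> * (1 + b) = 1"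
      using \<alpha>(3) by (simp add: \<gamma>_def)
    finally show ?thesis
      by (simp add: w_def)
  qed
  then show thesis
    using that unitary_mult[OF uH uD] n by blast
qed

text \<open>
  After a unitary matrix has moved the first column to \<open>e\<^sub>0\<close>, orthogonality clears the first
  row of the other columns, and the induction continues with one row and one column less. This
  argument also yields \<open>k \<le> m\<close>.
\<close>

lemma orthonormal_completion:
  fixes P :: "quat mat"
  assumes "P \<in> carrier_mat m k" "P\<^sup>\<dagger> * P = 1\<^sub>m k"
  shows "k \<le> m \<and> (\<exists>U. unitary m U \<and> (\<forall>i<m. \<forall>j<k. U $$ (i,j) = P $$ (i,j)))"
  using assms
proof (induction k arbitrary: m P)
  case 0
  then show ?case
    using unitary_one[of m] by blast
next
  case (Suc k)
  have P: "dim_row P = m" "dim_col P = Suc k"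
    using Suc.prems(1) by auto
  define u where "u = mat m 1 (\<lambda>(i,j). P $$ (i,0))"
  have "u\<^sup>\<dagger> * u = 1\<^sub>m 1"
  proof (rule eq_matI)
    fix i j assume "i < dim_row (1\<^sub>m 1 :: quat mat)" "j < dim_col (1\<^sub>m 1 :: quat mat)"
    then have ij: "i = 0" "j = 0" by auto
    have "(u\<^sup>\<dagger> * u) $$ (0,0) = (P\<^sup>\<dagger> * P) $$ (0,0)"
      by (rule adj_mult_cong_cols[of _ m]) (auto simp: u_def P)
    then show "(u\<^sup>\<dagger> * u) $$ (i,j) = 1\<^sub>m 1 $$ (i,j)"
      by (simp add: Suc.prems(2) ij del: index_mult_mat(1))
  qed (auto simp: u_def)
  then obtain H where H: "unitary m H" "m > 0" "\<And>i. i < m \<Longrightarrow> H $$ (i,0) = u $$ (i,0)"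
    using unit_vector_completion[of u m] by (auto simp: u_def)
  note dim = unitary_dim[OF H(1)] P
  obtain m' where m: "m = Suc m'"
    using H(2) by (cases m) auto
  define Q where "Q = H\<^sup>\<dagger> * P"
  have Q: "Q \<in> carrier_mat (1 + m') (1 + k)"
    by (intro carrier_matI) (auto simp: Q_def dim m)
  have QQ: "Q\<^sup>\<dagger> * Q = 1\<^sub>m (Suc k)"
    using Suc.prems(2) by (simp add: Q_def adj_mult dim mult_assoc unitary_cancel[OF H(1)])
  have Q0: "Q $$ (i,0) = (if i = 0 then 1 else 0)" if "i < Suc m'" for i
  proof -
    have "Q $$ (i,0) = (H\<^sup>\<dagger> * H) $$ (i,0)"
      unfolding Q_def using that H(3)
      by (intro mult_cong_col[of _ m]) (auto simp: dim u_def m)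
    then show ?thesis
      using that by (simp add: unitary_cancel[OF H(1)] m del: index_mult_mat(1))
  qed
  have Q0': "Q $$ (0,j) = (if j = 0 then 1 else 0)" if "j < Suc k" for j
  proof -
    have "(Q\<^sup>\<dagger> * Q) $$ (0,j) = (\<Sum>l<m. Q\<^sup>\<dagger> $$ (0,l) * Q $$ (l,j))"
      using that by (intro mult_index) (auto simp: Q_def dim)
    also have "\<dots> = (\<Sum>l<m. if l = 0 then Q $$ (l,j) else 0)"
      using Q0 Q by (intro sum.cong) (auto simp: m)
    finally show ?thesis
      using that H(2) QQ by (simp del: index_mult_mat(1))
  qed
  define P' where "P' = mat m' k (\<lambda>(i,j). Q $$ (1 + i, 1 + j))"
  have "Q = dsum (mat 1 1 (\<lambda>(i,j). Q $$ (i,j))) P'"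
    unfolding P'_def by (rule split_dsum) (use Q Q0 Q0' in auto)
  also have "mat 1 1 (\<lambda>(i,j). Q $$ (i,j)) = 1\<^sub>m 1"
    by (rule eq_matI) (auto simp: Q0)
  finally have Q_eq: "Q = dsum (1\<^sub>m 1) P'" .
  have "dsum (1\<^sub>m 1) (P'\<^sup>\<dagger> * P') = dsum (1\<^sub>m 1) (1\<^sub>m k)"
    using QQ unfolding Q_eq by (simp add: adj_dsum dsum_mult dsum_one)
  then have "P'\<^sup>\<dagger> * P' = 1\<^sub>m k"
    by (rule dsum_inject) (auto simp: P'_def)
  then obtain U where U: "k \<le> m'" "unitary m' U" "\<And>i j. i < m' \<Longrightarrow> j < k \<Longrightarrow> U $$ (i,j) = P' $$ (i,j)"
    using Suc.IH[of P' m'] by (auto simp: P'_def)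
  have u1: "unitary m (dsum (1\<^sub>m 1) U)"
    using unitary_dsum[OF unitary_one[of 1] U(2)] by (simp add: m)
  have "(H * dsum (1\<^sub>m 1) U) $$ (i,j) = P $$ (i,j)" if "i < m" "j < Suc k" for i j
  proof -
    have "(H * dsum (1\<^sub>m 1) U) $$ (i,j) = (H * Q) $$ (i,j)"
      unfolding Q_eq using that U(1,3) unitary_dim[OF U(2)]
      by (intro mult_cong_col[of _ m]) (auto simp: dim m dsum_index P'_def)
    then show ?thesis
      by (simp add: Q_def unitary_cancel[OF H(1)] dim del: index_mult_mat(1))
  qed
  then show ?case
    using unitary_mult[OF H(1) u1] U(1) m by auto
qed

subsection \<open>Standard and infinitesimal parts of a dual matrix\<close>

definition stm :: "'a dual mat \<Rightarrow> 'a mat" where "stm = map_mat st_part"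
definition inm :: "'a dual mat \<Rightarrow> 'a mat" where "inm = map_mat in_part"
definition dualm :: "'a mat \<Rightarrow> 'a mat \<Rightarrow> 'a dual mat" where
  "dualm A B = mat (dim_row A) (dim_col A) (\<lambda>ij. Dual (A $$ ij) (B $$ ij))"

lemma parts_dim [simp]:
  "dim_row (stm A) = dim_row A" "dim_col (stm A) = dim_col A"
  "dim_row (inm A) = dim_row A" "dim_col (inm A) = dim_col A"
  "dim_row (dualm B C) = dim_row B" "dim_col (dualm B C) = dim_col B"
  by (simp_all add: stm_def inm_def dualm_def)

lemma parts_index [simp]:
  "i < dim_row A \<Longrightarrow> j < dim_col A \<Longrightarrow> stm A $$ (i,j) = st_part (A $$ (i,j))"
  "i < dim_row A \<Longrightarrow> j < dim_col A \<Longrightarrow> inm A $$ (i,j) = in_part (A $$ (i,j))"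
  "i < dim_row B \<Longrightarrow> j < dim_col B \<Longrightarrow> dualm B C $$ (i,j) = Dual (B $$ (i,j)) (C $$ (i,j))"
  by (simp_all add: stm_def inm_def dualm_def)

lemma parts_dualm [simp]:
  "stm (dualm A B) = A"
  "dim_row B = dim_row A \<Longrightarrow> dim_col B = dim_col A \<Longrightarrow> inm (dualm A B) = B"
  by (auto intro!: eq_matI)

lemma parts_eqI: "stm A = stm B \<Longrightarrow> inm A = inm B \<Longrightarrow> A = B"
proof (rule eq_matI)
  assume eq: "stm A = stm B" "inm A = inm B"
  show dim: "dim_row A = dim_row B" "dim_col A = dim_col B"
    using arg_cong[OF eq(1), of dim_row] arg_cong[OF eq(1), of dim_col] by simp_all
  fix i j assume "i < dim_row B" "j < dim_col B"
  then show "A $$ (i,j) = B $$ (i,j)"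
    using arg_cong[OF eq(1), of "\<lambda>M. M $$ (i,j)"] arg_cong[OF eq(2), of "\<lambda>M. M $$ (i,j)"] dim
    by (simp add: dual_eq_iff)
qed

lemma parts_mult:
  fixes A B :: "'a :: ring_1 dual mat"
  assumes "dim_col A = dim_row B"
  shows "stm (A * B) = stm A * stm B" "inm (A * B) = stm A * inm B + inm A * stm B"
proof -
  show "stm (A * B) = stm A * stm B"
  proof (rule eq_matI)
    fix i j assume "i < dim_row (stm A * stm B)" "j < dim_col (stm A * stm B)"
    then show "stm (A * B) $$ (i,j) = (stm A * stm B) $$ (i,j)"
      using assms by (simp add: mult_index[OF _ refl] del: index_mult_mat(1))
  qed auto
  show "inm (A * B) = stm A * inm B + inm A * stm B"
  proof (rule eq_matI)
    fix i j assume "i < dim_row (stm A * inm B + inm A * stm B)" "j < dim_col (stm A * inm B + inm A * stm B)"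
    then show "inm (A * B) $$ (i,j) = (stm A * inm B + inm A * stm B) $$ (i,j)"
      using assms by (simp add: mult_index[OF _ refl] sum.distrib del: index_mult_mat(1))
  qed auto
qed

lemma parts_adj [simp]:
  "stm (A\<^sup>\<dagger>) = (stm A)\<^sup>\<dagger>" "inm (A\<^sup>\<dagger>) = (inm A)\<^sup>\<dagger>"
  by (auto intro!: eq_matI)

lemma parts_one [simp]:
  "stm (1\<^sub>m n) = (1\<^sub>m n :: 'a :: ring_1 mat)" "inm (1\<^sub>m n) = (0\<^sub>m n n :: 'a :: ring_1 mat)"
  by (auto intro!: eq_matI)

lemma unitary_lift:
  assumes "unitary n U"
  shows "unitary n (dualm U (0\<^sub>m n n))"
  unfolding unitary_def
  using unitary_dim[OF assms] unitary_cancel[OF assms]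
  by (auto intro!: parts_eqI carrier_matI simp: parts_mult)

text \<open>
  In the product of \<open>I + \<epsilon> K\<close> with its adjoint the infinitesimal part is \<open>K + K\<^sup>*\<close>; it
  vanishes because \<open>K\<close> is skew-Hermitian.
\<close>

lemma unitary_infinitesimal:
  fixes K :: "'a :: star_ring mat"
  assumes K: "K \<in> carrier_mat n n" "K\<^sup>\<dagger> = - K"
  shows "unitary n (dualm (1\<^sub>m n) K)"
proof -
  have "K + - K = 0\<^sub>m n n" "- K + K = 0\<^sub>m n n"
    using K(1) by (auto intro!: eq_matI)
  then show ?thesis
    unfolding unitary_def using K
    by (auto intro!: parts_eqI carrier_matI simp: parts_mult)
qed

text \<open>
  Let \<open>U\<close> be a completion of the standard part of \<open>P\<close>. A dual completion is sought as
  \<open>U (I + \<epsilon> K)\<close>, which forces the first \<open>k\<close> columns of \<open>K\<close> to be those of \<open>U\<^sup>*\<close> times the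
  infinitesimal part of \<open>P\<close>. The infinitesimal part of \<open>P\<^sup>* P = I\<close> says that their upper
  square block is skew-Hermitian, so they extend to a skew-Hermitian \<open>K\<close>.
\<close>

lemma dual_orthonormal_completion:
  fixes P :: "quat dual mat"
  assumes P: "P \<in> carrier_mat m k" "P\<^sup>\<dagger> * P = 1\<^sub>m k"
  obtains U where "k \<le> m" "unitary m U" "\<And>i j. i < m \<Longrightarrow> j < k \<Longrightarrow> U $$ (i,j) = P $$ (i,j)"
proof -
  have dimP: "dim_row P = m" "dim_col P = k"
    using P(1) by auto
  have st: "(stm P)\<^sup>\<dagger> * stm P = 1\<^sub>m k"
    using arg_cong[OF P(2), of stm] by (simp add: parts_mult)
  have inn: "(stm P)\<^sup>\<dagger> * inm P + (inm P)\<^sup>\<dagger> * stm P = 0\<^sub>m k k"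
    using arg_cong[OF P(2), of inm] by (simp add: parts_mult)
  obtain U where U: "k \<le> m" "unitary m U" "\<And>i j. i < m \<Longrightarrow> j < k \<Longrightarrow> U $$ (i,j) = stm P $$ (i,j)"
    using orthonormal_completion[OF carrier_matI st] dimP by auto
  note dimU = unitary_dim[OF U(2)]
  define G where "G = U\<^sup>\<dagger> * inm P"
  have dimG: "dim_row G = m" "dim_col G = k"
    by (auto simp: G_def dimU dimP)
  have G: "G $$ (i,j) = ((stm P)\<^sup>\<dagger> * inm P) $$ (i,j)" if "i < k" "j < k" for i j
    unfolding G_def using that U by (intro adj_mult_cong_cols[of _ m]) (auto simp: dimP dimU)
  have skew: "G $$ (i,j) = - conjugate (G $$ (j,i))" if "i < k" "j < k" for i j
  proof -
    have "((stm P)\<^sup>\<dagger> * inm P)\<^sup>\<dagger> = (inm P)\<^sup>\<dagger> * stm P"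
      by (simp add: adj_mult)
    then have "conjugate (((stm P)\<^sup>\<dagger> * inm P) $$ (j,i)) = ((inm P)\<^sup>\<dagger> * stm P) $$ (i,j)"
      using that dimP adj_index[of i "(stm P)\<^sup>\<dagger> * inm P" j] by (simp del: index_mult_mat(1))
    then show ?thesis
      using arg_cong[OF inn, of "\<lambda>M. M $$ (i,j)"] that dimP
      by (simp add: G del: index_mult_mat(1)) (metis eq_neg_iff_add_eq_0)
  qed
  define K where "K = mat m m (\<lambda>(i,j). if j < k then G $$ (i,j)
    else if i < k then - conjugate (G $$ (j,i)) else 0)"
  have "K\<^sup>\<dagger> = - K"
  proof (rule eq_matI)
    fix i j assume "i < dim_row (- K)" "j < dim_col (- K)"
    then show "K\<^sup>\<dagger> $$ (i,j) = (- K) $$ (i,j)"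
      using skew[of i j] by (auto simp: K_def conjugate_uminus)
  qed (auto simp: K_def)
  then have uK: "unitary m (dualm (1\<^sub>m m) K)"
    by (intro unitary_infinitesimal) (auto simp: K_def)
  define W where "W = dualm U (0\<^sub>m m m) * dualm (1\<^sub>m m) K"
  have W: "unitary m W"
    unfolding W_def by (intro unitary_mult unitary_lift U(2) uK)
  have stW: "stm W = U" and inW: "inm W = U * K"
    by (auto simp: W_def parts_mult dimU K_def)
  have "W $$ (i,j) = P $$ (i,j)" if ij: "i < m" "j < k" for i j
  proof -
    have "(U * K) $$ (i,j) = (U * G) $$ (i,j)"
      using ij U(1) by (intro mult_cong_col[of _ m]) (auto simp: dimU dimG K_def)
    also have "U * G = inm P"
      by (simp add: G_def unitary_cancel[OF U(2)] dimP)
    finally have "in_part (W $$ (i,j)) = in_part (P $$ (i,j))"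
      using ij U(1) unitary_dim[OF W] dimP by (simp flip: inW del: index_mult_mat(1))
    moreover have "st_part (W $$ (i,j)) = st_part (P $$ (i,j))"
      using ij U(1,3) unitary_dim[OF W] dimP
      by (metis less_le_trans parts_index(1) stW)
    ultimately show ?thesis
      by (simp add: dual_eq_iff)
  qed
  then show thesis
    using that U(1) W by blast
qed

section \<open>The spectral theorem for quaternion matrices\<close>

subsection \<open>Compactness of the unit sphere\<close>

lemma bounded_real_convergent_subsequence:
  fixes f :: "nat \<Rightarrow> real"
  assumes "\<And>k. \<bar>f k\<bar> \<le> B"
  obtains s where "strict_mono s" "convergent (\<lambda>k. f (s k))"
proof -
  obtain s where s: "strict_mono s" "monoseq (\<lambda>k. f (s k))"
    using seq_monosub[of f] by auto
  have "Bseq (\<lambda>k. f (s k))"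
    using assms by (intro BseqI'[of _ B]) auto
  then show thesis
    using that[OF s(1)] Bseq_monoseq_convergent[OF _ s(2)] by blast
qed

text \<open>Successive extraction of subsequences, one member of the family at a time.\<close>

lemma bounded_family_convergent_subsequence:
  fixes F :: "(nat \<Rightarrow> real) set"
  assumes "finite F" "\<And>f k. f \<in> F \<Longrightarrow> \<bar>f k\<bar> \<le> B"
  shows "\<exists>s. strict_mono s \<and> (\<forall>f\<in>F. convergent (\<lambda>k. f (s k)))"
  using assms
proof (induction F rule: finite_induct)
  case empty
  have "strict_mono (\<lambda>k::nat. k)"
    by (simp add: strict_mono_def)
  then show ?case
    by blast
next
  case (insert f F)
  then obtain s where s: "strict_mono s" "\<forall>f\<in>F. convergent (\<lambda>k. f (s k))"
    by auto
  obtain r where r: "strict_mono r" "convergent (\<lambda>k. f (s (r k)))"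
    using bounded_real_convergent_subsequence[of "\<lambda>k. f (s k)" B] insert.prems by auto
  have "strict_mono (s \<circ> r)"
    using s(1) r(1) by (rule strict_mono_o)
  moreover have "convergent (\<lambda>k. g ((s \<circ> r) k))" if "g \<in> F" for g
    using convergent_subseq_convergent[of "\<lambda>k. g (s k)" r] s(2) r(1) that by (simp add: o_def)
  ultimately show ?case
    using r(2) by (auto intro!: exI[of _ "s \<circ> r"])
qed

definition qlim :: "(nat \<Rightarrow> quat) \<Rightarrow> quat \<Rightarrow> bool" where
  "qlim y l \<longleftrightarrow> (\<lambda>k. qRe (y k)) \<longlonglongrightarrow> qRe l \<and> (\<lambda>k. qI (y k)) \<longlonglongrightarrow> qI l \<and>
    (\<lambda>k. qJ (y k)) \<longlonglongrightarrow> qJ l \<and> (\<lambda>k. qK (y k)) \<longlonglongrightarrow> qK l"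

lemma qlim_const: "qlim (\<lambda>_. c) c"
  by (simp add: qlim_def)

lemma qlim_add: "qlim x a \<Longrightarrow> qlim y b \<Longrightarrow> qlim (\<lambda>k. x k + y k) (a + b)"
  by (auto simp: qlim_def intro!: tendsto_intros)

lemma qlim_mult: "qlim x a \<Longrightarrow> qlim y b \<Longrightarrow> qlim (\<lambda>k. x k * y k) (a * b)"
  by (auto simp: qlim_def quat_sel_times intro!: tendsto_intros)

lemma qlim_conjugate: "qlim x a \<Longrightarrow> qlim (\<lambda>k. conjugate (x k)) (conjugate a)"
  by (auto simp: qlim_def intro!: tendsto_intros)

lemma qlim_sum: "(\<And>i. i \<in> S \<Longrightarrow> qlim (x i) (a i)) \<Longrightarrow> qlim (\<lambda>k. \<Sum>i\<in>S. x i k) (\<Sum>i\<in>S. a i)"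
  by (induction S rule: infinite_finite_induct) (auto intro: qlim_add qlim_const)

lemma qlim_unique: "qlim x a \<Longrightarrow> qlim x b \<Longrightarrow> a = b"
  by (auto simp: qlim_def quat_eq_iff intro: LIMSEQ_unique)

definition mlim :: "nat \<Rightarrow> nat \<Rightarrow> (nat \<Rightarrow> quat mat) \<Rightarrow> quat mat \<Rightarrow> bool" where
  "mlim m n X L \<longleftrightarrow> (\<forall>k. X k \<in> carrier_mat m n) \<and> L \<in> carrier_mat m n \<and>
    (\<forall>i<m. \<forall>j<n. qlim (\<lambda>k. X k $$ (i,j)) (L $$ (i,j)))"

lemma mlim_const: "A \<in> carrier_mat m n \<Longrightarrow> mlim m n (\<lambda>_. A) A"
  by (simp add: mlim_def qlim_const)

lemma mlim_mult:
  assumes "mlim m n X A" "mlim n p Y B"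
  shows "mlim m p (\<lambda>k. X k * Y k) (A * B)"
proof -
  have dim: "dim_row (X k) = m" "dim_col (X k) = n" "dim_row (Y k) = n" "dim_col (Y k) = p"
    "dim_row A = m" "dim_col A = n" "dim_row B = n" "dim_col B = p" for k
    using assms by (auto simp: mlim_def)
  have "qlim (\<lambda>k. \<Sum>l<n. X k $$ (i,l) * Y k $$ (l,j)) (\<Sum>l<n. A $$ (i,l) * B $$ (l,j))"
    if "i < m" "j < p" for i j
    using assms that by (intro qlim_sum qlim_mult) (auto simp: mlim_def)
  then show ?thesis
    unfolding mlim_def
    by (auto intro!: carrier_matI simp: dim mult_index[of _ n] simp del: index_mult_mat(1))
qed

lemma mlim_adj: "mlim m n X A \<Longrightarrow> mlim n m (\<lambda>k. (X k)\<^sup>\<dagger>) (A\<^sup>\<dagger>)"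
proof -
  assume *: "mlim m n X A"
  then have dim: "dim_row (X k) = m" "dim_col (X k) = n" "dim_row A = m" "dim_col A = n" for k
    by (auto simp: mlim_def)
  show ?thesis
    using * by (auto simp: mlim_def dim intro!: qlim_conjugate)
qed

lemma mlim_unique:
  assumes "mlim m n X A" "mlim m n X B"
  shows "A = B"
proof (rule eq_matI)
  fix i j assume "i < dim_row B" "j < dim_col B"
  then show "A $$ (i,j) = B $$ (i,j)"
    using assms by (auto simp: mlim_def intro: qlim_unique[of "\<lambda>k. X k $$ (i,j)"])
qed (use assms in \<open>auto simp: mlim_def\<close>)

text \<open>
  The hypothesis combines sequential compactness of \<open>K\<close> with continuity of \<open>f\<close>, so that
  neither requires a topology on matrices.
\<close>

lemma attains_max:
  fixes f :: "'a \<Rightarrow> real"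
  assumes ne: "K \<noteq> {}"
    and cpt: "\<And>X :: nat \<Rightarrow> 'a. (\<And>k. X k \<in> K) \<Longrightarrow>
      \<exists>s L. strict_mono s \<and> L \<in> K \<and> (\<lambda>k. f (X (s k))) \<longlonglongrightarrow> f L"
  obtains x where "x \<in> K" "\<And>y. y \<in> K \<Longrightarrow> f y \<le> f x"
proof -
  have bdd: "bdd_above (f ` K)"
  proof (rule ccontr)
    assume "\<not> bdd_above (f ` K)"
    then have "\<exists>x\<in>K. real k < f x" for k
      unfolding bdd_above_def by (auto simp: not_le)
    then obtain X where X: "\<And>k. X k \<in> K" "\<And>k. real k < f (X k)"
      by metis
    from cpt[of X] X(1) obtain s L where s: "strict_mono s" "(\<lambda>k. f (X (s k))) \<longlonglongrightarrow> f L"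
      by auto
    from s(2) obtain B where B: "norm (f (X (s k))) \<le> B" for k
      using Bseq_def convergentI convergent_imp_Bseq by metis
    obtain k where "B < real k"
      using reals_Archimedean2 by auto
    also have "real k \<le> real (s k)"
      using seq_suble[OF s(1)] by simp
    also have "\<dots> < f (X (s k))"
      by (rule X)
    finally show False
      using B[of k] by simp
  qed
  define S where "S = Sup (f ` K)"
  have "\<exists>x\<in>K. S - 1 / real (Suc k) < f x" for k
    using less_cSup_iff[of "f ` K" "S - 1 / real (Suc k)"] ne bdd by (auto simp: S_def)
  then obtain X where X: "\<And>k. X k \<in> K" "\<And>k. S - 1 / real (Suc k) < f (X k)"
    by metis
  from cpt[of X] X(1) obtain s L where s: "strict_mono s" "L \<in> K" "(\<lambda>k. f (X (s k))) \<longlonglongrightarrow> f L"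
    by auto
  have "(\<lambda>k. S - 1 / real (Suc k)) \<longlonglongrightarrow> S - 0"
    using LIMSEQ_inverse_real_of_nat by (intro tendsto_intros) (simp add: inverse_eq_divide)
  moreover have "S - 1 / real (Suc k) \<le> f (X (s k))" for k
  proof -
    have "1 / real (Suc (s k)) \<le> 1 / real (Suc k)"
      using seq_suble[OF s(1), of k] by (simp add: divide_simps)
    then show ?thesis
      using X(2)[of "s k"] by linarith
  qed
  ultimately have "S - 0 \<le> f L"
    using s(3) by (intro LIMSEQ_le) auto
  then have "f y \<le> f L" if "y \<in> K" for y
    using cSup_upper[OF _ bdd, of "f y"] that by (simp add: S_def)
  then show thesis
    using that s(2) by blast
qed

text \<open>
  Column vectors are elements of \<open>carrier_mat n 1\<close>; the literal \<open>1\<close> has to survive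
  simplification.
\<close>

declare One_nat_def [simp del]

subsection \<open>The real inner product on quaternion columns\<close>

definition mscale :: "real \<Rightarrow> 'a :: real_vector mat \<Rightarrow> 'a mat" where
  "mscale a = map_mat (scaleR a)"

lemma mscale_dim [simp]: "dim_row (mscale a A) = dim_row A" "dim_col (mscale a A) = dim_col A"
  by (simp_all add: mscale_def)

lemma mscale_index [simp]:
  "i < dim_row A \<Longrightarrow> j < dim_col A \<Longrightarrow> mscale a A $$ (i,j) = a *\<^sub>R A $$ (i,j)"
  by (simp add: mscale_def)

lemma mult_mscale:
  fixes A B :: "'a :: real_algebra_1 mat"
  assumes "dim_col A = dim_row B"
  shows "mscale a A * B = mscale a (A * B)" "A * mscale a B = mscale a (A * B)"
  using assms
  by (auto intro!: eq_matI simp: mult_index[OF _ refl] scaleR_sum_right simp del: index_mult_mat(1))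

text \<open>The real part of the quaternion inner product: real bilinear and symmetric.\<close>

definition ip :: "quat mat \<Rightarrow> quat mat \<Rightarrow> real" where
  "ip u v = (\<Sum>i<dim_row u. qRe (conjugate (u $$ (i,0)) * v $$ (i,0)))"

lemma ip_eq:
  assumes "dim_row v = dim_row u" "dim_col u = 1" "dim_col v = 1"
  shows "ip u v = qRe ((u\<^sup>\<dagger> * v) $$ (0,0))"
  using assms by (simp add: ip_def mult_index qRe_sum del: index_mult_mat(1))

lemma ip_add:
  assumes "u \<in> carrier_mat n 1" "v \<in> carrier_mat n 1" "w \<in> carrier_mat n 1"
  shows "ip (u + v) w = ip u w + ip v w" "ip w (u + v) = ip w u + ip w v"
    "ip (u - v) w = ip u w - ip v w" "ip w (u - v) = ip w u - ip w v"
  using assms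
  by (auto simp: ip_def conjugate_add conjugate_diff algebra_simps sum.distrib sum_subtractf)

lemma ip_mscale:
  assumes "u \<in> carrier_mat n 1" "v \<in> carrier_mat n 1"
  shows "ip (mscale a u) v = a * ip u v" "ip u (mscale a v) = a * ip u v"
  using assms by (auto simp: ip_def conjugate_scaleR sum_distrib_left)

lemma ip_commute:
  assumes "u \<in> carrier_mat n 1" "v \<in> carrier_mat n 1"
  shows "ip u v = ip v u"
  using assms by (auto simp: ip_def quat_sel_times algebra_simps)

lemma ip_self:
  assumes "u \<in> carrier_mat n 1"
  shows "ip u u = (\<Sum>i<n. qnorm2 (u $$ (i,0)))"
  using assms by (auto simp: ip_def conjugate_mult_self)

lemma adj_mult_self_column:
  assumes "u \<in> carrier_mat n 1"
  shows "u\<^sup>\<dagger> * u = 1\<^sub>m 1 \<longleftrightarrow> ip u u = 1"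
proof -
  have "(u\<^sup>\<dagger> * u) $$ (0,0) = of_real (ip u u)"
    using assms unfolding ip_self[OF assms]
    by (simp add: mult_index[of _ n] conjugate_mult_self del: index_mult_mat(1))
  then have "u\<^sup>\<dagger> * u = 1\<^sub>m 1 \<Longrightarrow> ip u u = 1"
    by (metis index_one_mat(1) less_one of_real_eq_1_iff)
  moreover have "u\<^sup>\<dagger> * u = 1\<^sub>m 1" if "ip u u = 1"
    using assms that \<open>(u\<^sup>\<dagger> * u) $$ (0,0) = _\<close>
    by (intro eq_matI) (auto simp del: index_mult_mat(1))
  ultimately show ?thesis
    by blast
qed

lemma ip_self_nonneg: "u \<in> carrier_mat n 1 \<Longrightarrow> ip u u \<ge> 0"
  by (simp add: ip_self sum_nonneg qnorm2_nonneg)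

lemma ip_self_eq_0: "u \<in> carrier_mat n 1 \<Longrightarrow> ip u u = 0 \<Longrightarrow> u = 0\<^sub>m n 1"
  by (auto intro!: eq_matI simp: ip_self sum_nonneg_eq_0_iff qnorm2_nonneg)

lemma ip_hermitian:
  assumes "u \<in> carrier_mat n 1" "v \<in> carrier_mat n 1" "H \<in> carrier_mat n n" "H\<^sup>\<dagger> = H"
  shows "ip u (H * v) = ip (H * u) v"
  using assms by (subst (1 2) ip_eq) (auto simp: adj_mult mult_assoc simp del: index_mult_mat(1))

text \<open>
  The first-order condition at a maximum: small \<open>t\<close> make the right-hand side negligible.
\<close>

lemma real_quadratic_le:
  fixes a c :: real
  assumes "\<And>t. 2 * t * a \<le> t\<^sup>2 * c" "c \<ge> 0"
  shows "a \<le> 0"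
proof (rule ccontr)
  assume "\<not> a \<le> 0"
  then have a: "a > 0" by simp
  define t where "t = a / (c + 1)"
  have t: "t > 0" "t * (c + 1) = a"
    using a assms(2) by (auto simp: t_def)
  have "2 * t * a \<le> t * (t * c)"
    using assms(1)[of t] by (simp add: power2_eq_square mult.assoc)
  then have "2 * a \<le> t * c"
    using t(1) by (simp add: mult.assoc mult.left_commute[of 2])
  moreover have "t * c < a"
    using t by (simp add: distrib_left)
  ultimately show False
    using a by linarith
qed

lemma unit_sphere_compact:
  fixes X :: "nat \<Rightarrow> quat mat"
  assumes X: "\<And>k. X k \<in> carrier_mat n 1" "\<And>k. ip (X k) (X k) = 1"
  obtains s L where "strict_mono s" "mlim n 1 (\<lambda>k. X (s k)) L"
proof -
  have bound: "qnorm2 (X k $$ (i,0)) \<le> 1" if "i < n" for k i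
  proof -
    have "qnorm2 (X k $$ (i,0)) \<le> (\<Sum>i<n. qnorm2 (X k $$ (i,0)))"
      using that by (intro member_le_sum) (auto simp: qnorm2_nonneg)
    then show ?thesis
      using X(2)[of k] ip_self[OF X(1)] by simp
  qed
  have le1: "\<bar>x\<bar> \<le> 1" if "x\<^sup>2 \<le> (1::real)" for x
    using that by (simp add: abs_square_le_1)
  define F where "F = (\<lambda>(i,c) k. c (X k $$ (i,0))) ` ({..<n} \<times> {qRe, qI, qJ, qK})"
  have "finite F"
    by (simp add: F_def)
  moreover have "\<bar>f k\<bar> \<le> 1" if "f \<in> F" for f k
  proof -
    from that obtain ic where "ic \<in> {..<n} \<times> {qRe, qI, qJ, qK}" "f = (\<lambda>(i,c) k. c (X k $$ (i,0))) ic"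
      unfolding F_def by blast
    then obtain i c where ic: "i < n" "c \<in> {qRe, qI, qJ, qK}" "f k = c (X k $$ (i,0))"
      by (cases ic) auto
    have "(c (X k $$ (i,0)))\<^sup>2 \<le> qnorm2 (X k $$ (i,0))"
      using ic(2) by (auto simp: qnorm2_def)
    then show ?thesis
      using bound[OF ic(1), of k] ic(3) by (intro le1) simp
  qed
  ultimately obtain s where s: "strict_mono s" "\<forall>f\<in>F. convergent (\<lambda>k. f (s k))"
    using bounded_family_convergent_subsequence[of F 1] by blast
  define g where "g c i = lim (\<lambda>k. c (X (s k) $$ (i,0)))" for c :: "quat \<Rightarrow> real" and i
  have lim: "(\<lambda>k. c (X (s k) $$ (i,0))) \<longlonglongrightarrow> g c i" if "i < n" "c \<in> {qRe, qI, qJ, qK}" for i c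
  proof -
    have "(\<lambda>k. c (X k $$ (i,0))) \<in> F"
      using that by (auto simp: F_def)
    then show ?thesis
      using s(2) unfolding g_def convergent_LIMSEQ_iff[symmetric] by fastforce
  qed
  define L where "L = mat n 1 (\<lambda>(i,j). Quat (g qRe i) (g qI i) (g qJ i) (g qK i))"
  have "mlim n 1 (\<lambda>k. X (s k)) L"
    using X(1) lim by (simp add: mlim_def L_def qlim_def)
  then show thesis
    using that s(1) by blast
qed

subsection \<open>Eigenvectors and diagonalization\<close>

text \<open>
  Let \<open>x\<close> maximize the quadratic form of \<open>H\<close> on the unit sphere of the kernel of \<open>M\<close>, and let
  \<open>\<mu>\<close> be the maximum. The residual \<open>y = H x - \<mu> x\<close> again lies in the kernel, since \<open>H\<close>
  commutes with \<open>M\<close>; moving from \<open>x\<close> in the direction of \<open>y\<close> would increase the Rayleigh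
  quotient to first order by twice the squared length of \<open>y\<close>, so \<open>y\<close> is zero. With \<open>M = 0\<close>
  this is the existence of an eigenvector.
\<close>

lemma common_eigenvector:
  fixes H M :: "quat mat"
  assumes H: "H \<in> carrier_mat n n" "H\<^sup>\<dagger> = H"
    and M: "M \<in> carrier_mat n n" "M * H = H * M"
    and z: "z \<in> carrier_mat n 1" "M * z = 0\<^sub>m n 1" "z \<noteq> 0\<^sub>m n 1"
  obtains x \<mu> where "x \<in> carrier_mat n 1" "x\<^sup>\<dagger> * x = 1\<^sub>m 1" "M * x = 0\<^sub>m n 1" "H * x = mscale \<mu> x"
proof -
  define K where "K = {x \<in> carrier_mat n 1. ip x x = 1 \<and> M * x = 0\<^sub>m n 1}"
  define f where "f x = ip x (H * x)" for x
  have dim: "dim_row H = n" "dim_col H = n" "dim_row M = n" "dim_col M = n"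
    using H M by auto
  have Hc [simp]: "H * x \<in> carrier_mat n 1" if "x \<in> carrier_mat n 1" for x
    using that H(1) by auto
  have sc [simp]: "mscale a x \<in> carrier_mat n 1" if "x \<in> carrier_mat n 1" for a x
    using that by (auto intro!: carrier_matI)
  have M_sc: "M * mscale a x = 0\<^sub>m n 1" if "x \<in> carrier_mat n 1" "M * x = 0\<^sub>m n 1" for a x
    using that dim by (subst mult_mscale) (auto intro!: eq_matI)
  have normalize: "mscale (1 / sqrt (ip x x)) x \<in> K"
    if "x \<in> carrier_mat n 1" "M * x = 0\<^sub>m n 1" "ip x x \<noteq> 0" for x
    using that ip_self_nonneg[OF that(1)]
    by (simp add: K_def M_sc ip_mscale[where n = n])
  have "ip z z \<noteq> 0"
    using ip_self_eq_0[OF z(1)] z(3) by blast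
  then have "K \<noteq> {}"
    using normalize z by blast
  moreover have "\<exists>s L. strict_mono s \<and> L \<in> K \<and> (\<lambda>k. f (X (s k))) \<longlonglongrightarrow> f L"
    if X: "\<And>k. X k \<in> K" for X :: "nat \<Rightarrow> quat mat"
  proof -
    obtain s L where s: "strict_mono s" "mlim n 1 (\<lambda>k. X (s k)) L"
      using X by (rule_tac unit_sphere_compact[of X n]) (auto simp: K_def)
    have L: "L \<in> carrier_mat n 1"
      using s(2) by (simp add: mlim_def)
    have X': "X k \<in> carrier_mat n 1" "(X k)\<^sup>\<dagger> * X k = 1\<^sub>m 1" "M * X k = 0\<^sub>m n 1" for k
      using X[of k] by (auto simp: K_def adj_mult_self_column)
    have "mlim 1 1 (\<lambda>k. (X (s k))\<^sup>\<dagger> * X (s k)) (L\<^sup>\<dagger> * L)"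
      using s(2) by (intro mlim_mult[of _ n] mlim_adj)
    then have 1: "L\<^sup>\<dagger> * L = 1\<^sub>m 1"
      unfolding X'(2) by (rule mlim_unique) (simp add: mlim_const)
    have "mlim n 1 (\<lambda>k. M * X (s k)) (M * L)"
      using s(2) M by (intro mlim_mult[of _ n] mlim_const)
    then have 2: "M * L = 0\<^sub>m n 1"
      unfolding X'(3) by (rule mlim_unique) (simp add: mlim_const)
    have "mlim 1 1 (\<lambda>k. (X (s k))\<^sup>\<dagger> * (H * X (s k))) (L\<^sup>\<dagger> * (H * L))"
      using s(2) H by (intro mlim_mult[of _ n] mlim_adj mlim_const)
    then have "qlim (\<lambda>k. ((X (s k))\<^sup>\<dagger> * (H * X (s k))) $$ (0,0)) ((L\<^sup>\<dagger> * (H * L)) $$ (0,0))"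
      by (simp add: mlim_def del: index_mult_mat(1))
    moreover have "f y = qRe ((y\<^sup>\<dagger> * (H * y)) $$ (0,0))" if "y \<in> carrier_mat n 1" for y
      unfolding f_def using that dim by (intro ip_eq) auto
    ultimately have "(\<lambda>k. f (X (s k))) \<longlonglongrightarrow> f L"
      using X'(1) L by (simp add: qlim_def del: index_mult_mat(1))
    moreover have "L \<in> K"
      using L 1 2 by (simp add: K_def adj_mult_self_column)
    ultimately show "\<exists>s L. strict_mono s \<and> L \<in> K \<and> (\<lambda>k. f (X (s k))) \<longlonglongrightarrow> f L"
      using s(1) by blast
  qed
  ultimately obtain x where x: "x \<in> K" "\<And>y. y \<in> K \<Longrightarrow> f y \<le> f x"
    using attains_max[of K f] by blast
  define \<mu> where "\<mu> = f x"
  have xc: "x \<in> carrier_mat n 1" "ip x x = 1" "M * x = 0\<^sub>m n 1"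
    using x(1) by (auto simp: K_def)
  have homogeneous: "f y \<le> \<mu> * ip y y" if y: "y \<in> carrier_mat n 1" "M * y = 0\<^sub>m n 1" for y
  proof (cases "ip y y = 0")
    case True
    then have "y = 0\<^sub>m n 1"
      using ip_self_eq_0 y(1) by blast
    then show ?thesis
      using True y dim by (simp add: f_def)
  next
    case False
    then have pos: "ip y y > 0"
      using ip_self_nonneg[OF y(1)] by simp
    define a where "a = 1 / sqrt (ip y y)"
    have a: "a * a * ip y y = 1" "a * a > 0"
      using pos by (auto simp: a_def)
    have "f (mscale a y) \<le> \<mu>"
      unfolding \<mu>_def a_def using x(2) normalize[OF y False] by blast
    then have "a * a * f y \<le> a * a * (\<mu> * ip y y)"
      using y a(1) dim by (simp add: f_def mult_mscale ip_mscale[where n = n] mult.left_commute[of _ \<mu>])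
    then show ?thesis
      using a(2) mult_le_cancel_left_pos by blast
  qed
  define y where "y = H * x - mscale \<mu> x"
  have yc [simp]: "y \<in> carrier_mat n 1"
    unfolding y_def by (intro minus_carrier_mat sc xc(1))
  have My: "M * y = 0\<^sub>m n 1"
  proof -
    have "M * y = M * (H * x) - M * mscale \<mu> x"
      unfolding y_def using M xc(1) by (intro mult_minus_distrib_mat[of _ n n _ 1]) auto
    also have "M * (H * x) = H * (M * x)"
      using M(2) xc(1) dim by (simp flip: mult_assoc)
    finally show ?thesis
      using xc dim H(1) by (simp add: M_sc)
  qed
  have "2 * t * ip y y \<le> t\<^sup>2 * (\<mu> * ip y y - f y)" for t
  proof -
    define w where "w = x + mscale t y"
    have wc: "w \<in> carrier_mat n 1"
      using xc(1) by (auto simp: w_def)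
    have "M * w = M * x + M * mscale t y"
      unfolding w_def using M xc(1) by (intro mult_add_distrib_mat[of _ n n _ 1]) auto
    then have "M * w = 0\<^sub>m n 1"
      using xc(3) My by (simp add: M_sc)
    then have le: "f w \<le> \<mu> * ip w w"
      using homogeneous wc by blast
    have Hw: "H * w = H * x + mscale t (H * y)"
      unfolding w_def using H(1) xc(1) mult_add_distrib_mat[of H n n x 1 "mscale t y"] dim carrier_matD[OF yc]
      by (simp add: mult_mscale)
    note ips = ip_add[where n = n] ip_mscale[where n = n]
    have fw: "f w = \<mu> + 2 * t * ip y (H * x) + t\<^sup>2 * f y"
      unfolding f_def Hw using ip_hermitian[OF xc(1) yc H] ip_commute[of y n "H * x"] xc(1)
      by (simp add: w_def ips \<mu>_def f_def power2_eq_square algebra_simps)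
    have ww: "ip w w = 1 + 2 * t * ip y x + t\<^sup>2 * ip y y"
      using xc(1,2) ip_commute[OF xc(1) yc]
      by (simp add: w_def ips power2_eq_square algebra_simps)
    have yy: "ip y y = ip y (H * x) - \<mu> * ip y x"
      using xc(1) by (subst (2) y_def) (simp add: ips)
    have "2 * t * (ip y (H * x) - \<mu> * ip y x) \<le> t\<^sup>2 * (\<mu> * ip y y - f y)"
      using le unfolding fw ww by (simp add: algebra_simps)
    then show ?thesis
      unfolding yy[symmetric] .
  qed
  then have "ip y y \<le> 0"
    by (rule real_quadratic_le) (use homogeneous[OF yc My] in simp)
  then have "ip y y = 0"
    using ip_self_nonneg[OF yc] by simp
  then have "y = 0\<^sub>m n 1"
    by (rule ip_self_eq_0[OF yc])
  then have "H * x = mscale \<mu> x"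
    unfolding y_def using Hc[OF xc(1)] sc[OF xc(1)] by (rule mat_eq_if_minus_eq_zero)
  with xc(1) _ xc(3) show thesis
    by (rule that) (simp only: adj_mult_self_column[OF xc(1)] xc(2))
qed

lemma hermitian_conj:
  fixes H U :: "'a :: star_ring mat"
  assumes "H\<^sup>\<dagger> = H" "H \<in> carrier_mat n n" "U \<in> carrier_mat n k"
  shows "(U\<^sup>\<dagger> * H * U)\<^sup>\<dagger> = U\<^sup>\<dagger> * H * U"
  using assms(1) carrier_matD[OF assms(2)] carrier_matD[OF assms(3)]
  by (simp add: adj_mult mult_assoc)

text \<open>
  Splitting off an eigenvector of a Hermitian matrix: the first column of \<open>U\<^sup>* H U\<close>, hence
  also its first row, vanishes off the diagonal.
\<close>

lemma deflate:
  fixes H U :: "quat mat"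
  assumes H: "H \<in> carrier_mat (Suc n) (Suc n)" "H\<^sup>\<dagger> = H"
    and U: "unitary (Suc n) U" "\<And>i. i < Suc n \<Longrightarrow> U $$ (i,0) = x $$ (i,0)"
    and x: "x \<in> carrier_mat (Suc n) 1" "H * x = mscale \<mu> x"
  obtains H' where "H' \<in> carrier_mat n n" "H'\<^sup>\<dagger> = H'"
    "U\<^sup>\<dagger> * H * U = dsum (dmat 1 1 (\<lambda>_. of_real \<mu>)) H'"
proof -
  note dim = unitary_dim[OF U(1)]
  have dH: "dim_row H = Suc n" "dim_col H = Suc n" "dim_row x = Suc n" "dim_col x = 1"
    using H(1) x(1) by auto
  define G where "G = U\<^sup>\<dagger> * H * U"
  have G: "G \<in> carrier_mat (1 + n) (1 + n)" "G\<^sup>\<dagger> = G"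
    using hermitian_conj[OF H(2,1), of U "Suc n"] dim by (auto simp: G_def intro!: carrier_matI)
  have dG: "dim_row G = Suc n" "dim_col G = Suc n"
    using G(1) by auto
  have col: "G $$ (i,0) = (if i = 0 then of_real \<mu> else 0)" if "i < Suc n" for i
  proof -
    have HU: "(H * U) $$ (l,0) = (H * x) $$ (l,0)" if "l < Suc n" for l
      using that U(2) dH dim by (intro mult_cong_col[of _ "Suc n"]) auto
    have "G = U\<^sup>\<dagger> * (H * U)"
      by (simp add: G_def mult_assoc dim dH)
    moreover have "(U\<^sup>\<dagger> * (H * U)) $$ (i,0) = (U\<^sup>\<dagger> * (H * x)) $$ (i,0)"
      by (rule mult_cong_col[of _ "Suc n", OF _ _ _ _ _ _ HU]) (use that dH dim in auto)
    ultimately have "G $$ (i,0) = (U\<^sup>\<dagger> * (H * x)) $$ (i,0)"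
      by simp
    also have "\<dots> = \<mu> *\<^sub>R (U\<^sup>\<dagger> * x) $$ (i,0)"
      unfolding x(2) using that dH dim by (subst mult_mscale) auto
    also have "(U\<^sup>\<dagger> * x) $$ (i,0) = (U\<^sup>\<dagger> * U) $$ (i,0)"
      using that U(2) dH dim by (intro mult_cong_col[of _ "Suc n"]) auto
    finally show ?thesis
      using that by (simp add: unitary_cancel[OF U(1)] of_real_def del: index_mult_mat(1))
  qed
  have row: "G $$ (0,j) = (if j = 0 then of_real \<mu> else 0)" if "j < Suc n" for j
  proof -
    have "G $$ (0,j) = conjugate (G $$ (j,0))"
      using adj_index[of 0 G j] that dG unfolding G(2) by simp
    then show ?thesis
      using col[OF that] by simp
  qed
  define H' where "H' = mat n n (\<lambda>(i,j). G $$ (1 + i, 1 + j))"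
  have "G = dsum (mat 1 1 (\<lambda>(i,j). G $$ (i,j))) H'"
    unfolding H'_def by (rule split_dsum[OF G(1)]) (use col row in auto)
  also have "mat 1 1 (\<lambda>(i,j). G $$ (i,j)) = dmat 1 1 (\<lambda>_. of_real \<mu>)"
    by (rule eq_matI) (auto simp: col)
  finally have G_eq: "G = dsum (dmat 1 1 (\<lambda>_. of_real \<mu>)) H'" .
  have "H'\<^sup>\<dagger> = H'"
    using G(2) unfolding G_eq adj_dsum by (rule dsum_inject) (auto simp: H'_def)
  moreover have "H' \<in> carrier_mat n n"
    by (simp add: H'_def)
  ultimately show thesis
    using that G_eq unfolding G_def by blast
qed

text \<open>
  By induction it suffices to split off a common eigenvector. An eigenvalue \<open>\<mu>\<close> of \<open>H\<close> makes
  the kernel of \<open>H - \<mu> I\<close> nontrivial, and \<open>K\<close> commutes with that matrix.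
\<close>

lemma simultaneous_diagonalization:
  fixes H K :: "quat mat"
  assumes "H \<in> carrier_mat n n" "H\<^sup>\<dagger> = H" "K \<in> carrier_mat n n" "K\<^sup>\<dagger> = K" "H * K = K * H"
  shows "\<exists>Q a b. unitary n Q \<and> Q\<^sup>\<dagger> * H * Q = dmat n n (\<lambda>i. of_real (a i)) \<and>
    Q\<^sup>\<dagger> * K * Q = dmat n n (\<lambda>i. of_real (b i))"
  using assms
proof (induction n arbitrary: H K)
  case 0
  have "A = B" if "dim_row A = 0" "dim_row B = 0" "dim_col A = 0" "dim_col B = 0" for A B :: "quat mat"
    using that by (intro eq_matI) auto
  then show ?case
    using 0 unitary_one[of 0] by (intro exI[of _ "1\<^sub>m 0"] exI[of _ "\<lambda>_. 0"]) auto
next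
  case (Suc n)
  have dim: "dim_row H = Suc n" "dim_col H = Suc n" "dim_row K = Suc n" "dim_col K = Suc n"
    using Suc.prems by auto
  \<comment> \<open>Any nonzero vector will do to start the search with the zero matrix in place of \<open>M\<close>.\<close>
  define e :: "quat mat" where "e = mat (Suc n) 1 (\<lambda>(i,j). 1)"
  have e: "e \<in> carrier_mat (Suc n) 1"
    by (simp add: e_def)
  have "e $$ (0,0) \<noteq> 0\<^sub>m (Suc n) 1 $$ (0,0)"
    by (simp add: e_def)
  then have e_nz: "e \<noteq> 0\<^sub>m (Suc n) 1"
    by metis
  have zero: "0\<^sub>m (Suc n) (Suc n) * H = H * 0\<^sub>m (Suc n) (Suc n)" "0\<^sub>m (Suc n) (Suc n) * e = 0\<^sub>m (Suc n) 1"
    using Suc.prems(1) e by auto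
  obtain x\<^sub>0 \<mu> where x0: "x\<^sub>0 \<in> carrier_mat (Suc n) 1" "x\<^sub>0\<^sup>\<dagger> * x\<^sub>0 = 1\<^sub>m 1"
      "0\<^sub>m (Suc n) (Suc n) * x\<^sub>0 = 0\<^sub>m (Suc n) 1" "H * x\<^sub>0 = mscale \<mu> x\<^sub>0"
    by (rule common_eigenvector[OF Suc.prems(1,2) zero_carrier_mat zero(1) e zero(2) e_nz])
  \<comment> \<open>The kernel of \<open>M\<close> is the eigenspace of \<open>H\<close>, in which \<open>K\<close> has an eigenvector.\<close>
  define M where "M = H - dmat (Suc n) (Suc n) (\<lambda>_. of_real \<mu>)"
  have M: "M \<in> carrier_mat (Suc n) (Suc n)"
    by (auto simp: M_def)
  have scal: "dmat (Suc n) (Suc n) (\<lambda>_. of_real a) * y = mscale a y" if "dim_row y = Suc n" for a and y :: "quat mat"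
    using that by (intro eq_matI) (auto simp: dmat_mult_index of_real_def simp del: index_mult_mat(1))
  have scal': "y * dmat (Suc n) (Suc n) (\<lambda>_. of_real a) = mscale a y" if "dim_col y = Suc n" for a and y :: "quat mat"
    using that by (intro eq_matI) (auto simp: mult_dmat_index of_real_def simp del: index_mult_mat(1))
  have M_mult: "M * y = H * y - mscale \<mu> y" if "y \<in> carrier_mat (Suc n) k" for y k
    unfolding M_def using Suc.prems(1) that
    by (subst minus_mult_distrib_mat[of _ "Suc n" "Suc n"]) (auto simp: scal)
  have KM: "K * M = K * H - mscale \<mu> K"
    unfolding M_def using Suc.prems(1,3)
    by (subst mult_minus_distrib_mat[of _ "Suc n" "Suc n"]) (auto simp: scal' dim)
  have "M * x\<^sub>0 = 0\<^sub>m (Suc n) 1"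
    unfolding M_mult[OF x0(1)] x0(4) using x0(1) by (intro eq_matI) auto
  moreover have "x\<^sub>0 \<noteq> 0\<^sub>m (Suc n) 1"
  proof
    assume "x\<^sub>0 = 0\<^sub>m (Suc n) 1"
    then have "1\<^sub>m 1 = (0\<^sub>m 1 1 :: quat mat)"
      using x0(2) by simp
    moreover have "1\<^sub>m 1 $$ (0,0) \<noteq> (0\<^sub>m 1 1 :: quat mat) $$ (0,0)"
      by simp
    ultimately show False
      by metis
  qed
  moreover have "M * K = K * M"
    unfolding M_mult[OF Suc.prems(3)] KM Suc.prems(5) ..
  ultimately obtain x \<nu> where x: "x \<in> carrier_mat (Suc n) 1" "x\<^sup>\<dagger> * x = 1\<^sub>m 1"
      "M * x = 0\<^sub>m (Suc n) 1" "K * x = mscale \<nu> x"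
    by (rule_tac common_eigenvector[OF Suc.prems(3,4) M _ x0(1)])
  have "H * x - mscale \<mu> x = 0\<^sub>m (Suc n) 1"
    using x(3) unfolding M_mult[OF x(1)] .
  moreover have "H * x \<in> carrier_mat (Suc n) 1" "mscale \<mu> x \<in> carrier_mat (Suc n) 1"
    using x(1) dim by (auto intro!: carrier_matI)
  ultimately have Hx: "H * x = mscale \<mu> x"
    by (rule mat_eq_if_minus_eq_zero)
  obtain U where U: "unitary (Suc n) U" "Suc n > 0" "\<And>i. i < Suc n \<Longrightarrow> U $$ (i,0) = x $$ (i,0)"
    using unit_vector_completion[OF x(1,2)] by blast
  note dU = unitary_dim[OF U(1)]
  obtain H' where H': "H' \<in> carrier_mat n n" "H'\<^sup>\<dagger> = H'"
      "U\<^sup>\<dagger> * H * U = dsum (dmat 1 1 (\<lambda>_. of_real \<mu>)) H'"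
    by (rule deflate[OF Suc.prems(1,2) U(1,3) x(1) Hx])
  obtain K' where K': "K' \<in> carrier_mat n n" "K'\<^sup>\<dagger> = K'"
      "U\<^sup>\<dagger> * K * U = dsum (dmat 1 1 (\<lambda>_. of_real \<nu>)) K'"
    by (rule deflate[OF Suc.prems(3,4) U(1,3) x(1,4)])
  have "(U\<^sup>\<dagger> * H * U) * (U\<^sup>\<dagger> * K * U) = U\<^sup>\<dagger> * (H * K) * U"
    "(U\<^sup>\<dagger> * K * U) * (U\<^sup>\<dagger> * H * U) = U\<^sup>\<dagger> * (K * H) * U"
    by (simp_all add: mult_assoc dU dim unitary_cancel[OF U(1)])
  then have "(U\<^sup>\<dagger> * H * U) * (U\<^sup>\<dagger> * K * U) = (U\<^sup>\<dagger> * K * U) * (U\<^sup>\<dagger> * H * U)"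
    using Suc.prems(5) by simp
  then have "dsum (dmat 1 1 (\<lambda>_. of_real \<mu>) * dmat 1 1 (\<lambda>_. of_real \<nu>)) (H' * K') =
      dsum (dmat 1 1 (\<lambda>_. of_real \<nu>) * dmat 1 1 (\<lambda>_. of_real \<mu>)) (K' * H')"
    unfolding H'(3) K'(3) using H'(1) K'(1) by (subst (asm) (1 2) dsum_mult) auto
  then have "H' * K' = K' * H'"
    by (rule dsum_inject(2)) (use H'(1) K'(1) in auto)
  then obtain Q a b where Q: "unitary n Q" "Q\<^sup>\<dagger> * H' * Q = dmat n n (\<lambda>i. of_real (a i))"
      "Q\<^sup>\<dagger> * K' * Q = dmat n n (\<lambda>i. of_real (b i))"
    using Suc.IH[OF H'(1,2) K'(1,2)] by blast
  note dQ = unitary_dim[OF Q(1)]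
  define W where "W = U * dsum (1\<^sub>m 1) Q"
  have W: "unitary (Suc n) W"
    unfolding W_def using unitary_dsum[OF unitary_one[of 1] Q(1), unfolded plus_1_eq_Suc] U(1) by (intro unitary_mult) simp_all
  have step: "W\<^sup>\<dagger> * L * W = dmat (Suc n) (Suc n) (\<lambda>i. of_real (case i of 0 \<Rightarrow> \<mu> | Suc i \<Rightarrow> a i))"
    if L: "L \<in> carrier_mat (Suc n) (Suc n)" "L' \<in> carrier_mat n n"
      "U\<^sup>\<dagger> * L * U = dsum (dmat 1 1 (\<lambda>_. of_real \<mu>)) L'" "Q\<^sup>\<dagger> * L' * Q = dmat n n (\<lambda>i. of_real (a i))"
    for L L' \<mu> a
  proof -
    have dL: "dim_row L = Suc n" "dim_col L = Suc n" "dim_row L' = n" "dim_col L' = n"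
      using L by auto
    have "W\<^sup>\<dagger> * L * W = dsum (1\<^sub>m 1) (Q\<^sup>\<dagger>) * (U\<^sup>\<dagger> * L * U) * dsum (1\<^sub>m 1) Q"
      by (simp add: W_def adj_mult mult_assoc dL dU dQ adj_dsum)
    also have "\<dots> = dsum (dmat 1 1 (\<lambda>_. of_real \<mu>)) (Q\<^sup>\<dagger> * L' * Q)"
      unfolding L(3) by (simp add: dsum_mult dQ dL)
    also have "\<dots> = dmat (1 + n) (1 + n) (\<lambda>i. if i < 1 then of_real \<mu> else of_real (a (i - 1)))"
      unfolding L(4) dsum_dmat_square ..
    also have "\<dots> = dmat (Suc n) (Suc n) (\<lambda>i. of_real (case i of 0 \<Rightarrow> \<mu> | Suc i \<Rightarrow> a i))"
      by (rule eq_matI) (auto split: nat.splits)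
    finally show ?thesis .
  qed
  show ?case
    using W step[OF Suc.prems(1) H'(1,3) Q(2)] step[OF Suc.prems(3) K'(1,3) Q(3)] by blast
qed

section \<open>Singular value decompositions\<close>

text \<open>
  Diagonalizing \<open>A\<^sup>* A\<close> by \<open>V\<close> makes the columns of \<open>A V\<close> orthogonal, with the eigenvalues as
  squared lengths. The nonzero columns, moved to the front and normalized, are the first
  columns of \<open>U\<close>.
\<close>

lemma quat_svd:
  fixes A :: "quat mat"
  assumes A: "A \<in> carrier_mat m n"
  obtains U V a where "unitary m U" "unitary n V" "U\<^sup>\<dagger> * A * V = dmat m n (\<lambda>i. of_real (a i))"
    "\<And>i. a i \<ge> 0" "antimono a" "\<And>i. min m n \<le> i \<Longrightarrow> a i = 0"
proof -
  have dA: "dim_row A = m" "dim_col A = n"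
    using A by auto
  have AA: "A\<^sup>\<dagger> * A \<in> carrier_mat n n" "(A\<^sup>\<dagger> * A)\<^sup>\<dagger> = A\<^sup>\<dagger> * A"
    using A by (auto simp: adj_mult)
  obtain Q d where Q: "unitary n Q" "Q\<^sup>\<dagger> * (A\<^sup>\<dagger> * A) * Q = dmat n n (\<lambda>i. of_real (d i))"
    using simultaneous_diagonalization[OF AA AA refl] by blast
  obtain p where p: "p permutes {..<n}" "\<And>i j. i \<le> j \<Longrightarrow> j < n \<Longrightarrow> - d (p i) \<le> - d (p j)"
    using sorting_permutation[of n "\<lambda>i. - d i"] by blast
  define V where "V = mat n n (\<lambda>(i,j). Q $$ (i, p j))"
  have V: "unitary n V"
    unfolding V_def by (rule unitary_permute_cols[OF Q(1) p(1)])
  note dV = unitary_dim[OF V]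
  define M where "M = A * V"
  have dM: "dim_row M = m" "dim_col M = n"
    by (simp_all add: M_def dA dV)
  have gram: "(M\<^sup>\<dagger> * M) $$ (i,j) = (if i = j then of_real (d (p i)) else 0)" if "i < n" "j < n" for i j
  proof -
    have pij: "p i < n" "p j < n"
      using that permutes_in_image[OF p(1)] by auto
    have "M\<^sup>\<dagger> * M = V\<^sup>\<dagger> * (A\<^sup>\<dagger> * A) * V"
      by (simp add: M_def adj_mult mult_assoc dA dV)
    then have "(M\<^sup>\<dagger> * M) $$ (i,j) = (Q\<^sup>\<dagger> * (A\<^sup>\<dagger> * A) * Q) $$ (p i, p j)"
      unfolding V_def using mult_permute_index[OF AA(1) Q(1) Q(1) p(1) p(1) that] by simp
    then show ?thesis
      using pij injD[OF permutes_inj[OF p(1)], of i j] by (auto simp: Q(2))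
  qed
  have gram_self: "(M\<^sup>\<dagger> * M) $$ (j,j) = of_real (\<Sum>l<m. qnorm2 (M $$ (l,j)))" if "j < n" for j
    using that by (simp add: mult_index[of _ m] dM conjugate_mult_self del: index_mult_mat(1))
  have d_eq: "d (p j) = (\<Sum>l<m. qnorm2 (M $$ (l,j)))" if "j < n" for j
    using gram_self[OF that] gram[OF that that] by (simp del: of_real_sum)
  have d_nonneg: "d (p j) \<ge> 0" if "j < n" for j
    by (simp add: d_eq[OF that] sum_nonneg qnorm2_nonneg)
  obtain r where r: "r \<le> n" "\<And>i. i < n \<Longrightarrow> d (p i) > 0 \<longleftrightarrow> i < r"
    using p(2) by (rule_tac initial_segment[of n "\<lambda>i. d (p i) > 0"]) (auto intro: less_le_trans)
  define a where "a i = (if i < r then sqrt (d (p i)) else 0)" for i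
  have a_pos: "a i > 0" "a i * a i = d (p i)" if "i < r" for i
    using r(1) r(2)[of i] that by (simp_all add: a_def)
  define N where "N = mat m r (\<lambda>(i,j). (1 / a j) *\<^sub>R M $$ (i,j))"
  have "N\<^sup>\<dagger> * N = 1\<^sub>m r"
  proof (rule eq_matI)
    fix i j assume "i < dim_row (1\<^sub>m r :: quat mat)" "j < dim_col (1\<^sub>m r :: quat mat)"
    then have ij: "i < r" "j < r" by auto
    have "(N\<^sup>\<dagger> * N) $$ (i,j) = (1 / a i * (1 / a j)) *\<^sub>R (M\<^sup>\<dagger> * M) $$ (i,j)"
      using ij r(1) by (simp add: mult_index[of _ m] N_def dM conjugate_scaleR scaleR_sum_right
          mult.commute[of "a j" "a i"] del: index_mult_mat(1))
    then show "(N\<^sup>\<dagger> * N) $$ (i,j) = 1\<^sub>m r $$ (i,j)"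
      using ij r(1) a_pos(1)[OF ij(1)] by (cases "i = j") (simp_all add: gram of_real_def del: index_mult_mat(1) flip: a_pos(2))
  qed (auto simp: N_def)
  then obtain U where U: "r \<le> m" "unitary m U" "\<And>i j. i < m \<Longrightarrow> j < r \<Longrightarrow> U $$ (i,j) = N $$ (i,j)"
    using orthonormal_completion[of N m r] by (auto simp: N_def)
  note dU = unitary_dim[OF U(2)]
  have "U\<^sup>\<dagger> * M = dmat m n (\<lambda>i. of_real (a i))"
  proof (rule eq_matI)
    fix i j assume "i < dim_row (dmat m n (\<lambda>i. of_real (a i) :: quat))" "j < dim_col (dmat m n (\<lambda>i. of_real (a i) :: quat))"
    then have ij: "i < m" "j < n" by auto
    have "(U\<^sup>\<dagger> * M) $$ (i,j) = (if i = j then of_real (a i) else 0)"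
    proof (cases "j < r")
      case True
      have "(U\<^sup>\<dagger> * M) $$ (i,j) = (U\<^sup>\<dagger> * mscale (a j) U) $$ (i,j)"
        using ij True U a_pos[OF True]
        by (intro mult_cong_col[of _ m]) (auto simp: dU dM N_def)
      also have "\<dots> = a j *\<^sub>R (U\<^sup>\<dagger> * U) $$ (i,j)"
        using ij True U(1) by (subst mult_mscale) (auto simp: dU)
      finally show ?thesis
        using ij True U(1) by (simp add: unitary_cancel[OF U(2)] of_real_def del: index_mult_mat(1))
    next
      case False
      have "d (p j) = 0"
        using d_nonneg[OF ij(2)] r(2)[OF ij(2)] False by simp
      then have "\<forall>l<m. M $$ (l,j) = 0"
        using d_eq[OF ij(2)] by (simp add: sum_nonneg_eq_0_iff qnorm2_nonneg)
      then show ?thesis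
        using ij False by (simp add: mult_index[of _ m] dM dU a_def del: index_mult_mat(1))
    qed
    then show "(U\<^sup>\<dagger> * M) $$ (i,j) = dmat m n (\<lambda>i. of_real (a i)) $$ (i,j)"
      using ij by simp
  qed (auto simp: dU dM)
  moreover have "U\<^sup>\<dagger> * A * V = U\<^sup>\<dagger> * M"
    by (simp add: M_def mult_assoc dU dA dV)
  moreover have "a j \<le> a i" if "i \<le> j" for i j
    using that p(2)[of i j] r(1) d_nonneg[of i] by (auto simp: a_def)
  then have "antimono a"
    by (rule antimonoI)
  moreover have "a i \<ge> 0" for i
    using d_nonneg[of i] r(1) by (simp add: a_def)
  moreover have "a i = 0" if "min m n \<le> i" for i
    using that r(1) U(1) by (auto simp: a_def)
  ultimately show thesis
    using that U(2) V by simp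
qed

lemma parts_conj_lift:
  fixes B :: "'a :: star_ring dual mat"
  assumes "B \<in> carrier_mat m n" "P \<in> carrier_mat m m" "Q \<in> carrier_mat n n"
  shows "stm ((dualm P (0\<^sub>m m m))\<^sup>\<dagger> * B * dualm Q (0\<^sub>m n n)) = P\<^sup>\<dagger> * stm B * Q"
    "inm ((dualm P (0\<^sub>m m m))\<^sup>\<dagger> * B * dualm Q (0\<^sub>m n n)) = P\<^sup>\<dagger> * inm B * Q"
  using carrier_matD[OF assms(1)] carrier_matD[OF assms(2)] carrier_matD[OF assms(3)]
  by (simp_all add: parts_mult zero_mult_dim add_zero_dim)

text \<open>
  Let \<open>X\<close> be the infinitesimal part of \<open>B\<close>. Conjugation by \<open>I + \<epsilon> K\<close> and \<open>I + \<epsilon> L\<close> changes the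
  entry \<open>X i j\<close> to \<open>X i j + a i * L i j - K i j * a j\<close>. The skew-Hermitian conditions couple
  this only with the entry at \<open>(j, i)\<close>, and the resulting pair of linear equations has
  determinant \<open>(a i)\<^sup>2 - (a j)\<^sup>2\<close>; it can be solved when \<open>a i \<noteq> a j\<close>. When \<open>a i = a j > 0\<close>, a
  multiple of the skew part of \<open>X\<close> in \<open>K\<close> leaves the Hermitian part. The matrix may be
  rectangular: \<open>a\<close> vanishes outside the square part, so entries of \<open>K\<close> and \<open>L\<close> without a
  partner in \<open>X\<close> are multiplied by zero.
\<close>

lemma remove_off_block_perturbation:
  fixes B :: "quat dual mat" and a :: "nat \<Rightarrow> real"
  assumes B: "B \<in> carrier_mat m n" "stm B = dmat m n (\<lambda>i. of_real (a i))"
    and a: "\<And>i. a i \<ge> 0" "\<And>i. min m n \<le> i \<Longrightarrow> a i = 0"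
  obtains U V Y where "unitary m U" "unitary n V" "U\<^sup>\<dagger> * B * V = dualm (dmat m n (\<lambda>i. of_real (a i))) Y"
    "Y \<in> carrier_mat m n" "\<And>i j. i < m \<Longrightarrow> j < n \<Longrightarrow> a i \<noteq> a j \<Longrightarrow> Y $$ (i,j) = 0"
    "\<And>i j. i < m \<Longrightarrow> j < n \<Longrightarrow> a i = a j \<Longrightarrow> a i > 0 \<Longrightarrow> conjugate (Y $$ (j,i)) = Y $$ (i,j)"
proof -
  have dB: "dim_row B = m" "dim_col B = n"
    using B(1) by auto
  \<comment> \<open>Extended by zero, so that transposed entries make sense in a rectangular matrix.\<close>
  define X where "X i j = (if i < m \<and> j < n then inm B $$ (i,j) else 0)" for i j
  \<comment> \<open>Cramer's rule for the pair of equations at \<open>(i, j)\<close> and \<open>(j, i)\<close>; the factor \<open>f\<close> is antisymmetric.\<close>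
  define f where "f i j = - (1 / ((a i)\<^sup>2 - (a j)\<^sup>2))" for i j
  define l where "l i j = (if a i \<noteq> a j then f i j *\<^sub>R (a i *\<^sub>R X i j + a j *\<^sub>R conjugate (X j i)) else 0)" for i j
  define k where "k i j = (if a i \<noteq> a j then f i j *\<^sub>R (a j *\<^sub>R X i j + a i *\<^sub>R conjugate (X j i))
    else if a i > 0 then (1 / (2 * a i)) *\<^sub>R (X i j - conjugate (X j i)) else 0)" for i j
  have f_swap: "f j i = - f i j" for i j
    unfolding f_def by (simp add: minus_divide_right)
  have l_skew: "conjugate (l j i) = - l i j" for i j
    unfolding l_def f_swap[of j i]
    by (simp add: conjugate_scaleR conjugate_add conjugate_uminus add.commute)
  have k_skew: "conjugate (k j i) = - k i j" for i j
    unfolding k_def f_swap[of j i]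
    by (simp add: conjugate_scaleR conjugate_add conjugate_diff conjugate_uminus add.commute
        scaleR_diff_right)
  define K where "K = mat m m (\<lambda>(i,j). k i j)"
  define L where "L = mat n n (\<lambda>(i,j). l i j)"
  have KL: "K \<in> carrier_mat m m" "L \<in> carrier_mat n n" "K\<^sup>\<dagger> = - K" "L\<^sup>\<dagger> = - L"
    by (auto simp: K_def L_def k_skew l_skew intro!: eq_matI)
  define U where "U = dualm (1\<^sub>m m) K"
  define V where "V = dualm (1\<^sub>m n) L"
  have U: "unitary m U" and V: "unitary n V"
    unfolding U_def V_def by (intro unitary_infinitesimal KL)+
  define Y where "Y = inm (U\<^sup>\<dagger> * B * V)"
  have dim: "dim_row K = m" "dim_col K = m" "dim_row L = n" "dim_col L = n"
    "dim_row U = m" "dim_col U = m" "dim_row V = n" "dim_col V = n" "dim_row Y = m" "dim_col Y = n"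
    using KL by (auto simp: U_def V_def Y_def)
  have st: "stm (U\<^sup>\<dagger> * B * V) = stm B"
    by (simp add: parts_mult dB dim) (simp add: U_def V_def dB)
  have Y_eq: "Y = stm B * L + (inm B + - K * stm B)"
    unfolding Y_def
    by (simp add: parts_mult dB dim)
      (simp add: U_def V_def dB dim KL(3) comm_add_mat[of _ m n])
  have Y: "Y $$ (i,j) = X i j + a i *\<^sub>R l i j - a j *\<^sub>R k i j" if ij: "i < m" "j < n" for i j
  proof -
    have "(stm B * L) $$ (i,j) = a i *\<^sub>R l i j"
      unfolding B(2) using ij a(2)[of i] by (subst dmat_mult_index) (auto simp: dim L_def of_real_def)
    moreover have "(- K * stm B) $$ (i,j) = - (a j *\<^sub>R k i j)"
      unfolding B(2) using ij a(2)[of j] by (subst mult_dmat_index) (auto simp: dim K_def of_real_def)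
    ultimately show ?thesis
      using ij unfolding Y_eq by (simp add: dB dim X_def del: index_mult_mat(1))
  qed
  have "Y $$ (i,j) = 0" if ij: "i < m" "j < n" and ne: "a i \<noteq> a j" for i j
  proof -
    have nz: "(a i)\<^sup>2 - (a j)\<^sup>2 \<noteq> 0"
      using ne a(1)[of i] a(1)[of j] by (simp add: power2_eq_iff_nonneg)
    have "a i *\<^sub>R l i j - a j *\<^sub>R k i j = (f i j * ((a i)\<^sup>2 - (a j)\<^sup>2)) *\<^sub>R X i j"
      using ne by (simp add: l_def k_def algebra_simps power2_eq_square)
    also have "f i j * ((a i)\<^sup>2 - (a j)\<^sup>2) = - 1"
      using nz by (simp add: f_def)
    finally have "a i *\<^sub>R l i j - a j *\<^sub>R k i j = - X i j"
      by simp
    then show ?thesis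
      unfolding Y[OF ij] add_diff_eq[symmetric] by simp
  qed
  moreover have "conjugate (Y $$ (j,i)) = Y $$ (i,j)"
    if ij: "i < m" "j < n" and eq: "a i = a j" "a i > 0" for i j
  proof -
    have "i < min m n" "j < min m n"
      using a(2)[of i] a(2)[of j] eq by (auto simp: not_less[symmetric])
    then have ij': "j < m" "i < n" by auto
    have sym: "Y $$ (i,j) = (1 / 2) *\<^sub>R (X i j + conjugate (X j i))"
      if "i < m" "j < n" "a i = a j" "a i > 0" for i j
      using that by (subst Y) (auto simp: l_def k_def quat_eq_iff field_simps)
    show ?thesis
      using ij ij' eq by (simp add: sym conjugate_scaleR conjugate_add add.commute)
  qed
  moreover have "U\<^sup>\<dagger> * B * V = dualm (dmat m n (\<lambda>i. of_real (a i))) Y"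
    by (rule parts_eqI) (simp_all add: st B(2) Y_def dim)
  moreover have "Y \<in> carrier_mat m n"
    by (intro carrier_matI) (simp_all add: dim)
  ultimately show thesis
    using that U V by blast
qed

text \<open>
  The new diagonal entries are averages of the old ones with weights \<open>qnorm2 (Q $$ (l,i))\<close>.
\<close>

lemma unitary_diagonal_pos:
  fixes a :: "nat \<Rightarrow> real"
  assumes Q: "unitary r Q" and D: "Q\<^sup>\<dagger> * dmat r r (\<lambda>i. of_real (a i)) * Q = dmat r r (\<lambda>i. of_real (d i) :: quat)"
    and a: "\<And>i. i < r \<Longrightarrow> a i > 0" and i: "i < r"
  shows "d i > 0"
proof -
  note dim = unitary_dim[OF Q]
  have "of_real (d i) = (Q\<^sup>\<dagger> * (dmat r r (\<lambda>i. of_real (a i)) * Q)) $$ (i,i)"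
    using D i by (simp add: mult_assoc dim del: index_mult_mat(1))
  also have "\<dots> = (\<Sum>l<r. conjugate (Q $$ (l,i)) * (of_real (a l) * Q $$ (l,i)))"
    using i by (simp add: mult_index[of _ r "dmat r r _ * Q"] dmat_mult_index dim del: index_mult_mat(1))
  also have "\<dots> = of_real (\<Sum>l<r. a l * qnorm2 (Q $$ (l,i)))"
    by (simp add: conjugate_mult_self of_real_def scaleR_sum_left)
  finally have d: "d i = (\<Sum>l<r. a l * qnorm2 (Q $$ (l,i)))"
    by (simp del: of_real_sum)
  have "(Q\<^sup>\<dagger> * Q) $$ (i,i) = of_real (\<Sum>l<r. qnorm2 (Q $$ (l,i)))"
    using i by (simp add: mult_index[of _ r] dim conjugate_mult_self del: index_mult_mat(1))
  then have "(\<Sum>l<r. qnorm2 (Q $$ (l,i))) \<noteq> 0"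
    using i by (auto simp: unitary_cancel[OF Q] simp del: index_mult_mat(1) of_real_sum)
  then obtain l where l: "l < r" "qnorm2 (Q $$ (l,i)) \<noteq> 0"
    by (meson lessThan_iff sum.neutral)
  then have "a l * qnorm2 (Q $$ (l,i)) > 0"
    using a[OF l(1)] l(2) qnorm2_nonneg[of "Q $$ (l,i)"] by (intro mult_pos_pos) (auto simp: less_le)
  also have "\<dots> \<le> d i"
    unfolding d using l(1) a by (intro member_le_sum) (auto simp: qnorm2_nonneg less_imp_le)
  finally show ?thesis .
qed

lemma dual_nonneg_iff: "0 \<le> (x :: real dual) \<longleftrightarrow> st_part x > 0 \<or> st_part x = 0 \<and> in_part x \<ge> 0"
  by (auto simp: less_eq_dual_def)

text \<open>
  Once the infinitesimal part respects the singular values \<open>a\<close> of the standard part, both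
  parts split into a block where \<open>a\<close> is positive and one where it is zero. On the first, the
  diagonal \<open>D\<close> and the Hermitian infinitesimal part commute and are diagonalized by the same
  unitary matrix on both sides; its singular values are appreciable and may have infinitesimal
  parts of either sign. The second block is purely infinitesimal and has its own singular
  value decomposition.
\<close>

lemma dual_svd:
  fixes A :: "quat dual mat"
  assumes A: "A \<in> carrier_mat m n"
  obtains U V \<mu> where "unitary m U" "unitary n V" "U\<^sup>\<dagger> * A * V = dmat m n (\<lambda>i. dq_of_dual (\<mu> i))"
    "\<And>i. \<mu> i \<ge> 0"
proof -
  have dA: "dim_row A = m" "dim_col A = n"
    using A by auto
  have stA: "stm A \<in> carrier_mat m n"
    using dA by (intro carrier_matI) auto
  obtain U0 V0 a where U0: "unitary m U0" "unitary n V0"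
      "U0\<^sup>\<dagger> * stm A * V0 = dmat m n (\<lambda>i. of_real (a i))"
      "\<And>i. a i \<ge> 0" "antimono a" "\<And>i. min m n \<le> i \<Longrightarrow> a i = 0"
    using quat_svd[OF stA] by blast
  define U1 where "U1 = dualm U0 (0\<^sub>m m m)"
  define V1 where "V1 = dualm V0 (0\<^sub>m n n)"
  have u1: "unitary m U1" "unitary n V1"
    unfolding U1_def V1_def by (intro unitary_lift U0)+
  define B where "B = U1\<^sup>\<dagger> * A * V1"
  have "U0 \<in> carrier_mat m m" "V0 \<in> carrier_mat n n"
    using U0(1,2) by (auto simp: unitary_def)
  then have "stm B = dmat m n (\<lambda>i. of_real (a i))"
    unfolding B_def U1_def V1_def U0(3)[symmetric] by (rule parts_conj_lift(1)[OF A])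
  moreover have "B \<in> carrier_mat m n"
    using unitary_dim[OF u1(1)] unitary_dim[OF u1(2)] by (intro carrier_matI) (simp_all add: B_def)
  ultimately have B: "B \<in> carrier_mat m n" "stm B = dmat m n (\<lambda>i. of_real (a i))"
    by blast+
  obtain U2 V2 Y where u2: "unitary m U2" "unitary n V2"
      "U2\<^sup>\<dagger> * B * V2 = dualm (dmat m n (\<lambda>i. of_real (a i))) Y" "Y \<in> carrier_mat m n"
      "\<And>i j. i < m \<Longrightarrow> j < n \<Longrightarrow> a i \<noteq> a j \<Longrightarrow> Y $$ (i,j) = 0"
      "\<And>i j. i < m \<Longrightarrow> j < n \<Longrightarrow> a i = a j \<Longrightarrow> a i > 0 \<Longrightarrow> conjugate (Y $$ (j,i)) = Y $$ (i,j)"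
    using remove_off_block_perturbation[OF B U0(4,6)] by blast
  have dY: "dim_row Y = m" "dim_col Y = n"
    using u2(4) by auto
  obtain r where r: "r \<le> min m n" "\<And>i. i < min m n \<Longrightarrow> a i > 0 \<longleftrightarrow> i < r"
    using less_le_trans[OF _ antimonoD[OF U0(5)]] by (rule_tac initial_segment[of "min m n" "\<lambda>i. a i > 0"]) auto
  have rmn: "r \<le> m" "r \<le> n"
    using r(1) by auto
  have a_pos: "a i > 0 \<longleftrightarrow> i < r" for i
    using r U0(6)[of i] by (cases "i < min m n") auto
  have a_zero: "a i = 0" if "i \<ge> r" for i
    using a_pos[of i] that U0(4)[of i] by simp
  define Y1 where "Y1 = mat r r (\<lambda>(i,j). Y $$ (i,j))"
  define Y2 where "Y2 = mat (m - r) (n - r) (\<lambda>(i,j). Y $$ (r + i, r + j))"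
  have Y_eq: "Y = dsum Y1 Y2"
    unfolding Y1_def Y2_def
  proof (rule split_dsum)
    show "Y \<in> carrier_mat (r + (m - r)) (r + (n - r))"
      using u2(4) rmn by simp
    show "Y $$ (i,j) = 0" if "i < r" "r \<le> j" "j < r + (n - r)" for i j
      using that rmn a_pos[of i] a_zero[of j] by (intro u2(5)) auto
    show "Y $$ (i,j) = 0" if "r \<le> i" "i < r + (m - r)" "j < r" for i j
      using that rmn a_pos[of j] a_zero[of i] by (intro u2(5)) auto
  qed
  define D where "D = dmat r r (\<lambda>i. of_real (a i) :: quat)"
  have D: "D \<in> carrier_mat r r" "D\<^sup>\<dagger> = D"
    by (simp_all add: D_def adj_dmat)
  have Y1: "Y1 \<in> carrier_mat r r" "Y1\<^sup>\<dagger> = Y1"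
  proof -
    show "Y1\<^sup>\<dagger> = Y1"
    proof (rule eq_matI)
      fix i j assume "i < dim_row Y1" "j < dim_col Y1"
      then have ij: "i < r" "j < r" by (auto simp: Y1_def)
      show "Y1\<^sup>\<dagger> $$ (i,j) = Y1 $$ (i,j)"
        using u2(6)[of i j] u2(5)[of i j] u2(5)[of j i] ij rmn a_pos[of i]
        by (cases "a i = a j") (auto simp: Y1_def)
    qed (auto simp: Y1_def)
  qed (simp add: Y1_def)
  have "D * Y1 = Y1 * D"
  proof (rule eq_matI)
    fix i j assume "i < dim_row (Y1 * D)" "j < dim_col (Y1 * D)"
    then have ij: "i < r" "j < r" by (auto simp: Y1_def D_def)
    have "of_real (a i) * Y $$ (i,j) = Y $$ (i,j) * of_real (a j)"
      using u2(5)[of i j] ij rmn by (cases "a i = a j") (auto simp: of_real_commute)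
    then show "(D * Y1) $$ (i,j) = (Y1 * D) $$ (i,j)"
      unfolding D_def using ij dmat_mult_index[of Y1 r i r j "\<lambda>i. of_real (a i)"]
        mult_dmat_index[of Y1 r i j r "\<lambda>i. of_real (a i)"]
      by (simp add: Y1_def del: index_mult_mat(1))
  qed (auto simp: Y1_def D_def)
  then obtain Q d b where Q: "unitary r Q" "Q\<^sup>\<dagger> * D * Q = dmat r r (\<lambda>i. of_real (d i))"
      "Q\<^sup>\<dagger> * Y1 * Q = dmat r r (\<lambda>i. of_real (b i))"
    using simultaneous_diagonalization[OF D Y1] by blast
  have Y2: "Y2 \<in> carrier_mat (m - r) (n - r)"
    by (simp add: Y2_def)
  obtain P R e where P: "unitary (m - r) P" "unitary (n - r) R"
      "P\<^sup>\<dagger> * Y2 * R = dmat (m - r) (n - r) (\<lambda>i. of_real (e i))" "\<And>i. e i \<ge> 0"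
    using quat_svd[OF Y2] by metis
  note dims = unitary_dim[OF Q(1)] unitary_dim[OF P(1)] unitary_dim[OF P(2)]
  have dYs: "dim_row Y1 = r" "dim_col Y1 = r" "dim_row Y2 = m - r" "dim_col Y2 = n - r"
      "dim_row D = r" "dim_col D = r"
    using Y1 Y2 D by auto
  define U3 where "U3 = dualm (dsum Q P) (0\<^sub>m m m)"
  define V3 where "V3 = dualm (dsum Q R) (0\<^sub>m n n)"
  have qp: "unitary m (dsum Q P)" "unitary n (dsum Q R)"
    using unitary_dsum[OF Q(1) P(1)] unitary_dsum[OF Q(1) P(2)] rmn by simp_all
  have u3: "unitary m U3" "unitary n V3"
    unfolding U3_def V3_def by (intro unitary_lift qp)+
  define \<mu> where "\<mu> i = (if i < r then Dual (d i) (b i) else Dual 0 (e (i - r)))" for i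
  define E where "E = dualm (dmat m n (\<lambda>i. of_real (a i))) Y"
  have E: "E \<in> carrier_mat m n"
    by (intro carrier_matI) (simp_all add: E_def)
  have stE: "stm E = dsum D (0\<^sub>m (m - r) (n - r))" and inE: "inm E = dsum Y1 Y2"
    using rmn dY a_zero
    by (auto simp: E_def D_def Y_eq[symmetric] dsum_index intro!: eq_matI)
  note qpc = qp[unfolded unitary_def]
  have "U3\<^sup>\<dagger> * E * V3 = dmat m n (\<lambda>i. dq_of_dual (\<mu> i))"
  proof (rule parts_eqI)
    have "stm (U3\<^sup>\<dagger> * E * V3) = dsum (Q\<^sup>\<dagger>) (P\<^sup>\<dagger>) * dsum D (0\<^sub>m (m - r) (n - r)) * dsum Q R"
      unfolding U3_def V3_def using qpc by (subst parts_conj_lift[OF E]) (simp_all add: stE adj_dsum)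
    also have "\<dots> = dsum (Q\<^sup>\<dagger> * D * Q) (0\<^sub>m (m - r) (n - r))"
      by (simp add: dsum_mult dims dYs zero_mult_dim)
    also have "\<dots> = stm (dmat m n (\<lambda>i. dq_of_dual (\<mu> i)))"
      unfolding Q(2) using rmn by (intro eq_matI) (auto simp: dsum_index \<mu>_def)
    finally show "stm (U3\<^sup>\<dagger> * E * V3) = stm (dmat m n (\<lambda>i. dq_of_dual (\<mu> i)))" .
    have "inm (U3\<^sup>\<dagger> * E * V3) = dsum (Q\<^sup>\<dagger>) (P\<^sup>\<dagger>) * dsum Y1 Y2 * dsum Q R"
      unfolding U3_def V3_def using qpc by (subst parts_conj_lift[OF E]) (simp_all add: inE adj_dsum)
    also have "\<dots> = dsum (Q\<^sup>\<dagger> * Y1 * Q) (P\<^sup>\<dagger> * Y2 * R)"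
      by (simp add: dsum_mult dims dYs)
    also have "\<dots> = inm (dmat m n (\<lambda>i. dq_of_dual (\<mu> i)))"
      unfolding Q(3) P(3) using rmn by (intro eq_matI) (auto simp: dsum_index \<mu>_def)
    finally show "inm (U3\<^sup>\<dagger> * E * V3) = inm (dmat m n (\<lambda>i. dq_of_dual (\<mu> i)))" .
  qed
  moreover have "(U1 * U2 * U3)\<^sup>\<dagger> * A * (V1 * V2 * V3) = U3\<^sup>\<dagger> * E * V3"
    unfolding E_def u2(3)[symmetric] B_def
    using unitary_dim[OF u1(1)] unitary_dim[OF u1(2)] unitary_dim[OF u2(1)] unitary_dim[OF u2(2)]
      unitary_dim[OF u3(1)] unitary_dim[OF u3(2)] dA
    by (simp add: adj_mult mult_assoc)
  moreover have "\<mu> i \<ge> 0" for i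
    using unitary_diagonal_pos[OF Q(1) Q(2)[unfolded D_def]] a_pos P(4)
    by (auto simp: \<mu>_def dual_nonneg_iff)
  moreover have "unitary m (U1 * U2 * U3)" "unitary n (V1 * V2 * V3)"
    using u1 u2(1,2) u3 by (auto intro: unitary_mult)
  ultimately show thesis
    using that by metis
qed

lemma minus_le_minus_dual: "- (x :: real dual) \<le> - y \<longleftrightarrow> y \<le> x"
  by (auto simp: less_eq_dual_def)

text \<open>Sorting in decreasing order makes the positive singular values an initial segment.\<close>

lemma is_svd_exists:
  fixes A :: "quat dual mat"
  obtains U V mus where "is_svd A U V mus"
proof -
  define m where "m = dim_row A"
  define n where "n = dim_col A"
  have A: "A \<in> carrier_mat m n"
    unfolding m_def n_def by (rule carrier_matI) (rule refl)+
  obtain U V \<mu> where U: "unitary m U" "unitary n V" "U\<^sup>\<dagger> * A * V = dmat m n (\<lambda>i. dq_of_dual (\<mu> i))"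
      "\<And>i. \<mu> i \<ge> 0"
    using dual_svd[OF A] by metis
  obtain p where p: "p permutes {..<min m n}"
      "\<And>i j. i \<le> j \<Longrightarrow> j < min m n \<Longrightarrow> - \<mu> (p i) \<le> - \<mu> (p j)"
    using sorting_permutation[of "min m n" "\<lambda>i. - \<mu> i"] by metis
  define \<nu> where "\<nu> i = \<mu> (p i)" for i
  have \<nu>: "\<nu> j \<le> \<nu> i" if "i \<le> j" "j < min m n" for i j
    using p(2)[OF that] by (simp add: minus_le_minus_dual \<nu>_def)
  obtain U' V' where U': "unitary m U'" "unitary n V'" "U'\<^sup>\<dagger> * A * V' = dmat m n (\<lambda>i. dq_of_dual (\<nu> i))"
    using permute_diagonal[OF A U(1-3) p(1)] unfolding \<nu>_def by blast
  obtain t where t: "t \<le> min m n" "\<And>i. i < min m n \<Longrightarrow> \<nu> i > 0 \<longleftrightarrow> i < t"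
    using less_le_trans[OF _ \<nu>] by (rule_tac initial_segment[of "min m n" "\<lambda>i. \<nu> i > 0"]) auto
  have zero: "\<nu> i = 0" if "i < min m n" "t \<le> i" for i
    using t(2)[OF that(1)] that(2) U(4)[of "p i"] by (auto simp: \<nu>_def)
  define mus where "mus = map \<nu> [0..<t]"
  have "is_svd A U' V' mus"
    unfolding is_svd_def unitary_mat_iff m_def[symmetric] n_def[symmetric]
  proof (intro conjI)
    show "length mus \<le> m" "length mus \<le> n"
      using t(1) by (auto simp: mus_def)
    show "sorted_wrt (\<ge>) mus"
      using \<nu> t(1) by (auto simp: mus_def sorted_wrt_iff_nth_less)
    show "\<forall>\<mu>\<in>set mus. 0 < \<mu>"
      using t by (auto simp: mus_def)
    show "U'\<^sup>\<dagger> * A * V' = diag_block_mat [mat_diag (length mus) (\<lambda>i. dq_of_dual (mus ! i)),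
        0\<^sub>m (m - length mus) (n - length mus)]"
      unfolding U'(3) using t(1) zero
      by (intro eq_matI) (auto simp: mus_def mat_diag_def Let_def)
  qed (use U' in auto)
  then show thesis
    using that by blast
qed

section \<open>The CS decomposition\<close>

subsection \<open>Square roots and inverses of dual numbers\<close>

text \<open>
  The infinitesimal part is the derivative of the square root in the direction of \<open>in_part x\<close>.
\<close>

definition dsqrt :: "real dual \<Rightarrow> real dual" where
  "dsqrt x = Dual (sqrt (st_part x)) (in_part x / (2 * sqrt (st_part x)))"

definition dinv :: "real dual \<Rightarrow> real dual" where
  "dinv x = Dual (1 / st_part x) (- in_part x / (st_part x)\<^sup>2)"

lemma dsqrt_mult_self: "st_part x > 0 \<Longrightarrow> dsqrt x * dsqrt x = x"
  by (simp add: dual_eq_iff dsqrt_def)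

lemma dsqrt_one [simp]: "dsqrt 1 = 1"
  by (simp add: dual_eq_iff dsqrt_def)

lemma mult_dinv: "st_part x \<noteq> 0 \<Longrightarrow> x * dinv x = 1"
  by (simp add: dual_eq_iff dinv_def power2_eq_square)

lemma dsqrt_one_minus_square_antimono:
  assumes "x \<le> y" "st_part x > 0" "st_part y < 1"
  shows "dsqrt (1 - y * y) \<le> dsqrt (1 - x * x)"
proof (cases "st_part x = st_part y")
  case True
  then have "in_part x \<le> in_part y"
    using assms(1) by (simp add: less_eq_dual_def)
  moreover have "st_part y * st_part y < 1"
    using mult_strict_mono[of "st_part y" 1 "st_part y" 1] assms True by simp
  ultimately show ?thesis
    using True assms(2) by (simp add: less_eq_dual_def dsqrt_def divide_right_mono)
next
  case False
  then have lt: "st_part x < st_part y"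
    using assms(1) by (simp add: less_eq_dual_def)
  then have "st_part x * st_part x < st_part y * st_part y"
    using assms(2) by (intro mult_strict_mono) auto
  then show ?thesis
    by (simp add: less_eq_dual_def dsqrt_def)
qed

subsection \<open>The block matrices as diagonal matrices\<close>

lemma eps_of_real: "eps * of_real x = Dual 0 (of_real x :: 'a :: real_algebra_1)"
  by (simp add: dual_eq_iff eps_def of_real_def scaleR_dual_def)

lemma Sigma_A_eq:
  assumes "r + q + t \<le> m" "r + q + t \<le> k"
  shows "Sigma_A m k r q t c \<xi> = dmat m k (\<lambda>i. if i < r then 1 else if i < r + q then dq_of_dual (c (i - r))
    else if i < r + q + t then Dual 0 (of_real (\<xi> (i - r - q))) else 0)"
proof -
  have X: "eps \<cdot>\<^sub>m dmat t t (\<lambda>i. of_real (\<xi> i)) = (dmat t t (\<lambda>i. Dual 0 (of_real (\<xi> i))) :: quat dual mat)"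
    by (rule eq_matI) (auto simp: eps_of_real)
  show ?thesis
    unfolding Sigma_A_def diag_block_mat_Cons_Cons diag_block_mat_singleton mat_diag_dmat X
      one_mat_dmat zero_mat_dmat dsum_dmat_square
    using assms by (intro eq_matI) auto
qed

lemma Sigma_B_eq:
  assumes "r + q + t \<le> k" "r' \<le> r" "k + r' \<le> p + r"
  shows "Sigma_B p k r r' q t s \<sigma> =
    dsum (dmat (p - (k - r)) r (\<lambda>i. if i < r' then Dual 0 (of_real (\<sigma> i)) else 0))
      (dmat (k - r) (k - r) (\<lambda>i. if i < q then dq_of_dual (s i) else 1))"
proof -
  let ?h = "k - r" and ?z = "p - (k - r) - r'"
  let ?S = "eps \<cdot>\<^sub>m mat_diag r' (\<lambda>i. of_real (\<sigma> i)) :: quat dual mat"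
  let ?T = "dsum (mat_diag q (\<lambda>i. dq_of_dual (s i))) (dsum (1\<^sub>m t) (1\<^sub>m (k - r - q - t)))"
  have sizes: "p + r - k - r' = ?z"
    using assms by auto
  have "Sigma_B p k r r' q t s \<sigma> = dsum ?S (dsum (0\<^sub>m ?z (r - r')) ?T)"
    by (simp only: Sigma_B_def sizes diag_block_mat_Cons_Cons diag_block_mat_singleton)
  also have "\<dots> = dsum (dsum ?S (0\<^sub>m ?z (r - r'))) ?T"
    by (rule dsum_assoc)
  also have "dsum ?S (0\<^sub>m ?z (r - r')) = dmat (p - ?h) r (\<lambda>i. if i < r' then Dual 0 (of_real (\<sigma> i)) else 0)"
    using assms by (intro eq_matI) (auto simp: dsum_index mat_diag_def eps_of_real)
  also have "?T = dmat ?h ?h (\<lambda>i. if i < q then dq_of_dual (s i) else 1)"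
    using assms by (intro eq_matI) (auto simp: dsum_index dsum_one mat_diag_def)
  finally show ?thesis .
qed

text \<open>
  Sorting by increasing key puts the singular values in the order of the blocks of \<open>Sigma_A\<close>:
  standard part 1 first, then the other appreciable ones increasingly, then the infinitesimal
  ones decreasingly and finally the zeros. The standard parts to be sorted are at most 1, so
  the constants \<open>- 1\<close> and \<open>1\<close> separate the groups.
\<close>

definition cs_key :: "real dual \<Rightarrow> real dual" where
  "cs_key x = (if st_part x \<ge> 1 then Dual (- 1) 0 else if st_part x > 0 then x else Dual 1 (- in_part x))"

lemma sorted_singular_values_segments:
  fixes \<nu> :: "nat \<Rightarrow> real dual"
  assumes "mono_on {..<l} (\<lambda>i. cs_key (\<nu> i))" and "\<forall>i. \<nu> i \<ge> 0" and "\<forall>i\<ge>l. \<nu> i = 0"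
    and "\<forall>i<l. st_part (\<nu> i) \<ge> 1 \<longrightarrow> \<nu> i = 1"
  obtains r q t where "r + q + t \<le> l" "\<And>i. i < r \<Longrightarrow> \<nu> i = 1"
    "\<And>i. r \<le> i \<Longrightarrow> i < r + q \<Longrightarrow> 0 < st_part (\<nu> i) \<and> st_part (\<nu> i) < 1"
    "\<And>i. r + q \<le> i \<Longrightarrow> st_part (\<nu> i) = 0"
    "\<And>i. r + q \<le> i \<Longrightarrow> i < r + q + t \<Longrightarrow> 0 < in_part (\<nu> i)"
    "\<And>i. r + q + t \<le> i \<Longrightarrow> \<nu> i = 0"
    "mono_on {..<q} (\<lambda>i. \<nu> (r + i))" "antimono_on {..<t} (\<lambda>i. in_part (\<nu> (r + q + i)))"
proof -
  have sorted: "cs_key (\<nu> i) \<le> cs_key (\<nu> j)" if "i \<le> j" "j < l" for i j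
    using mono_onD[OF assms(1), of i j] that by simp
  have nonneg: "\<nu> i \<ge> 0" and zero: "l \<le> i \<Longrightarrow> \<nu> i = 0"
    and one: "i < l \<Longrightarrow> st_part (\<nu> i) \<ge> 1 \<Longrightarrow> \<nu> i = 1" for i
    using assms(2-4) by blast+
  have st_nonneg: "st_part (\<nu> i) \<ge> 0" for i
    using nonneg[of i] by (auto simp: dual_nonneg_iff)
  have in_nonneg: "st_part (\<nu> i) = 0 \<Longrightarrow> in_part (\<nu> i) \<ge> 0" for i
    using nonneg[of i] by (auto simp: dual_nonneg_iff)
  have s1: "cs_key (\<nu> i) < 0 \<longleftrightarrow> st_part (\<nu> i) \<ge> 1" for i
    by (auto simp: cs_key_def less_dual_def)
  have s2: "st_part (cs_key (\<nu> i)) < 1 \<longleftrightarrow> st_part (\<nu> i) > 0" for i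
    by (auto simp: cs_key_def)
  have s3: "cs_key (\<nu> i) < Dual 1 0 \<longleftrightarrow> st_part (\<nu> i) > 0 \<or> in_part (\<nu> i) > 0" for i
    by (auto simp: cs_key_def less_dual_def)
  have le_st: "x \<le> y \<Longrightarrow> st_part x \<le> st_part y" for x y :: "real dual"
    by (auto simp: less_eq_dual_def)
  have c1: "st_part (\<nu> i) \<ge> 1" if "i \<le> j" "j < l" "st_part (\<nu> j) \<ge> 1" for i j
    using sorted[OF that(1,2)] that(3) unfolding s1[symmetric] by (rule le_less_trans)
  have c2: "st_part (\<nu> i) > 0" if "i \<le> j" "j < l" "st_part (\<nu> j) > 0" for i j
    using le_st[OF sorted[OF that(1,2)]] that(3) unfolding s2[symmetric] by (rule le_less_trans)
  have c3: "st_part (\<nu> i) > 0 \<or> in_part (\<nu> i) > 0"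
    if "i \<le> j" "j < l" "st_part (\<nu> j) > 0 \<or> in_part (\<nu> j) > 0" for i j
    using sorted[OF that(1,2)] that(3) unfolding s3[symmetric] by (rule le_less_trans)
  obtain r where r: "r \<le> l" "\<And>i. i < l \<Longrightarrow> st_part (\<nu> i) \<ge> 1 \<longleftrightarrow> i < r"
    using c1 by (rule_tac initial_segment[of l "\<lambda>i. st_part (\<nu> i) \<ge> 1"]) blast+
  obtain r' where r': "r' \<le> l" "\<And>i. i < l \<Longrightarrow> st_part (\<nu> i) > 0 \<longleftrightarrow> i < r'"
    using c2 by (rule_tac initial_segment[of l "\<lambda>i. st_part (\<nu> i) > 0"]) blast+
  obtain r'' where r'': "r'' \<le> l" "\<And>i. i < l \<Longrightarrow> (st_part (\<nu> i) > 0 \<or> in_part (\<nu> i) > 0) \<longleftrightarrow> i < r''"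
    using c3 by (rule_tac initial_segment[of l "\<lambda>i. st_part (\<nu> i) > 0 \<or> in_part (\<nu> i) > 0"]) blast+
  have rr': "r \<le> r'"
  proof (rule ccontr)
    assume "\<not> r \<le> r'"
    then show False
      using r(2)[of r'] r'(2)[of r'] r(1) by auto
  qed
  have r'r'': "r' \<le> r''"
  proof (rule ccontr)
    assume "\<not> r' \<le> r''"
    then show False
      using r'(2)[of r''] r''(2)[of r''] r'(1) by auto
  qed
  show thesis
  proof (rule that[of r "r' - r" "r'' - r'"])
    show "r + (r' - r) + (r'' - r') \<le> l"
      using rr' r'r'' r''(1) by simp
    show "\<nu> i = 1" if "i < r" for i
      using that r one[of i] by auto
    show "0 < st_part (\<nu> i) \<and> st_part (\<nu> i) < 1" if "r \<le> i" "i < r + (r' - r)" for i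
      using that r(2)[of i] r'(2)[of i] r'(1) rr' by auto
    show st0: "st_part (\<nu> i) = 0" if "r + (r' - r) \<le> i" for i
      using that r'(2)[of i] rr' st_nonneg[of i] zero[of i] by (cases "i < l") auto
    show pos: "0 < in_part (\<nu> i)" if "r + (r' - r) \<le> i" "i < r + (r' - r) + (r'' - r')" for i
      using that st0[of i] r''(2)[of i] r''(1) rr' r'r'' by auto
    show "\<nu> i = 0" if "r + (r' - r) + (r'' - r') \<le> i" for i
    proof (cases "i < l")
      case True
      then have "st_part (\<nu> i) = 0" "in_part (\<nu> i) = 0"
        using that st0[of i] r''(2)[of i] in_nonneg[of i] rr' r'r'' by auto
      then show ?thesis
        by (simp add: dual_eq_iff)
    qed (use zero in auto)
    show "mono_on {..<r' - r} (\<lambda>i. \<nu> (r + i))"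
    proof (rule mono_onI)
      fix i j assume ij: "i \<in> {..<r' - r}" "j \<in> {..<r' - r}" "i \<le> j"
      have key: "cs_key (\<nu> (r + i)) = \<nu> (r + i)" if "i < r' - r" for i
        using that r(2)[of "r + i"] r'(2)[of "r + i"] r'(1) by (auto simp: cs_key_def)
      show "\<nu> (r + i) \<le> \<nu> (r + j)"
        using sorted[of "r + i" "r + j"] key[of i] key[of j] ij r'(1) by auto
    qed
    show "antimono_on {..<r'' - r'} (\<lambda>i. in_part (\<nu> (r + (r' - r) + i)))"
    proof (rule monotone_onI)
      fix i j assume ij: "i \<in> {..<r'' - r'}" "j \<in> {..<r'' - r'}" "i \<le> j"
      have key: "cs_key (\<nu> (r' + i)) = Dual 1 (- in_part (\<nu> (r' + i)))" if "i < r'' - r'" for i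
        using that st0[of "r' + i"] rr' by (auto simp: cs_key_def)
      show "in_part (\<nu> (r + (r' - r) + j)) \<le> in_part (\<nu> (r + (r' - r) + i))"
        using sorted[of "r' + i" "r' + j"] key[of i] key[of j] ij r''(1) rr'
        by (auto simp: less_eq_dual_def)
    qed
  qed
qed

text \<open>
  Exchanges the first \<open>h\<close> with the last \<open>p - h\<close> indices, since \<open>Sigma_B\<close> has its appreciable
  rows at the bottom.
\<close>

lemma rotation_permutes:
  assumes "h \<le> (p :: nat)"
  shows "(\<lambda>i. if i < p - h then i + h else if i < p then i - (p - h) else i) permutes {..<p}"
    (is "?f permutes _")
proof (rule bij_imp_permutes)
  show "bij_betw ?f {..<p} {..<p}"
    by (rule bij_betw_byWitness[where f' = "\<lambda>i. if i < h then i + (p - h) else i - h"])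
      (use assms in auto)
qed auto

text \<open>
  The last \<open>h\<close> columns have appreciable length. Normalized, they are completed to a unitary
  matrix, of which they form the last columns; in that basis they are multiples of basis
  vectors, and the other columns, being orthogonal to them, have no components there.
\<close>

lemma orthogonal_columns_normal_form:
  fixes M :: "quat dual mat"
  assumes M: "M \<in> carrier_mat p (r + h)"
    and gram: "\<And>i j. i < r + h \<Longrightarrow> j < r + h \<Longrightarrow> i \<noteq> j \<Longrightarrow> (M\<^sup>\<dagger> * M) $$ (i,j) = 0"
      "\<And>j. j < h \<Longrightarrow> (M\<^sup>\<dagger> * M) $$ (r + j, r + j) = dq_of_dual (\<tau> j * \<tau> j)"
    and \<tau>: "\<And>j. j < h \<Longrightarrow> st_part (\<tau> j) \<noteq> 0"
  obtains V E where "h \<le> p" "unitary p V" "E \<in> carrier_mat (p - h) r"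
    "V\<^sup>\<dagger> * M = dsum E (dmat h h (\<lambda>i. dq_of_dual (\<tau> i)))"
proof -
  have dM: "dim_row M = p" "dim_col M = r + h"
    using M by auto
  define \<delta> where "\<delta> j = dq_of_dual (dinv (\<tau> j))" for j
  have \<delta>: "dq_of_dual (\<tau> j) * \<delta> j = 1" if "j < h" for j
    unfolding \<delta>_def by (simp add: mult_dinv[OF \<tau>[OF that]] flip: dq_of_dual_arith(3))
  have \<delta>_comm: "\<delta> j * x = x * \<delta> j" "conjugate (\<delta> j) = \<delta> j" for j x
    by (simp_all add: \<delta>_def dq_of_dual_commute)
  define N where "N = mat p h (\<lambda>(i,j). M $$ (i, r + j) * \<delta> j)"
  have N_M: "(N\<^sup>\<dagger> * B) $$ (i,j) = \<delta> i * (M\<^sup>\<dagger> * B) $$ (r + i, j)"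
    if "i < h" "dim_row B = p" "j < dim_col B" for i j B
    using that
    by (simp add: mult_index[of _ p] dM N_def conjugate_mult \<delta>_comm(2) sum_distrib_left mult.assoc
        del: index_mult_mat(1))
  have M_N: "(M\<^sup>\<dagger> * N) $$ (i,j) = (M\<^sup>\<dagger> * M) $$ (i, r + j) * \<delta> j" if "i < r + h" "j < h" for i j
    using that
    by (simp add: mult_index[of _ p] dM N_def sum_distrib_right mult.assoc del: index_mult_mat(1))
  have "N\<^sup>\<dagger> * N = 1\<^sub>m h"
  proof (rule eq_matI)
    fix i j assume "i < dim_row (1\<^sub>m h :: quat dual mat)" "j < dim_col (1\<^sub>m h :: quat dual mat)"
    then have ij: "i < h" "j < h" by auto
    have "(N\<^sup>\<dagger> * N) $$ (i,j) = \<delta> i * (M\<^sup>\<dagger> * M) $$ (r + i, r + j) * \<delta> j"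
      using ij by (subst N_M) (auto simp: N_def[symmetric] M_N mult.assoc simp del: index_mult_mat(1), auto simp: N_def)
    moreover have "\<delta> i * (dq_of_dual (\<tau> i) * dq_of_dual (\<tau> i)) * \<delta> i = 1"
      using \<delta>[OF ij(1)] by (simp add: \<delta>_comm mult.assoc)
    ultimately show "(N\<^sup>\<dagger> * N) $$ (i,j) = 1\<^sub>m h $$ (i,j)"
      using ij by (cases "i = j") (simp_all add: gram del: index_mult_mat(1))
  qed (auto simp: N_def)
  then obtain V1 where V1: "h \<le> p" "unitary p V1" "\<And>i j. i < p \<Longrightarrow> j < h \<Longrightarrow> V1 $$ (i,j) = N $$ (i,j)"
    using dual_orthonormal_completion[of N p h] by (auto simp: N_def)
  define f where "f i = (if i < p - h then i + h else if i < p then i - (p - h) else i)" for i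
  define V where "V = mat p p (\<lambda>(i,j). V1 $$ (i, f j))"
  have "f permutes {..<p}"
    using rotation_permutes[OF V1(1)] unfolding f_def .
  then have V: "unitary p V"
    unfolding V_def by (rule unitary_permute_cols[OF V1(2)])
  have dV: "dim_row V = p" "dim_col V = p"
    by (simp_all add: V_def)
  have V_last: "V $$ (i, p - h + j) = N $$ (i,j)" if "i < p" "j < h" for i j
    using that V1(1,3) by (auto simp: V_def f_def)
  define G where "G = V\<^sup>\<dagger> * M"
  have G: "G \<in> carrier_mat ((p - h) + h) (r + h)"
    using V1(1) by (intro carrier_matI) (auto simp: G_def dV dM)
  have right: "G $$ (i, r + j) = (if i = p - h + j then dq_of_dual (\<tau> j) else 0)" if "i < p" "j < h" for i j
  proof -
    have "M $$ (l, r + j) = V $$ (l, p - h + j) * dq_of_dual (\<tau> j)" if "l < p" for l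
      using that \<open>j < h\<close> \<delta>[of j] V_last[of l j]
      by (simp add: N_def mult.assoc \<delta>_comm)
    then have "G $$ (i, r + j) = (V\<^sup>\<dagger> * V) $$ (i, p - h + j) * dq_of_dual (\<tau> j)"
      using that V1(1)
      by (simp add: G_def mult_index[of _ p] dV dM sum_distrib_right mult.assoc del: index_mult_mat(1))
    then show ?thesis
      using that V1(1) by (auto simp: unitary_cancel[OF V] simp del: index_mult_mat(1))
  qed
  have left: "G $$ (p - h + i, j) = 0" if "i < h" "j < r" for i j
  proof -
    have "G $$ (p - h + i, j) = (N\<^sup>\<dagger> * M) $$ (i,j)"
      unfolding G_def using that V1(1) V_last
      by (intro adj_mult_cong_cols[of _ p]) (auto simp: dV dM N_def)
    also have "\<dots> = 0"
      using that by (subst N_M) (auto simp: dM gram simp del: index_mult_mat(1))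
    finally show ?thesis .
  qed
  define E where "E = mat (p - h) r (\<lambda>(i,j). G $$ (i,j))"
  have "G = dsum E (mat h h (\<lambda>(i,j). G $$ (p - h + i, r + j)))"
    unfolding E_def
  proof (rule split_dsum[OF G])
    show "G $$ (i,j) = 0" if "i < p - h" "r \<le> j" "j < r + h" for i j
      using right[of i "j - r"] that by auto
    show "G $$ (i,j) = 0" if "p - h \<le> i" "i < p - h + h" "j < r" for i j
      using left[of "i - (p - h)" j] that by auto
  qed
  also have "mat h h (\<lambda>(i,j). G $$ (p - h + i, r + j)) = dmat h h (\<lambda>i. dq_of_dual (\<tau> i))"
    using V1(1) by (intro eq_matI) (auto simp: right)
  finally have "V\<^sup>\<dagger> * M = dsum E (dmat h h (\<lambda>i. dq_of_dual (\<tau> i)))"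
    unfolding G_def .
  moreover have "E \<in> carrier_mat (p - h) r"
    by (simp add: E_def)
  ultimately show thesis
    using that[OF V1(1) V] by blast
qed

text \<open>
  Without a standard part, a decomposition of the infinitesimal part is one of the whole
  matrix.
\<close>

lemma infinitesimal_svd:
  fixes E :: "quat dual mat"
  assumes E: "E \<in> carrier_mat a b" "stm E = 0\<^sub>m a b"
  obtains P Q r \<sigma> where "unitary a P" "unitary b Q" "r \<le> a" "r \<le> b"
    "antimono_on {..<r} \<sigma>" "\<And>i. i < r \<Longrightarrow> \<sigma> i > 0"
    "P\<^sup>\<dagger> * E * Q = dmat a b (\<lambda>i. if i < r then Dual 0 (of_real (\<sigma> i)) else 0)"
proof -
  have inE: "inm E \<in> carrier_mat a b"
    using E(1) by (intro carrier_matI) auto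
  obtain P Q \<sigma> where PQ: "unitary a P" "unitary b Q" "P\<^sup>\<dagger> * inm E * Q = dmat a b (\<lambda>i. of_real (\<sigma> i))"
      "\<And>i. \<sigma> i \<ge> 0" "antimono \<sigma>" "\<And>i. min a b \<le> i \<Longrightarrow> \<sigma> i = 0"
    using quat_svd[OF inE] by metis
  obtain r where r: "r \<le> min a b" "\<And>i. i < min a b \<Longrightarrow> \<sigma> i > 0 \<longleftrightarrow> i < r"
    using less_le_trans[OF _ antimonoD[OF PQ(5)]]
    by (rule_tac initial_segment[of "min a b" "\<lambda>i. \<sigma> i > 0"]) auto
  have zero: "\<sigma> i = 0" if "r \<le> i" for i
    using r(2)[of i] PQ(4)[of i] PQ(6)[of i] that by (cases "i < min a b") auto
  have c: "P \<in> carrier_mat a a" "Q \<in> carrier_mat b b"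
    using PQ(1,2) by (auto simp: unitary_def)
  have "(dualm P (0\<^sub>m a a))\<^sup>\<dagger> * E * dualm Q (0\<^sub>m b b)
      = dmat a b (\<lambda>i. if i < r then Dual 0 (of_real (\<sigma> i)) else 0)" (is "?L = ?R")
  proof (rule parts_eqI)
    show "stm ?L = stm ?R"
      unfolding parts_conj_lift(1)[OF E(1) c] E(2) using c
      by (intro eq_matI) (auto simp: zero_mult_dim)
    show "inm ?L = inm ?R"
      unfolding parts_conj_lift(2)[OF E(1) c] PQ(3) using zero
      by (intro eq_matI) auto
  qed
  moreover have "antimono_on {..<r} \<sigma>"
    using antimonoD[OF PQ(5)] by (intro monotone_onI) auto
  ultimately show thesis
    using that[OF unitary_lift[OF PQ(1)] unitary_lift[OF PQ(2)], of r \<sigma>] r by auto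
qed

subsection \<open>The decomposition\<close>

text \<open>
  Infinitesimal columns are orthogonal to each other and to themselves, because \<open>\<epsilon>\<^sup>2 = 0\<close>.
\<close>

lemma product_infinitesimals:
  assumes "\<And>l. l < n \<Longrightarrow> st_part (x l) = 0" "\<And>l. l < n \<Longrightarrow> st_part (y l) = 0"
  shows "(\<Sum>l<n. conjugate (x l) * y l) = (0 :: 'a :: star_ring dual)"
  by (intro sum.neutral) (use assms in \<open>auto simp: dual_eq_iff\<close>)

text \<open>
  The singular value decomposition of \<open>P\<close> diagonalizes \<open>P\<^sup>* P\<close> and therefore also
  \<open>R\<^sup>* R = I - P\<^sup>* P\<close>, so the columns of \<open>R W\<close> are orthogonal. The columns belonging to
  singular values 1 of \<open>P\<close> are infinitesimal and are brought to diagonal form separately.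
\<close>

lemma cs_decomposition:
  fixes P R :: "quat dual mat"
  assumes P: "P \<in> carrier_mat m k" and R: "R \<in> carrier_mat p k"
    and orth: "P\<^sup>\<dagger> * P + R\<^sup>\<dagger> * R = 1\<^sub>m k"
  obtains U V W r r\<^sub>1 q t \<sigma> \<xi> c s where "unitary m U" "unitary p V" "unitary k W"
    "gsvd_parameters m p k r r\<^sub>1 q t \<sigma> \<xi> c s"
    "P = U * Sigma_A m k r q t c \<xi> * W" "R = V * Sigma_B p k r r\<^sub>1 q t s \<sigma> * W"
proof -
  have dPR: "dim_row P = m" "dim_col P = k" "dim_row R = p" "dim_col R = k"
    using P R by auto
  obtain U1 W1 \<mu>' where svd: "unitary m U1" "unitary k W1" "U1\<^sup>\<dagger> * P * W1 = dmat m k (\<lambda>i. dq_of_dual (\<mu>' i))"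
      "\<And>i. \<mu>' i \<ge> 0"
    using dual_svd[OF P] by metis
  define l where "l = min m k"
  define \<mu> where "\<mu> i = (if i < l then \<mu>' i else 0)" for i
  have \<mu>: "U1\<^sup>\<dagger> * P * W1 = dmat m k (\<lambda>i. dq_of_dual (\<mu> i))" "\<And>i. \<mu> i \<ge> 0" "\<And>i. l \<le> i \<Longrightarrow> \<mu> i = 0"
    using svd(3,4) by (auto simp: \<mu>_def l_def intro!: dmat_cong)
  obtain f where f: "f permutes {..<l}" "\<And>i j. i \<le> j \<Longrightarrow> j < l \<Longrightarrow> cs_key (\<mu> (f i)) \<le> cs_key (\<mu> (f j))"
    using sorting_permutation[of l "\<lambda>i. cs_key (\<mu> i)"] by metis
  define \<nu> where "\<nu> i = \<mu> (f i)" for i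
  have \<nu>: "\<And>i. \<nu> i \<ge> 0" "\<And>i. l \<le> i \<Longrightarrow> \<nu> i = 0"
    using \<mu>(2,3) permutes_not_in[OF f(1)] by (auto simp: \<nu>_def)
  have sorted: "mono_on {..<l} (\<lambda>i. cs_key (\<nu> i))"
    using f(2) by (intro mono_onI) (simp add: \<nu>_def)
  obtain U2 W2 where u2: "unitary m U2" "unitary k W2" "U2\<^sup>\<dagger> * P * W2 = dmat m k (\<lambda>i. dq_of_dual (\<nu> i))"
    unfolding \<nu>_def
    using permute_diagonal[OF P svd(1,2) \<mu>(1) f(1)[unfolded l_def]] by metis
  note d2 = unitary_dim[OF u2(1)] unitary_dim[OF u2(2)]
  define M where "M = R * W2"
  have dM: "dim_row M = p" "dim_col M = k"
    by (simp_all add: M_def dPR d2)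
  have PW: "P * W2 = U2 * dmat m k (\<lambda>i. dq_of_dual (\<nu> i))"
    unfolding u2(3)[symmetric] by (simp add: mult_assoc dPR d2 unitary_cancel[OF u2(1)])
  have gram: "(M\<^sup>\<dagger> * M) $$ (i,j) = (if i = j then dq_of_dual (1 - \<nu> i * \<nu> i) else 0)" if ij: "i < k" "j < k" for i j
  proof -
    have "W2\<^sup>\<dagger> * (P\<^sup>\<dagger> * P + R\<^sup>\<dagger> * R) * W2 = W2\<^sup>\<dagger> * (P\<^sup>\<dagger> * P) * W2 + W2\<^sup>\<dagger> * (R\<^sup>\<dagger> * R) * W2"
      using P R u2(2)
      by (subst mult_add_distrib_mat[of _ k k _ k], auto simp: unitary_def)
        (subst add_mult_distrib_mat[of _ k k _ _ k], auto)
    then have "(P * W2)\<^sup>\<dagger> * (P * W2) + M\<^sup>\<dagger> * M = 1\<^sub>m k"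
      unfolding orth by (simp add: M_def adj_mult mult_assoc dPR d2 unitary_cancel[OF u2(2)])
    moreover have "(P * W2)\<^sup>\<dagger> * (P * W2) = dmat k k (\<lambda>i. dq_of_dual (\<nu> i * \<nu> i))"
      unfolding PW using \<nu>(2)
      by (simp add: adj_mult mult_assoc d2 unitary_cancel[OF u2(1)] adj_dmat dmat_mult)
        (auto intro!: dmat_cong simp: l_def)
    ultimately have "(dmat k k (\<lambda>i. dq_of_dual (\<nu> i * \<nu> i)) + M\<^sup>\<dagger> * M) $$ (i,j) = 1\<^sub>m k $$ (i,j)"
      by simp
    then show ?thesis
      using ij dM by (auto simp: eq_diff_eq add.commute simp del: index_mult_mat(1))
  qed
  have gram_st: "1 - st_part (\<nu> j) * st_part (\<nu> j) = (\<Sum>i<p. qnorm2 (st_part (M $$ (i,j))))" if "j < k" for j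
  proof -
    have "st_part ((M\<^sup>\<dagger> * M) $$ (j,j)) = of_real (\<Sum>i<p. qnorm2 (st_part (M $$ (i,j))))"
      using that by (simp add: mult_index[of _ p] dM conjugate_mult_self del: index_mult_mat(1))
    moreover have "st_part ((M\<^sup>\<dagger> * M) $$ (j,j)) = of_real (st_part (1 - \<nu> j * \<nu> j))"
      by (simp only: gram[OF that that] simp_thms if_True dq_of_dual_sel)
    ultimately have "st_part (1 - \<nu> j * \<nu> j) = (\<Sum>i<p. qnorm2 (st_part (M $$ (i,j))))"
      by (simp only: of_real_eq_iff)
    then show ?thesis
      by simp
  qed
  have st_zero: "st_part (M $$ (i,j)) = 0" if "j < k" "st_part (\<nu> j) \<ge> 1" "i < p" for i j
  proof -
    have "1 * 1 \<le> st_part (\<nu> j) * st_part (\<nu> j)"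
      using that(2) by (intro mult_mono) auto
    then have "(\<Sum>i<p. qnorm2 (st_part (M $$ (i,j)))) = 0"
      using gram_st[OF that(1)] by (intro antisym) (auto simp: sum_nonneg qnorm2_nonneg)
    then show ?thesis
      using that(3) by (simp add: sum_nonneg_eq_0_iff qnorm2_nonneg)
  qed
  \<comment> \<open>A singular value with standard part 1 has no infinitesimal part: its column in \<open>M\<close> is infinitesimal and so has
    Gram entry zero.\<close>
  have one: "\<nu> j = 1" if "j < l" "st_part (\<nu> j) \<ge> 1" for j
  proof -
    have jk: "j < k"
      using that(1) by (simp add: l_def)
    have "(M\<^sup>\<dagger> * M) $$ (j,j) = (\<Sum>i<p. conjugate (M $$ (i,j)) * M $$ (i,j))"
      using jk by (simp add: mult_index[of _ p] dM del: index_mult_mat(1))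
    also have "\<dots> = 0"
      by (rule product_infinitesimals) (use st_zero[OF jk that(2)] in auto)
    finally have "dq_of_dual (1 - \<nu> j * \<nu> j) = dq_of_dual 0"
      using gram[OF jk jk] by simp
    then have "1 - \<nu> j * \<nu> j = 0"
      unfolding dq_of_dual_eq_iff .
    then have sq: "st_part (1 - \<nu> j * \<nu> j) = 0" "in_part (1 - \<nu> j * \<nu> j) = 0"
      by simp_all
    have st1: "st_part (\<nu> j) = 1"
      using sq(1) that(2) by (simp add: square_eq_1_iff)
    then have "in_part (\<nu> j) = 0"
      using sq(2) by simp
    with st1 show ?thesis
      by (simp add: dual_eq_iff)
  qed
  have segs: "\<forall>i. \<nu> i \<ge> 0" "\<forall>i\<ge>l. \<nu> i = 0" "\<forall>i<l. st_part (\<nu> i) \<ge> 1 \<longrightarrow> \<nu> i = 1"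
    using \<nu> one by blast+
  obtain r q t where rqt: "r + q + t \<le> l" "\<And>i. i < r \<Longrightarrow> \<nu> i = 1"
    "\<And>i. r \<le> i \<Longrightarrow> i < r + q \<Longrightarrow> 0 < st_part (\<nu> i) \<and> st_part (\<nu> i) < 1"
    "\<And>i. r + q \<le> i \<Longrightarrow> st_part (\<nu> i) = 0"
    "\<And>i. r + q \<le> i \<Longrightarrow> i < r + q + t \<Longrightarrow> 0 < in_part (\<nu> i)"
    "\<And>i. r + q + t \<le> i \<Longrightarrow> \<nu> i = 0"
    "mono_on {..<q} (\<lambda>i. \<nu> (r + i))" "antimono_on {..<t} (\<lambda>i. in_part (\<nu> (r + q + i)))"
    using sorted_singular_values_segments[OF sorted segs] by blast
  define h where "h = k - r"
  have rk: "r \<le> m" "r \<le> k" "k = r + h"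
    using rqt(1) by (auto simp: l_def h_def)
  define \<tau> where "\<tau> j = dsqrt (1 - \<nu> (r + j) * \<nu> (r + j))" for j
  have st_lt: "0 \<le> st_part (\<nu> (r + j)) \<and> st_part (\<nu> (r + j)) * st_part (\<nu> (r + j)) < 1" for j
  proof (cases "j < q")
    case True
    then have "0 < st_part (\<nu> (r + j))" "st_part (\<nu> (r + j)) < 1"
      using rqt(3)[of "r + j"] by auto
    then show ?thesis
      using mult_strict_mono[of "st_part (\<nu> (r + j))" 1 "st_part (\<nu> (r + j))" 1] by simp
  next
    case False
    then show ?thesis
      using rqt(4)[of "r + j"] by simp
  qed
  have \<tau>_sq: "\<tau> j * \<tau> j = 1 - \<nu> (r + j) * \<nu> (r + j)" for j
    unfolding \<tau>_def by (rule dsqrt_mult_self) (use st_lt[of j] in simp)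
  have \<tau>_pos: "st_part (\<tau> j) > 0" for j
    using st_lt[of j] by (simp add: \<tau>_def dsqrt_def)
  \<comment> \<open>Infinitesimal singular values have square zero, so they contribute identity blocks to \<open>Sigma_B\<close>.\<close>
  have \<tau>_one: "\<tau> j = 1" if "q \<le> j" for j
  proof -
    have "\<nu> (r + j) * \<nu> (r + j) = 0"
      using rqt(4)[of "r + j"] that by (simp add: dual_eq_iff)
    then show ?thesis
      by (simp add: \<tau>_def)
  qed
  have "M \<in> carrier_mat p (r + h)"
    using dM rk by (intro carrier_matI) auto
  then obtain V2 E where V2: "h \<le> p" "unitary p V2" "E \<in> carrier_mat (p - h) r"
      "V2\<^sup>\<dagger> * M = dsum E (dmat h h (\<lambda>i. dq_of_dual (\<tau> i)))"
  proof (rule orthogonal_columns_normal_form)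
    show "(M\<^sup>\<dagger> * M) $$ (i,j) = 0" if "i < r + h" "j < r + h" "i \<noteq> j" for i j
      using gram[of i j] that rk(3) by simp
    show "(M\<^sup>\<dagger> * M) $$ (r + j, r + j) = dq_of_dual (\<tau> j * \<tau> j)" if "j < h" for j
      using gram[of "r + j" "r + j"] that rk(3) unfolding \<tau>_sq by simp
    show "st_part (\<tau> j) \<noteq> 0" for j
      using \<tau>_pos[of j] by simp
  qed blast
  note dV2 = unitary_dim[OF V2(2)]
  have dE: "dim_row E = p - h" "dim_col E = r"
    using V2(3) by auto
  have "stm E = 0\<^sub>m (p - h) r"
  proof (rule eq_matI)
    fix i j assume "i < dim_row (0\<^sub>m (p - h) r :: quat mat)" "j < dim_col (0\<^sub>m (p - h) r :: quat mat)"
    then have ij: "i < p - h" "j < r" by auto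
    have "st_part (M $$ (l',j)) = 0" if "l' < p" for l'
      using st_zero[of j l'] that ij rk rqt(2)[of j] by simp
    then have "st_part ((V2\<^sup>\<dagger> * M) $$ (i,j)) = 0"
      using ij rk by (simp add: mult_index[of _ p] dM dV2 del: index_mult_mat(1))
    then show "stm E $$ (i,j) = 0\<^sub>m (p - h) r $$ (i,j)"
      using ij dE unfolding V2(4) by (simp add: dsum_index)
  qed (simp_all add: dE)
  then obtain P3 Q3 r\<^sub>1 \<sigma> where P3: "unitary (p - h) P3" "unitary r Q3" "r\<^sub>1 \<le> p - h" "r\<^sub>1 \<le> r"
    "antimono_on {..<r\<^sub>1} \<sigma>" "\<And>i. i < r\<^sub>1 \<Longrightarrow> \<sigma> i > 0"
    "P3\<^sup>\<dagger> * E * Q3 = dmat (p - h) r (\<lambda>i. if i < r\<^sub>1 then Dual 0 (of_real (\<sigma> i)) else 0)"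
    using infinitesimal_svd[OF V2(3)] by blast
  note d3 = unitary_dim[OF P3(1)] unitary_dim[OF P3(2)]
  \<comment> \<open>The rotation \<open>Q3\<close> of the first \<open>r\<close> columns must be undone in \<open>P\<close>; there the block is the identity, so the
    same rotation in \<open>U3\<close> does it.\<close>
  define U3 where "U3 = U2 * dsum Q3 (1\<^sub>m (m - r))"
  define V3 where "V3 = V2 * dsum P3 (1\<^sub>m h)"
  define W3 where "W3 = W2 * dsum Q3 (1\<^sub>m h)"
  have u3: "unitary m U3" "unitary p V3" "unitary k W3"
    unfolding U3_def V3_def W3_def
    using unitary_dsum[OF P3(2) unitary_one[of "m - r"]] unitary_dsum[OF P3(1) unitary_one[of h]]
      unitary_dsum[OF P3(2) unitary_one[of h]] rk V2(1,2) u2(1,2)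
    by (auto intro!: unitary_mult)
  define c where "c i = \<nu> (r + i)" for i
  define \<xi> where "\<xi> i = in_part (\<nu> (r + q + i))" for i
  have "r + q + t \<le> m" "r + q + t \<le> k"
    using rqt(1) by (auto simp: l_def)
  note sizes = this
  have \<nu>_blocks: "dq_of_dual (\<nu> i) = (if i < r then 1 else if i < r + q then dq_of_dual (c (i - r))
      else if i < r + q + t then Dual 0 (of_real (\<xi> (i - r - q))) else 0)" for i
    using rqt(2,4,6)[of i] by (auto simp: c_def \<xi>_def dual_eq_iff)
  have A_blocks: "dmat m k (\<lambda>i. dq_of_dual (\<nu> i))
      = dsum (1\<^sub>m r) (dmat (m - r) h (\<lambda>i. dq_of_dual (\<nu> (r + i))))"
    unfolding one_mat_dmat dsum_dmat_square using rk rqt(2)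
    by (intro eq_matI) auto
  have "U3\<^sup>\<dagger> * P * W3 = dsum (Q3\<^sup>\<dagger>) (1\<^sub>m (m - r)) * (U2\<^sup>\<dagger> * P * W2) * dsum Q3 (1\<^sub>m h)"
    unfolding U3_def W3_def using rk by (simp add: adj_mult mult_assoc adj_dsum d2 d3 dPR)
  also have "\<dots> = dmat m k (\<lambda>i. dq_of_dual (\<nu> i))"
    unfolding u2(3) A_blocks by (simp add: dsum_mult d3 unitary_cancel[OF P3(2)])
  also have "\<dots> = Sigma_A m k r q t c \<xi>"
    unfolding Sigma_A_eq[OF sizes] \<nu>_blocks ..
  finally have "U3 * (U3\<^sup>\<dagger> * P * W3) * W3\<^sup>\<dagger> = U3 * Sigma_A m k r q t c \<xi> * W3\<^sup>\<dagger>"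
    by simp
  then have P_eq: "P = U3 * Sigma_A m k r q t c \<xi> * W3\<^sup>\<dagger>"
    using unitary_dim[OF u3(1)] unitary_dim[OF u3(3)]
    by (simp add: mult_assoc dPR unitary_cancel[OF u3(1)] unitary_cancel[OF u3(3)])
  have h_sizes: "p + r - k = p - h" "k + r\<^sub>1 \<le> p + r"
    using rk(3) V2(1) P3(3) by auto
  have "V3\<^sup>\<dagger> * R * W3 = dsum (P3\<^sup>\<dagger>) (1\<^sub>m h) * (V2\<^sup>\<dagger> * M) * dsum Q3 (1\<^sub>m h)"
    unfolding V3_def W3_def M_def using rk V2(1) by (simp add: adj_mult mult_assoc adj_dsum d2 dV2 d3 dPR)
  also have "\<dots> = dsum (dmat (p - h) r (\<lambda>i. if i < r\<^sub>1 then Dual 0 (of_real (\<sigma> i)) else 0))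
      (dmat h h (\<lambda>i. dq_of_dual (\<tau> i)))"
    unfolding V2(4) P3(7)[symmetric] by (simp add: dsum_mult d3 dE)
  also have "dmat h h (\<lambda>i. dq_of_dual (\<tau> i)) = dmat h h (\<lambda>i. if i < q then dq_of_dual (\<tau> i) else 1)"
    using \<tau>_one by (intro dmat_cong) auto
  also have "dsum (dmat (p - h) r (\<lambda>i. if i < r\<^sub>1 then Dual 0 (of_real (\<sigma> i)) else 0)) \<dots>
      = Sigma_B p k r r\<^sub>1 q t \<tau> \<sigma>"
    unfolding Sigma_B_eq[OF sizes(2) P3(4) h_sizes(2)] h_def ..
  finally have "V3 * (V3\<^sup>\<dagger> * R * W3) * W3\<^sup>\<dagger> = V3 * Sigma_B p k r r\<^sub>1 q t \<tau> \<sigma> * W3\<^sup>\<dagger>"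
    by simp
  then have R_eq: "R = V3 * Sigma_B p k r r\<^sub>1 q t \<tau> \<sigma> * W3\<^sup>\<dagger>"
    using unitary_dim[OF u3(2)] unitary_dim[OF u3(3)]
    by (simp add: mult_assoc dPR unitary_cancel[OF u3(2)] unitary_cancel[OF u3(3)])
  have c_range: "0 < st_part (c i)" "st_part (c i) < 1" if "i < q" for i
    using rqt(3)[of "r + i"] that by (auto simp: c_def)
  have \<tau>_lt: "st_part (\<tau> i) < 1" if "i < q" for i
    using c_range[OF that] st_lt[of i] by (simp add: \<tau>_def dsqrt_def c_def)
  have "antimono_on {..<q} \<tau>"
  proof (rule monotone_onI)
    fix i j assume "i \<in> {..<q}" "j \<in> {..<q}" "i \<le> j"
    then show "\<tau> j \<le> \<tau> i"
      unfolding \<tau>_def using mono_onD[OF rqt(7), of i j] c_range[of i] c_range[of j]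
      by (intro dsqrt_one_minus_square_antimono) (auto simp: c_def)
  qed
  moreover have "\<forall>i<q. appreciable (c i) \<and> 0 < c i \<and> c i < 1 \<and> appreciable (\<tau> i) \<and> 0 < \<tau> i \<and> \<tau> i < 1
      \<and> (c i)\<^sup>2 + (\<tau> i)\<^sup>2 = 1"
  proof (intro allI impI)
    fix i assume i: "i < q"
    show "appreciable (c i) \<and> 0 < c i \<and> c i < 1 \<and> appreciable (\<tau> i) \<and> 0 < \<tau> i \<and> \<tau> i < 1
      \<and> (c i)\<^sup>2 + (\<tau> i)\<^sup>2 = 1"
      using c_range[OF i] \<tau>_pos[of i] \<tau>_lt[OF i]
      by (simp add: appreciable_def less_dual_def power2_eq_square \<tau>_sq c_def)
  qed
  moreover have "mono_on {..<q} c" "antimono_on {..<t} \<xi>" "\<forall>i<t. 0 < \<xi> i"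
    using rqt(5,7,8) c_def[abs_def] \<xi>_def[abs_def] by auto
  ultimately have "gsvd_parameters m p k r r\<^sub>1 q t \<sigma> \<xi> c \<tau>"
    unfolding gsvd_parameters_def using sizes P3(4-6) h_sizes(2) by simp
  then show thesis
    using that[OF u3(1,2) unitary_adj[OF u3(3)] _ P_eq R_eq] by blast
qed

section \<open>The generalized singular value decomposition\<close>

lemma append_dim [simp]:
  "dim_row (A @\<^sub>c B) = dim_row A" "dim_col (A @\<^sub>c B) = dim_col A + dim_col B"
  "dim_row (A @\<^sub>r B) = dim_row A + dim_row B" "dim_col (A @\<^sub>r B) = dim_col A"
  by (simp_all add: append_cols_def append_rows_def)

lemma append_cols_index:
  "i < dim_row A \<Longrightarrow> j < dim_col A + dim_col B \<Longrightarrow>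
    (A @\<^sub>c B) $$ (i,j) = (if j < dim_col A then A $$ (i,j) else B $$ (i, j - dim_col A))"
  by (simp add: append_cols_def)

lemma append_rows_index:
  "i < dim_row A + dim_row B \<Longrightarrow> j < dim_col A \<Longrightarrow>
    (A @\<^sub>r B) $$ (i,j) = (if i < dim_row A then A $$ (i,j) else B $$ (i - dim_row A, j))"
  by (simp add: append_rows_def)

lemma sum_lessThan_add:
  fixes f :: "nat \<Rightarrow> 'a :: comm_monoid_add"
  shows "(\<Sum>l<a + b. f l) = (\<Sum>l<a. f l) + (\<Sum>l<b. f (a + l))"
  by (induction b) (simp_all add: add.assoc)

lemma Sigma_dims:
  assumes "gsvd_parameters m p k r r\<^sub>1 q t \<sigma> \<xi> c s"
  shows "dim_row (Sigma_A m k r q t c \<xi>) = m" "dim_col (Sigma_A m k r q t c \<xi>) = k"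
    "dim_row (Sigma_B p k r r\<^sub>1 q t s \<sigma>) = p" "dim_col (Sigma_B p k r r\<^sub>1 q t s \<sigma>) = k"
proof -
  have "r + q + t \<le> m" "r + q + t \<le> k" "r\<^sub>1 \<le> r" "k + r\<^sub>1 \<le> p + r"
    using assms by (auto simp: gsvd_parameters_def)
  then show "dim_row (Sigma_A m k r q t c \<xi>) = m" "dim_col (Sigma_A m k r q t c \<xi>) = k"
    "dim_row (Sigma_B p k r r\<^sub>1 q t s \<sigma>) = p" "dim_col (Sigma_B p k r r\<^sub>1 q t s \<sigma>) = k"
    by (simp_all add: Sigma_A_eq Sigma_B_eq)
qed

lemma append_cols_mult_append_rows:
  fixes A B X Y :: "'a :: ring_1 mat"
  assumes "dim_row B = dim_row A" "dim_col Y = dim_col X" "dim_col A = dim_row X" "dim_col B = dim_row Y"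
  shows "(A @\<^sub>c B) * (X @\<^sub>r Y) = A * X + B * Y"
proof (rule eq_matI)
  let ?a = "dim_col A" and ?b = "dim_col B"
  fix i j assume "i < dim_row (A * X + B * Y)" "j < dim_col (A * X + B * Y)"
  then have ij: "i < dim_row A" "j < dim_col X"
    using assms by auto
  have "((A @\<^sub>c B) * (X @\<^sub>r Y)) $$ (i,j) = (\<Sum>l<?a + ?b. (A @\<^sub>c B) $$ (i,l) * (X @\<^sub>r Y) $$ (l,j))"
    using ij assms by (intro mult_index) auto
  also have "\<dots> = (\<Sum>l<?a. (A @\<^sub>c B) $$ (i,l) * (X @\<^sub>r Y) $$ (l,j))
      + (\<Sum>l<?b. (A @\<^sub>c B) $$ (i,?a + l) * (X @\<^sub>r Y) $$ (?a + l,j))"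
    by (rule sum_lessThan_add)
  also have "\<dots> = (\<Sum>l<?a. A $$ (i,l) * X $$ (l,j)) + (\<Sum>l<?b. B $$ (i,l) * Y $$ (l,j))"
    using ij assms by (intro arg_cong2[of _ _ _ _ "(+)"] sum.cong) (auto simp: append_cols_index append_rows_index)
  finally show "((A @\<^sub>c B) * (X @\<^sub>r Y)) $$ (i,j) = (A * X + B * Y) $$ (i,j)"
    using ij assms by (simp add: mult_index[of A ?a] mult_index[of B ?b] del: index_mult_mat(1))
qed (use assms in auto)

lemma mult_append_cols:
  fixes U A B :: "'a :: ring_1 mat"
  assumes "dim_col U = dim_row A" "dim_row B = dim_row A"
  shows "U * (A @\<^sub>c B) = (U * A) @\<^sub>c (U * B)"
proof (rule eq_matI)
  fix i j assume "i < dim_row ((U * A) @\<^sub>c (U * B))" "j < dim_col ((U * A) @\<^sub>c (U * B))"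
  then have ij: "i < dim_row U" "j < dim_col A + dim_col B"
    by auto
  have "(U * (A @\<^sub>c B)) $$ (i,j) = (if j < dim_col A then (U * A) $$ (i,j) else (U * B) $$ (i, j - dim_col A))"
    using ij assms
    by (auto simp del: index_mult_mat(1) intro!: mult_cong_col[of _ "dim_row A"] simp: append_cols_index)
  then show "(U * (A @\<^sub>c B)) $$ (i,j) = ((U * A) @\<^sub>c (U * B)) $$ (i,j)"
    using ij by (simp add: append_cols_index del: index_mult_mat(1))
qed (use assms in auto)

lemma append_cols_mult_dsum:
  fixes A B X Y :: "'a :: ring_1 mat"
  assumes "dim_row B = dim_row A" "dim_col A = dim_row X" "dim_col B = dim_row Y"
  shows "(A @\<^sub>c B) * dsum X Y = (A * X) @\<^sub>c (B * Y)"
proof (rule eq_matI)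
  let ?a = "dim_col A" and ?b = "dim_col B"
  fix i j assume "i < dim_row ((A * X) @\<^sub>c (B * Y))" "j < dim_col ((A * X) @\<^sub>c (B * Y))"
  then have ij: "i < dim_row A" "j < dim_col X + dim_col Y"
    using assms by auto
  have "((A @\<^sub>c B) * dsum X Y) $$ (i,j) = (\<Sum>l<?a + ?b. (A @\<^sub>c B) $$ (i,l) * dsum X Y $$ (l,j))"
    using ij assms by (intro mult_index) auto
  also have "\<dots> = (\<Sum>l<?a. (A @\<^sub>c B) $$ (i,l) * dsum X Y $$ (l,j))
      + (\<Sum>l<?b. (A @\<^sub>c B) $$ (i,?a + l) * dsum X Y $$ (?a + l,j))"
    by (rule sum_lessThan_add)
  also have "\<dots> = (if j < dim_col X then \<Sum>l<?a. A $$ (i,l) * X $$ (l,j)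
      else \<Sum>l<?b. B $$ (i,l) * Y $$ (l, j - dim_col X))"
    using ij assms by (simp add: append_cols_index dsum_index)
  finally show "((A @\<^sub>c B) * dsum X Y) $$ (i,j) = ((A * X) @\<^sub>c (B * Y)) $$ (i,j)"
    using ij assms
    by (simp add: append_cols_index mult_index[of A ?a] mult_index[of B ?b] del: index_mult_mat(1))
qed (use assms in auto)

lemma gram_append_rows:
  fixes X Y :: "'a :: star_ring mat"
  assumes "dim_col Y = dim_col X"
  shows "(X @\<^sub>r Y)\<^sup>\<dagger> * (X @\<^sub>r Y) = X\<^sup>\<dagger> * X + Y\<^sup>\<dagger> * Y"
proof -
  have "(X @\<^sub>r Y)\<^sup>\<dagger> = X\<^sup>\<dagger> @\<^sub>c Y\<^sup>\<dagger>"
    using assms by (intro eq_matI) (auto simp: append_cols_index append_rows_index)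
  then show ?thesis
    using assms by (simp add: append_cols_mult_append_rows)
qed

text \<open>
  Columns of a unitary matrix are orthonormal; this is what makes the two parts of such
  columns a CS pair.
\<close>

lemma unitary_column_blocks:
  fixes U :: "'a :: star_ring mat"
  assumes U: "unitary (m + p) U" and c: "o' + c \<le> m + p"
  shows "(mat m c (\<lambda>(i,j). U $$ (i, o' + j)))\<^sup>\<dagger> * mat m c (\<lambda>(i,j). U $$ (i, o' + j))
    + (mat p c (\<lambda>(i,j). U $$ (m + i, o' + j)))\<^sup>\<dagger> * mat p c (\<lambda>(i,j). U $$ (m + i, o' + j)) = 1\<^sub>m c"
    (is "?P\<^sup>\<dagger> * ?P + ?R\<^sup>\<dagger> * ?R = _")
proof (rule eq_matI)
  fix i j assume "i < dim_row (1\<^sub>m c :: 'a mat)" "j < dim_col (1\<^sub>m c :: 'a mat)"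
  then have ij: "i < c" "j < c" by auto
  have "((?P @\<^sub>r ?R)\<^sup>\<dagger> * (?P @\<^sub>r ?R)) $$ (i,j) = (U\<^sup>\<dagger> * U) $$ (o' + i, o' + j)"
    using ij c unitary_dim[OF U]
    by (intro adj_mult_cong_cols[of _ "m + p"]) (auto simp: append_rows_index)
  then show "(?P\<^sup>\<dagger> * ?P + ?R\<^sup>\<dagger> * ?R) $$ (i,j) = 1\<^sub>m c $$ (i,j)"
    using ij c by (simp add: gram_append_rows unitary_cancel[OF U] del: index_mult_mat(1))
qed auto

lemma eps_smult_mult:
  fixes U N :: "'a :: ring_1 dual mat"
  assumes "dim_col U = dim_row N"
  shows "U * (eps \<cdot>\<^sub>m N) = eps \<cdot>\<^sub>m (U * N)"
proof (rule eq_matI)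
  fix i j assume "i < dim_row (eps \<cdot>\<^sub>m (U * N))" "j < dim_col (eps \<cdot>\<^sub>m (U * N))"
  moreover have "x * (eps * y) = eps * (x * y)" for x y :: "'a dual"
    by (simp add: dual_eq_iff eps_def)
  ultimately show "(U * (eps \<cdot>\<^sub>m N)) $$ (i,j) = (eps \<cdot>\<^sub>m (U * N)) $$ (i,j)"
    using assms by (simp add: mult_index[of _ "dim_row N"] sum_distrib_left del: index_mult_mat(1))
qed (use assms in auto)

text \<open>
  The core of the second part, for one of the two row blocks. The entries \<open>d i\<close> with \<open>t \<le> i\<close>
  factor as \<open>\<epsilon>\<close> times a real number; \<open>\<epsilon>\<close> stays with the columns of \<open>P\<close> and the real number
  becomes an entry \<open>e i\<close> of the right factor. The entries of \<open>e\<close> beyond \<open>k - t\<close> meet zero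
  columns and are free.
\<close>

lemma infinitesimal_part_to_the_left:
  fixes P :: "quat dual mat" and d :: "nat \<Rightarrow> real dual"
  assumes U: "unitary m U" and P: "P \<in> carrier_mat m k" and S: "S \<in> carrier_mat m t" and W: "unitary t W"
    and tkn: "t \<le> k" "k \<le> n"
    and P1: "mat m t (\<lambda>(i,j). P $$ (i,j)) = U * S * W"
    and d: "\<And>i. t \<le> i \<Longrightarrow> i < k \<Longrightarrow> st_part (d i) = 0"
    and e: "\<And>i. i < k - t \<Longrightarrow> e i = dq_of_dual (Dual (in_part (d (t + i))) 0)"
  shows "U * (S @\<^sub>c (eps \<cdot>\<^sub>m (U\<^sup>\<dagger> * mat m (k - t) (\<lambda>(i,j). P $$ (i, t + j)))) @\<^sub>c 0\<^sub>m m (n - k)) *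
      dsum (W * dmat t t (\<lambda>i. dq_of_dual (d i))) (dmat (n - t) (n - t) e) =
    P * dmat k n (\<lambda>i. dq_of_dual (d i))"
proof -
  let ?P2 = "mat m (k - t) (\<lambda>(i,j). P $$ (i, t + j))"
  let ?D = "dmat t t (\<lambda>i. dq_of_dual (d i))"
  note dims = unitary_dim[OF U] unitary_dim[OF W] carrier_matD[OF P] carrier_matD[OF S]
  have "U * (S @\<^sub>c (eps \<cdot>\<^sub>m (U\<^sup>\<dagger> * ?P2)) @\<^sub>c 0\<^sub>m m (n - k)) = (U * S) @\<^sub>c ((eps \<cdot>\<^sub>m ?P2) @\<^sub>c 0\<^sub>m m (n - k))"
    by (simp add: mult_append_cols dims eps_smult_mult unitary_cancel[OF U] zero_mult_dim)
  then have "U * (S @\<^sub>c (eps \<cdot>\<^sub>m (U\<^sup>\<dagger> * ?P2)) @\<^sub>c 0\<^sub>m m (n - k)) * dsum (W * ?D) (dmat (n - t) (n - t) e)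
      = (U * S * (W * ?D)) @\<^sub>c (((eps \<cdot>\<^sub>m ?P2) @\<^sub>c 0\<^sub>m m (n - k)) * dmat (n - t) (n - t) e)"
    using tkn by (simp add: append_cols_mult_dsum dims)
  also have "U * S * (W * ?D) = mat m t (\<lambda>(i,j). P $$ (i,j)) * ?D"
    unfolding P1 by (simp add: mult_assoc dims)
  also have "\<dots> @\<^sub>c (((eps \<cdot>\<^sub>m ?P2) @\<^sub>c 0\<^sub>m m (n - k)) * dmat (n - t) (n - t) e) = P * dmat k n (\<lambda>i. dq_of_dual (d i))"
    (is "?L = ?R")
  proof (rule eq_matI)
    fix i j assume "i < dim_row ?R" "j < dim_col ?R"
    then have ij: "i < m" "j < n"
      using dims by auto
    have R: "?R $$ (i,j) = (if j < k then P $$ (i,j) * dq_of_dual (d j) else 0)"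
      using ij dims by (simp add: mult_dmat_index del: index_mult_mat(1))
    have L: "?L $$ (i,j) = (if j < t then P $$ (i,j) * dq_of_dual (d j)
        else if j < k then eps * P $$ (i,j) * e (j - t) else 0)"
      using ij dims tkn by (simp add: append_cols_index mult_dmat_index del: index_mult_mat(1)) auto
    have "eps * P $$ (i,j) * e (j - t) = P $$ (i,j) * dq_of_dual (d j)" if "t \<le> j" "j < k"
      using that d[of j] e[of "j - t"] by (simp add: dual_eq_iff eps_def)
    then show "?L $$ (i,j) = ?R $$ (i,j)"
      unfolding L R using tkn by auto
  qed (use dims tkn in auto)
  finally show ?thesis .
qed

lemma singular_values_segment:
  assumes "sorted_wrt (\<ge>) mus" "\<forall>\<mu>\<in>set mus. 0 < (\<mu> :: real dual)" "i < length mus"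
  shows "appreciable (mus ! i) \<longleftrightarrow> i < length (filter appreciable mus)"
proof -
  have app: "appreciable x \<longleftrightarrow> st_part x > 0" if "x \<in> set mus" for x
    using assms(2) that by (auto simp: appreciable_def less_dual_def)
  have "appreciable (mus ! i)" if "i \<le> j" "j < length mus" "appreciable (mus ! j)" for i j
  proof -
    have "mus ! j \<le> mus ! i"
      using sorted_wrt_nth_less[OF assms(1), of i j] that by (cases "i = j") auto
    then have "st_part (mus ! j) \<le> st_part (mus ! i)"
      by (auto simp: less_eq_dual_def)
    then show ?thesis
      using app[of "mus ! i"] app[of "mus ! j"] that by auto
  qed
  then obtain r where r: "r \<le> length mus" "\<And>i. i < length mus \<Longrightarrow> appreciable (mus ! i) \<longleftrightarrow> i < r"
    by (rule_tac initial_segment[of "length mus" "\<lambda>i. appreciable (mus ! i)"]) blast+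
  have "{i. i < length mus \<and> appreciable (mus ! i)} = {..<r}"
    using r by auto
  then have "length (filter appreciable mus) = r"
    by (simp add: length_filter_conv_card)
  then show ?thesis
    using r(2)[OF assms(3)] by simp
qed

lemma invertible_matI:
  assumes "X \<in> carrier_mat n n" "Y \<in> carrier_mat n n" "X * Y = 1\<^sub>m n" "Y * X = 1\<^sub>m n"
  shows "invertible_mat X"
  using assms unfolding invertible_mat_def inverts_mat_def by auto

theorem theorem4p1:
  fixes A B C :: "quat dual mat" and m n p k t s :: nat
  assumes A: "A \<in> carrier_mat m n"
    and B: "B \<in> carrier_mat p n"
    and C: "C = A @\<^sub>r B"
    and k: "dq_rank C = k"
    and t: "dq_Arank C = t"
    and s: "s = k - t"
  shows
    "(\<exists>U V X r r\<^sub>1 q t\<^sub>1 \<sigma> \<xi> c sv.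
        unitary_mat m U \<and> unitary_mat p V \<and> X \<in> carrier_mat n n \<and>
        gsvd_parameters m p k r r\<^sub>1 q t\<^sub>1 \<sigma> \<xi> c sv \<and>
        A = U * (Sigma_A m k r q t\<^sub>1 c \<xi> @\<^sub>c 0\<^sub>m m (n - k)) * X \<and>
        B = V * (Sigma_B p k r r\<^sub>1 q t\<^sub>1 sv \<sigma> @\<^sub>c 0\<^sub>m p (n - k)) * X) \<and>
     (\<exists>U V X N\<^sub>A N\<^sub>B r r\<^sub>1 q t\<^sub>1 \<sigma> \<xi> c sv.
        unitary_mat m U \<and> unitary_mat p V \<and> X \<in> carrier_mat n n \<and> invertible_mat X \<and>
        N\<^sub>A \<in> carrier_mat m s \<and> N\<^sub>B \<in> carrier_mat p s \<and>
        orthonormal_columns (N\<^sub>A @\<^sub>r N\<^sub>B) \<and>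
        gsvd_parameters m p t r r\<^sub>1 q t\<^sub>1 \<sigma> \<xi> c sv \<and>
        A = U * (Sigma_A m t r q t\<^sub>1 c \<xi> @\<^sub>c (eps \<cdot>\<^sub>m N\<^sub>A) @\<^sub>c 0\<^sub>m m (n - k)) * X \<and>
        B = V * (Sigma_B p t r r\<^sub>1 q t\<^sub>1 sv \<sigma> @\<^sub>c (eps \<cdot>\<^sub>m N\<^sub>B) @\<^sub>c 0\<^sub>m p (n - k)) * X)"
proof -
  have dAB: "dim_row A = m" "dim_col A = n" "dim_row B = p" "dim_col B = n"
    using A B by auto
  have dC: "dim_row C = m + p" "dim_col C = n"
    by (simp_all add: C dAB)
  define mus where "mus = singular_values C"
  have "\<exists>mus U V. is_svd C U V mus"
    using is_svd_exists[of C] by metis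
  then have "\<exists>U V. is_svd C U V mus"
    unfolding mus_def singular_values_def by (rule someI_ex)
  then obtain G H where svd: "is_svd C G H mus"
    by blast
  have len: "length mus = k" "length (filter appreciable mus) = t"
    using k t by (simp_all add: dq_rank_def dq_Arank_def mus_def)
  have GH: "unitary (m + p) G" "unitary n H" and kmn: "k \<le> m + p" "k \<le> n"
    and sorted: "sorted_wrt (\<ge>) mus" and pos: "\<forall>\<mu>\<in>set mus. 0 < \<mu>"
    and diag: "G\<^sup>\<dagger> * C * H = diag_block_mat
        [mat_diag k (\<lambda>i. dq_of_dual (mus ! i)), 0\<^sub>m (m + p - k) (n - k)]"
    using svd by (simp_all add: is_svd_def dC len unitary_mat_iff)
  define d where "d i = mus ! i" for i
  note dGH = unitary_dim[OF GH(1)] unitary_dim[OF GH(2)]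
  have tk: "t \<le> k"
    using length_filter_le[of appreciable mus] len by simp
  have d_app: "appreciable (d i) \<longleftrightarrow> i < t" if "i < k" for i
    using singular_values_segment[OF sorted pos] that len by (simp add: d_def)
  have d_pos: "0 < d i" if "i < k" for i
    using pos that len by (simp add: d_def)
  have diag': "G\<^sup>\<dagger> * C * H = dmat (m + p) n (\<lambda>i. if i < k then dq_of_dual (d i) else 0)"
    unfolding diag diag_block_mat_Cons_Cons diag_block_mat_singleton mat_diag_dmat zero_mat_dmat
      dsum_dmat_square using kmn by (auto intro!: dmat_cong simp: d_def)
  define Z where "Z = dmat k n (\<lambda>i. dq_of_dual (d i)) * H\<^sup>\<dagger>"
  have dZ: "dim_row Z = k" "dim_col Z = n"
    by (simp_all add: Z_def dGH)
  define P where "P = mat m k (\<lambda>(i,j). G $$ (i,j))"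
  define R where "R = mat p k (\<lambda>(i,j). G $$ (m + i,j))"
  have dPR: "dim_row P = m" "dim_col P = k" "dim_row R = p" "dim_col R = k"
    by (simp_all add: P_def R_def)
  have PR: "P \<in> carrier_mat m k" "R \<in> carrier_mat p k"
    by (simp_all add: P_def R_def)
  have C_eq: "C = G * (dmat (m + p) n (\<lambda>i. if i < k then dq_of_dual (d i) else 0) * H\<^sup>\<dagger>)"
    unfolding diag'[symmetric]
    by (simp add: mult_assoc dGH dC unitary_cancel[OF GH(1)] unitary_cancel[OF GH(2)])
  have C_index: "C $$ (i,j) = (\<Sum>l<k. G $$ (i,l) * Z $$ (l,j))" if ij: "i < m + p" "j < n" for i j
  proof -
    have "C $$ (i,j) = (\<Sum>l<m + p. G $$ (i,l) * (dmat (m + p) n (\<lambda>i. if i < k then dq_of_dual (d i) else 0) * H\<^sup>\<dagger>) $$ (l,j))"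
      unfolding C_eq using ij by (intro mult_index) (auto simp: dGH)
    also have "\<dots> = (\<Sum>l<m + p. if l < k then G $$ (i,l) * Z $$ (l,j) else 0)"
      using ij by (intro sum.cong) (auto simp: dmat_mult_index dGH Z_def simp del: index_mult_mat(1))
    also have "\<dots> = (\<Sum>l<k. G $$ (i,l) * Z $$ (l,j))"
      using kmn(1) by (intro sum.mono_neutral_cong_right) auto
    finally show ?thesis .
  qed
  have A_eq: "A = P * Z"
  proof (rule eq_matI)
    fix i j assume "i < dim_row (P * Z)" "j < dim_col (P * Z)"
    then have ij: "i < m" "j < n" by (auto simp: dPR dZ)
    have "A $$ (i,j) = C $$ (i,j)"
      using ij by (simp add: C append_rows_index dAB)
    then show "A $$ (i,j) = (P * Z) $$ (i,j)"
      using ij by (simp add: C_index mult_index[of _ k] dPR dZ P_def del: index_mult_mat(1))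
  qed (simp_all add: dPR dZ dAB)
  have B_eq: "B = R * Z"
  proof (rule eq_matI)
    fix i j assume "i < dim_row (R * Z)" "j < dim_col (R * Z)"
    then have ij: "i < p" "j < n" by (auto simp: dPR dZ)
    have "B $$ (i,j) = C $$ (m + i,j)"
      using ij by (simp add: C append_rows_index dAB)
    then show "B $$ (i,j) = (R * Z) $$ (i,j)"
      using ij by (simp add: C_index mult_index[of _ k] dPR dZ R_def del: index_mult_mat(1))
  qed (simp_all add: dPR dZ dAB)

  have "\<exists>U V X r r\<^sub>1 q t\<^sub>1 \<sigma> \<xi> c sv.
        unitary_mat m U \<and> unitary_mat p V \<and> X \<in> carrier_mat n n \<and>
        gsvd_parameters m p k r r\<^sub>1 q t\<^sub>1 \<sigma> \<xi> c sv \<and>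
        A = U * (Sigma_A m k r q t\<^sub>1 c \<xi> @\<^sub>c 0\<^sub>m m (n - k)) * X \<and>
        B = V * (Sigma_B p k r r\<^sub>1 q t\<^sub>1 sv \<sigma> @\<^sub>c 0\<^sub>m p (n - k)) * X"
  proof -
    have "P\<^sup>\<dagger> * P + R\<^sup>\<dagger> * R = 1\<^sub>m k"
      using unitary_column_blocks[OF GH(1), of 0 k] kmn(1) by (simp add: P_def R_def)
    then obtain U V W r r\<^sub>1 q t\<^sub>1 \<sigma> \<xi> c sv where cs: "unitary m U" "unitary p V" "unitary k W"
        "gsvd_parameters m p k r r\<^sub>1 q t\<^sub>1 \<sigma> \<xi> c sv"
        "P = U * Sigma_A m k r q t\<^sub>1 c \<xi> * W" "R = V * Sigma_B p k r r\<^sub>1 q t\<^sub>1 sv \<sigma> * W"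
      using cs_decomposition[OF PR] by blast
    note dims = unitary_dim[OF cs(1)] unitary_dim[OF cs(2)] unitary_dim[OF cs(3)]
    have dS: "dim_row (Sigma_A m k r q t\<^sub>1 c \<xi>) = m" "dim_col (Sigma_A m k r q t\<^sub>1 c \<xi>) = k"
      "dim_row (Sigma_B p k r r\<^sub>1 q t\<^sub>1 sv \<sigma>) = p" "dim_col (Sigma_B p k r r\<^sub>1 q t\<^sub>1 sv \<sigma>) = k"
      using Sigma_dims[OF cs(4)] by auto
    \<comment> \<open>Square by appended zero rows; they meet the zero columns on the left.\<close>
    define X where "X = (W * Z) @\<^sub>r 0\<^sub>m (n - k) n"
    have "X \<in> carrier_mat n n"
      using kmn by (intro carrier_matI) (simp_all add: X_def dims dZ)
    moreover have "A = U * (Sigma_A m k r q t\<^sub>1 c \<xi> @\<^sub>c 0\<^sub>m m (n - k)) * X"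
      unfolding A_eq cs(5) X_def using kmn
      by (simp add: mult_assoc append_cols_mult_append_rows dims dS dZ zero_mult_dim add_zero_dim)
    moreover have "B = V * (Sigma_B p k r r\<^sub>1 q t\<^sub>1 sv \<sigma> @\<^sub>c 0\<^sub>m p (n - k)) * X"
      unfolding B_eq cs(6) X_def using kmn
      by (simp add: mult_assoc append_cols_mult_append_rows dims dS dZ zero_mult_dim add_zero_dim)
    ultimately show ?thesis
      using cs(1,2,4) unfolding unitary_mat_iff by blast
  qed
  moreover have "\<exists>U V X N\<^sub>A N\<^sub>B r r\<^sub>1 q t\<^sub>1 \<sigma> \<xi> c sv.
        unitary_mat m U \<and> unitary_mat p V \<and> X \<in> carrier_mat n n \<and> invertible_mat X \<and>
        N\<^sub>A \<in> carrier_mat m s \<and> N\<^sub>B \<in> carrier_mat p s \<and>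
        orthonormal_columns (N\<^sub>A @\<^sub>r N\<^sub>B) \<and>
        gsvd_parameters m p t r r\<^sub>1 q t\<^sub>1 \<sigma> \<xi> c sv \<and>
        A = U * (Sigma_A m t r q t\<^sub>1 c \<xi> @\<^sub>c (eps \<cdot>\<^sub>m N\<^sub>A) @\<^sub>c 0\<^sub>m m (n - k)) * X \<and>
        B = V * (Sigma_B p t r r\<^sub>1 q t\<^sub>1 sv \<sigma> @\<^sub>c (eps \<cdot>\<^sub>m N\<^sub>B) @\<^sub>c 0\<^sub>m p (n - k)) * X"
  proof -
    define P1 where "P1 = mat m t (\<lambda>(i,j). P $$ (i,j))"
    define R1 where "R1 = mat p t (\<lambda>(i,j). R $$ (i,j))"
    define P2 where "P2 = mat m s (\<lambda>(i,j). P $$ (i,t + j))"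
    define R2 where "R2 = mat p s (\<lambda>(i,j). R $$ (i,t + j))"
    have PG: "P1 = mat m t (\<lambda>(i,j). G $$ (i, 0 + j))" "R1 = mat p t (\<lambda>(i,j). G $$ (m + i, 0 + j))"
      "P2 = mat m s (\<lambda>(i,j). G $$ (i, t + j))" "R2 = mat p s (\<lambda>(i,j). G $$ (m + i, t + j))"
      using tk s by (auto simp: P1_def R1_def P2_def R2_def P_def R_def intro!: eq_matI)
    have PR1: "P1 \<in> carrier_mat m t" "R1 \<in> carrier_mat p t"
      by (simp_all add: P1_def R1_def)
    have dPR2: "dim_row P2 = m" "dim_col P2 = s" "dim_row R2 = p" "dim_col R2 = s"
      by (simp_all add: P2_def R2_def)
    have "P1\<^sup>\<dagger> * P1 + R1\<^sup>\<dagger> * R1 = 1\<^sub>m t"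
      unfolding PG by (rule unitary_column_blocks[OF GH(1)]) (use tk kmn in simp)
    then obtain U V W r r\<^sub>1 q t\<^sub>1 \<sigma> \<xi> c sv where cs: "unitary m U" "unitary p V" "unitary t W"
        "gsvd_parameters m p t r r\<^sub>1 q t\<^sub>1 \<sigma> \<xi> c sv"
        "P1 = U * Sigma_A m t r q t\<^sub>1 c \<xi> * W" "R1 = V * Sigma_B p t r r\<^sub>1 q t\<^sub>1 sv \<sigma> * W"
      using cs_decomposition[OF PR1] by blast
    note dims = unitary_dim[OF cs(1)] unitary_dim[OF cs(2)] unitary_dim[OF cs(3)]
    have dS: "Sigma_A m t r q t\<^sub>1 c \<xi> \<in> carrier_mat m t" "Sigma_B p t r r\<^sub>1 q t\<^sub>1 sv \<sigma> \<in> carrier_mat p t"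
      using Sigma_dims[OF cs(4)] by (auto intro: carrier_matI)
    define N\<^sub>A where "N\<^sub>A = U\<^sup>\<dagger> * P2"
    define N\<^sub>B where "N\<^sub>B = V\<^sup>\<dagger> * R2"
    have N: "N\<^sub>A \<in> carrier_mat m s" "N\<^sub>B \<in> carrier_mat p s"
      by (auto intro!: carrier_matI simp: N\<^sub>A_def N\<^sub>B_def dims dPR2)
    have "N\<^sub>A\<^sup>\<dagger> * N\<^sub>A + N\<^sub>B\<^sup>\<dagger> * N\<^sub>B = P2\<^sup>\<dagger> * P2 + R2\<^sup>\<dagger> * R2"
      by (simp add: N\<^sub>A_def N\<^sub>B_def adj_mult mult_assoc dims dPR2 unitary_cancel[OF cs(1)] unitary_cancel[OF cs(2)])
    also have "\<dots> = 1\<^sub>m s"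
      unfolding PG by (rule unitary_column_blocks[OF GH(1)]) (use tk kmn s in simp)
    finally have orth: "orthonormal_columns (N\<^sub>A @\<^sub>r N\<^sub>B)"
      using N by (simp add: orthonormal_columns_def gram_append_rows)
    \<comment> \<open>The value 1 beyond \<open>s\<close> keeps the right factor invertible.\<close>
    define e' where "e' i = (if i < s then Dual (in_part (d (t + i))) 0 else 1)" for i
    define e where "e i = dq_of_dual (e' i)" for i
    have d_inf: "st_part (d i) = 0" if "t \<le> i" "i < k" for i
      using d_app[of i] that by (simp add: appreciable_def)
    have e'_nz: "st_part (e' i) \<noteq> 0" for i
    proof (cases "i < s")
      case True
      then have "t + i < k"
        using s by simp
      then show ?thesis
        using d_pos[of "t + i"] d_inf[of "t + i"] True by (auto simp: e'_def less_dual_def)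
    qed (simp add: e'_def)
    let ?D = "dmat t t (\<lambda>i. dq_of_dual (d i))" and ?D' = "dmat t t (\<lambda>i. dq_of_dual (dinv (d i)))"
    let ?E = "dmat (n - t) (n - t) e" and ?E' = "dmat (n - t) (n - t) (\<lambda>i. dq_of_dual (dinv (e' i)))"
    have tn: "t \<le> n"
      using tk kmn by simp
    have inverse: "dq_of_dual x * dq_of_dual (dinv x) = 1" "dq_of_dual (dinv x) * dq_of_dual x = 1"
      if "st_part x \<noteq> 0" for x
      using mult_dinv[OF that] by (simp_all add: mult.commute flip: dq_of_dual_arith(3))
    have "d i \<noteq> 0 \<and> st_part (d i) \<noteq> 0" if "i < t" for i
      using d_app[of i] that tk by (auto simp: appreciable_def)
    then have DD: "?D * ?D' = 1\<^sub>m t" "?D' * ?D = 1\<^sub>m t"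
      unfolding dmat_mult one_mat_dmat by (auto intro!: dmat_cong simp: inverse)
    have EE: "?E * ?E' = 1\<^sub>m (n - t)" "?E' * ?E = 1\<^sub>m (n - t)"
      unfolding dmat_mult one_mat_dmat e_def using e'_nz by (auto intro!: dmat_cong simp: inverse)
    define Y where "Y = dsum (W * ?D) ?E"
    define Y' where "Y' = dsum (?D' * W\<^sup>\<dagger>) ?E'"
    have dY: "dim_row Y = n" "dim_col Y = n" "dim_row Y' = n" "dim_col Y' = n"
      using tn by (simp_all add: Y_def Y'_def dims)
    have "W * ?D * (?D' * W\<^sup>\<dagger>) = W * (?D * ?D') * W\<^sup>\<dagger>" "?D' * W\<^sup>\<dagger> * (W * ?D) = ?D' * ?D"
      by (simp_all add: mult_assoc dims unitary_cancel[OF cs(3)])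
    then have YY: "Y * Y' = 1\<^sub>m n" "Y' * Y = 1\<^sub>m n"
      unfolding Y_def Y'_def using tn
      by (simp_all add: dsum_mult dims DD EE unitary_cancel[OF cs(3)] dsum_one)
    define X where "X = Y * H\<^sup>\<dagger>"
    have X: "X \<in> carrier_mat n n"
      by (intro carrier_matI) (simp_all add: X_def dY dGH)
    moreover have "invertible_mat X"
    proof (rule invertible_matI[OF X])
      show "H * Y' \<in> carrier_mat n n"
        by (intro carrier_matI) (simp_all add: dY dGH)
      have "X * (H * Y') = Y * Y'"
        by (simp add: X_def mult_assoc dY dGH unitary_cancel[OF GH(2)])
      then show "X * (H * Y') = 1\<^sub>m n"
        using YY(1) by simp
      have "(H * Y') * X = H * ((Y' * Y) * H\<^sup>\<dagger>)"
        by (simp add: X_def mult_assoc dY dGH)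
      then show "(H * Y') * X = 1\<^sub>m n"
        unfolding YY(2) by (simp add: dGH unitary_cancel[OF GH(2)])
    qed
    moreover have "A = U * (Sigma_A m t r q t\<^sub>1 c \<xi> @\<^sub>c (eps \<cdot>\<^sub>m N\<^sub>A) @\<^sub>c 0\<^sub>m m (n - k)) * X"
    proof -
      have "U * (Sigma_A m t r q t\<^sub>1 c \<xi> @\<^sub>c (eps \<cdot>\<^sub>m N\<^sub>A) @\<^sub>c 0\<^sub>m m (n - k)) * Y = P * dmat k n (\<lambda>i. dq_of_dual (d i))"
        unfolding N\<^sub>A_def P2_def Y_def s
        by (rule infinitesimal_part_to_the_left[OF cs(1) PR(1) dS(1) cs(3) tk kmn(2) cs(5)[unfolded P1_def]])
          (use d_inf s in \<open>auto simp: e_def e'_def\<close>)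
      then show ?thesis
        unfolding A_eq X_def Z_def using tk kmn s carrier_matD[OF dS(1)] carrier_matD[OF N(1)]
        by (simp add: dims dY dGH dPR flip: mult_assoc)
    qed
    moreover have "B = V * (Sigma_B p t r r\<^sub>1 q t\<^sub>1 sv \<sigma> @\<^sub>c (eps \<cdot>\<^sub>m N\<^sub>B) @\<^sub>c 0\<^sub>m p (n - k)) * X"
    proof -
      have "V * (Sigma_B p t r r\<^sub>1 q t\<^sub>1 sv \<sigma> @\<^sub>c (eps \<cdot>\<^sub>m N\<^sub>B) @\<^sub>c 0\<^sub>m p (n - k)) * Y = R * dmat k n (\<lambda>i. dq_of_dual (d i))"
        unfolding N\<^sub>B_def R2_def Y_def s
        by (rule infinitesimal_part_to_the_left[OF cs(2) PR(2) dS(2) cs(3) tk kmn(2) cs(6)[unfolded R1_def]])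
          (use d_inf s in \<open>auto simp: e_def e'_def\<close>)
      then show ?thesis
        unfolding B_eq X_def Z_def using tk kmn s carrier_matD[OF dS(2)] carrier_matD[OF N(2)]
        by (simp add: dims dY dGH dPR flip: mult_assoc)
    qed
    ultimately show ?thesis
      using cs(1,2,4) N orth unfolding unitary_mat_iff by blast
  qed
  ultimately show ?thesis
    by blast
qed

end
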